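(* Let $0<T<\infty$ and $1<p<\infty$. For each origin-destination pair $st\in V\times V$, $s\ne t$, let $u_{st}\in L^p(0,T)$, $u_{st}\ge 0$ (possibly zero), be the corresponding inflow, extended by $0$ outside $[0,T]$, and suppose there is at least one directed $s$-$t$ path whenever $u_{st}$ is nonzero. Assume that $\tau_e>0$ on every link $e\in E$. Then there exists a (multiple origin-destination) dynamic equilibrium.
   Context: Network. $G=(V,E)$ is a finite directed graph without loops and with at most one edge from $v$ to $w$ for every pair of nodes; an edge (link) from $v$ to $w$ is written $e=vw$, and $\delta^+(v),\delta^-(v)$ are the sets of edges leaving and entering $v$. Each edge has a service rate $\nu_e>0$ and a travel time $\tau_e$. $\mathcal F_0(\mathbb R)$ is the set of nonnegative locally integrable functions on $\mathbb R$ that vanish a.e. on $(-\infty,0)$. Feasible flows over time. A feasible flow-over-time is a family of inflows $f_e^+=\sum_{st}f_{e,st}^+$ and outflows $f_e^-=\sum_{st}f_{e,st}^-$, $e\in E$, with $f_{e,st}^\pm\in\mathcal F_0(\mathbb R)$, satisfying the following. With $F_e^\pm(\theta)=\int_0^\theta f_e^\pm(\xi)\,d\xi$ and queue size $z_e(\theta)=F_e^+(\theta)-F_e^-(\theta+\tau_e)$, for almost all $\theta$ one has $f_e^-(\theta)\le\nu_e$ and $z_e(\theta)\ge 0$ for each $e$; and for each pair $st$, $\sum_{e\in\delta^+(v)}f_{e,st}^+(\theta)-\sum_{e\in\delta^-(v)}f_{e,st}^-(\theta)$ equals $u_{st}(\theta)$ for $v=s$ and $0$ for $v\in V\setminus\{s,t\}$.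 It is always assumed that queues operate at capacity: for each $e$ and almost all $\theta$, $f_e^-(\theta+\tau_e)=\nu_e$ if $z_e(\theta)>0$ and $f_e^-(\theta+\tau_e)=\min\{f_e^+(\theta),\nu_e\}$ otherwise. Travel times. $T_e(\theta)=\theta+z_e(\theta)/\nu_e+\tau_e$. For a directed path $P=(e_1,\dots,e_k)$, $\ell^P(\theta)=T_{e_k}\circ\cdots\circ T_{e_1}(\theta)$. For nodes $s,v$, $\ell_{sv}(\theta)=\min_P\ell^P(\theta)$ over all directed $s$-$v$ paths $P$, with $\ell_{ss}(\theta)=\theta$ (and $\ell_{sv}=+\infty$ if there is no such path). For $e=vw$, $\Theta_e^s$ is the set of all times $\theta$ at which $e$ is active for origin $s$, namely $\ell_{sw}(\theta)=T_e(\ell_{sv}(\theta))$. Dynamic equilibrium. A feasible flow-over-time is a dynamic equilibrium if for each pair $st$ and all $e=vw\in E$ (with $v$ reachable from $s$) we have $f_{e,st}^+(\xi)=0$ for almost all $\xi\in\ell_{sv}(\mathbb R\setminus\Theta_e^s)$. *)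

theory Defs
  imports "HOL-Analysis.Analysis" "Graph_Theory.Digraph" "Graph_Theory.Arc_Walk"
begin

section \<open>Function spaces\<close>

definition Lp_space :: "'a measure \<Rightarrow> real \<Rightarrow> ('a \<Rightarrow> real) set" where
  "Lp_space M p = {f \<in> borel_measurable M. integrable M (\<lambda>x. \<bar>f x\<bar> powr p)}"

definition locally_integrable :: "(real \<Rightarrow> real) \<Rightarrow> bool" where
  "locally_integrable f \<longleftrightarrow> (\<forall>K. compact K \<longrightarrow> f absolutely_integrable_on K)"

text \<open>
  Elements of function spaces are represented by actual functions on the reals, so that
  pointwise conditions are imposed almost everywhere.
\<close>

definition F0_space :: "(real \<Rightarrow> real) set" where
  "F0_space = {f. locally_integrable f \<and> (AE \<theta> in lebesgue. 0 \<le> f \<theta>) \<and>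
                  (AE \<theta> in lebesgue. \<theta> < 0 \<longrightarrow> f \<theta> = 0)}"

section \<open>Flows over time\<close>

text \<open>
  A flow is given by its link inflows \<open>fp e (s, t)\<close> and link outflows \<open>fm e (s, t)\<close>, one pair of
  functions of time for each arc \<open>e\<close> and each origin-destination pair \<open>(s, t)\<close>.
\<close>

type_synonym ('v, 'e) link_flow = "'e \<Rightarrow> 'v \<times> 'v \<Rightarrow> real \<Rightarrow> real"

definition od_pairs :: "('v, 'e) pre_digraph \<Rightarrow> ('v \<times> 'v) set" where
  "od_pairs G = {(s, t). s \<in> verts G \<and> t \<in> verts G \<and> s \<noteq> t}"

definition aggregate :: "('v, 'e) pre_digraph \<Rightarrow> ('v, 'e) link_flow \<Rightarrow> 'e \<Rightarrow> real \<Rightarrow> real" where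
  "aggregate G f e \<theta> = (\<Sum>st\<in>od_pairs G. f e st \<theta>)"

text \<open>The integral is oriented: for \<open>\<theta> < 0\<close> it is minus the integral over \<open>[\<theta>, 0]\<close>.\<close>

definition cumulative :: "(real \<Rightarrow> real) \<Rightarrow> real \<Rightarrow> real" where
  "cumulative g \<theta> = interval_lebesgue_integral lebesgue 0 (ereal \<theta>) g"

definition queue :: "('v, 'e) pre_digraph \<Rightarrow> ('e \<Rightarrow> real) \<Rightarrow>
    ('v, 'e) link_flow \<Rightarrow> ('v, 'e) link_flow \<Rightarrow> 'e \<Rightarrow> real \<Rightarrow> real" where
  "queue G \<tau> fp fm e \<theta> =
     cumulative (aggregate G fp e) \<theta> - cumulative (aggregate G fm e) (\<theta> + \<tau> e)"

definition feasible_flow :: "('v, 'e) pre_digraph \<Rightarrow> ('e \<Rightarrow> real) \<Rightarrow> ('e \<Rightarrow> real) \<Rightarrow>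
    ('v \<times> 'v \<Rightarrow> real \<Rightarrow> real) \<Rightarrow> ('v, 'e) link_flow \<Rightarrow> ('v, 'e) link_flow \<Rightarrow> bool" where
  "feasible_flow G \<nu> \<tau> u fp fm \<longleftrightarrow>
     (\<forall>e\<in>arcs G. \<forall>st\<in>od_pairs G. fp e st \<in> F0_space \<and> fm e st \<in> F0_space) \<and>
     (\<forall>e\<in>arcs G. AE \<theta> in lebesgue. aggregate G fm e \<theta> \<le> \<nu> e \<and> 0 \<le> queue G \<tau> fp fm e \<theta>) \<and>
     (\<forall>(s, t)\<in>od_pairs G. \<forall>v\<in>verts G - {t}. AE \<theta> in lebesgue.
        (\<Sum>e\<in>out_arcs G v. fp e (s, t) \<theta>) - (\<Sum>e\<in>in_arcs G v. fm e (s, t) \<theta>)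
          = (if v = s then u (s, t) \<theta> else 0))"

definition operates_at_capacity :: "('v, 'e) pre_digraph \<Rightarrow> ('e \<Rightarrow> real) \<Rightarrow> ('e \<Rightarrow> real) \<Rightarrow>
    ('v, 'e) link_flow \<Rightarrow> ('v, 'e) link_flow \<Rightarrow> bool" where
  "operates_at_capacity G \<nu> \<tau> fp fm \<longleftrightarrow>
     (\<forall>e\<in>arcs G. AE \<theta> in lebesgue.
        aggregate G fm e (\<theta> + \<tau> e) =
          (if queue G \<tau> fp fm e \<theta> > 0 then \<nu> e else min (aggregate G fp e \<theta>) (\<nu> e)))"

section \<open>Travel times and dynamic equilibrium\<close>

definition exit_time :: "('v, 'e) pre_digraph \<Rightarrow> ('e \<Rightarrow> real) \<Rightarrow> ('e \<Rightarrow> real) \<Rightarrow>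
    ('v, 'e) link_flow \<Rightarrow> ('v, 'e) link_flow \<Rightarrow> 'e \<Rightarrow> real \<Rightarrow> real" where
  "exit_time G \<nu> \<tau> fp fm e \<theta> = \<theta> + queue G \<tau> fp fm e \<theta> / \<nu> e + \<tau> e"

text \<open>
  The functions below take the family \<open>T\<close> of link exit times as a parameter. Along a path
  \<open>[e\<^sub>1, \<dots>, e\<^sub>k]\<close>, \<open>fold\<close> computes \<open>T e\<^sub>k (\<dots> (T e\<^sub>1 \<theta>))\<close>. There are finitely many directed paths
  (without repeated nodes) in a finite digraph, and the only one from \<open>s\<close> to \<open>s\<close> is \<open>[]\<close>, of
  arrival time \<open>\<theta>\<close>.
\<close>

definition path_arrival :: "('e \<Rightarrow> real \<Rightarrow> real) \<Rightarrow> 'e list \<Rightarrow> real \<Rightarrow> real" where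
  "path_arrival T P \<theta> = fold T P \<theta>"

definition earliest_arrival :: "('v, 'e) pre_digraph \<Rightarrow> ('e \<Rightarrow> real \<Rightarrow> real) \<Rightarrow>
    'v \<Rightarrow> 'v \<Rightarrow> real \<Rightarrow> ereal" where
  "earliest_arrival G T s v \<theta> =
     (if \<exists>P. pre_digraph.apath G s P v
      then ereal (Min ((\<lambda>P. path_arrival T P \<theta>) ` {P. pre_digraph.apath G s P v}))
      else \<infinity>)"

definition extend_infty :: "(real \<Rightarrow> real) \<Rightarrow> ereal \<Rightarrow> ereal" where
  "extend_infty g x = (if x = \<infinity> then \<infinity> else ereal (g (real_of_ereal x)))"

definition active_times :: "('v, 'e) pre_digraph \<Rightarrow> ('e \<Rightarrow> real \<Rightarrow> real) \<Rightarrow>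
    'v \<Rightarrow> 'e \<Rightarrow> real set" where
  "active_times G T s e =
     {\<theta>. earliest_arrival G T s (head G e) \<theta> =
          extend_infty (T e) (earliest_arrival G T s (tail G e) \<theta>)}"

definition dynamic_equilibrium :: "('v, 'e) pre_digraph \<Rightarrow> ('e \<Rightarrow> real) \<Rightarrow> ('e \<Rightarrow> real) \<Rightarrow>
    ('v \<times> 'v \<Rightarrow> real \<Rightarrow> real) \<Rightarrow> ('v, 'e) link_flow \<Rightarrow> ('v, 'e) link_flow \<Rightarrow> bool" where
  "dynamic_equilibrium G \<nu> \<tau> u fp fm \<longleftrightarrow>
     feasible_flow G \<nu> \<tau> u fp fm \<and> operates_at_capacity G \<nu> \<tau> fp fm \<and>
     (let T = exit_time G \<nu> \<tau> fp fm in
      \<forall>(s, t)\<in>od_pairs G. \<forall>e\<in>arcs G. (\<exists>P. pre_digraph.apath G s P (tail G e)) \<longrightarrow>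
        (AE \<xi> in lebesgue.
           ereal \<xi> \<in> earliest_arrival G T s (tail G e) ` (UNIV - active_times G T s e) \<longrightarrow>
             fp e (s, t) \<xi> = 0))"

end

theory Submission
  imports Defs "HOL-Library.Diagonal_Subsequence"
begin

text \<open>
  A flow is described by the cumulative inflows \<open>H c\<close> into the pairs \<open>c = ((s, t), P)\<close> of an
  origin-destination pair and a path. For a link with cumulative inflow \<open>F\<close> put
  \<open>slack \<nu> F \<theta> = (SUP \<xi>\<in>{..\<theta>}. \<nu> * \<xi> - F \<xi>)\<close>. Then the exit time is \<open>\<tau> + (F \<theta> + slack \<nu> F \<theta>) / \<nu>\<close>,
  which is explicit, monotone, and continuous in \<open>F\<close> for pointwise convergence. Since all travel times
  are at least some \<open>\<delta> > 0\<close>, network loading is causal and can be solved in time steps of length \<open>\<delta>\<close>; the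
  path arrival times depend continuously on \<open>H\<close>.

  On a time grid of width \<open>1 / N\<close>, Brouwer's theorem gives inflows that use only paths which are optimal
  up to \<open>O(1 / N)\<close> at the grid points. All these \<open>H c\<close> are dominated by the cumulative network inflow,
  so a subsequence converges pointwise, and in the limit \<open>H c\<close> is constant near every time at which
  \<open>c\<close> is not a shortest path.

  To pass from paths to links, consider times \<open>\<theta>\<close> where \<open>H c\<close> increases from the left. There the
  arrival times along \<open>c\<close> increase strictly, because no flow enters a link while its exit time is
  constant; therefore every prefix of \<open>c\<close> is shortest at \<open>\<theta>\<close>, and no flow of \<open>c\<close> enters a link at arrival
  times of origin times at which the link is inactive.
\<close>

text \<open>The exit time formula is \<open>\<theta> + queue / \<nu> + \<tau>\<close> with
  \<open>F + slack - \<nu> * \<theta>\<close> inserted for the queue; the term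
  \<open>\<theta>\<close> cancels, which makes the monotonicity visible. Cumulative functions keep
  the limits elementary: for monotone functions, pointwise convergence to continuous limits passes
  through suprema, compositions and flat exit times. Hence \<open>cum_flow\<close> asks for
  continuity only. Densities enter after the equilibrium inflows are fixed, by Radon-Nikodym: every
  increment is bounded by that of the network inflow or, behind a link, by \<open>\<nu>\<close>
  times the elapsed time. The unknown of the fixed point problem is not a flow but the finite vector
  of path arrival times at the grid points. Such a vector determines how each cell is split among
  the paths, the split determines the loading, and the loading returns arrival times. A positive
  tolerance makes the split continuous, so no set-valued map occurs; the tolerance shrinks with the
  cells. In the limit, optimality is recorded at single points of left increase, so that it can be
  combined with arrival times without tracking null sets.\<close>

definition cum_flow :: "(real \<Rightarrow> real) \<Rightarrow> bool" where
  "cum_flow F \<longleftrightarrow> mono F \<and> continuous_on UNIV F \<and> (\<forall>x\<le>0. F x = 0)"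

lemma cum_flowI:
  assumes "\<And>x y. x \<le> y \<Longrightarrow> F x \<le> F y" "continuous_on UNIV F" "\<And>x. x \<le> 0 \<Longrightarrow> F x = 0"
  shows "cum_flow F"
  using assms by (auto simp: cum_flow_def mono_def)

lemma cum_flowD:
  assumes "cum_flow F"
  shows cum_flow_mono: "x \<le> y \<Longrightarrow> F x \<le> F y"
    and cum_flow_cont: "continuous_on S F"
    and cum_flow_isCont: "isCont F x"
    and cum_flow_zero: "x \<le> 0 \<Longrightarrow> F x = 0"
    and cum_flow_nonneg: "0 \<le> F x"
proof -
  show m: "x \<le> y \<Longrightarrow> F x \<le> F y" for x y using assms by (auto simp: cum_flow_def mono_def)
  show "continuous_on S F" using assms continuous_on_subset by (auto simp: cum_flow_def)
  show "isCont F x" using assms continuous_on_eq_continuous_at[of UNIV F] by (auto simp: cum_flow_def)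
  show z: "x \<le> 0 \<Longrightarrow> F x = 0" for x using assms by (auto simp: cum_flow_def)
  show "0 \<le> F x" using m[of 0 x] z[of 0] z[of x] by (cases "x \<le> 0") auto
qed

lemma cum_flow_0 [simp]: "cum_flow (\<lambda>_. 0)"
  by (rule cum_flowI) auto

lemma cum_flow_sum:
  assumes "\<And>i. i \<in> I \<Longrightarrow> cum_flow (F i)"
  shows "cum_flow (\<lambda>x. \<Sum>i\<in>I. F i x)"
proof (rule cum_flowI)
  show "continuous_on UNIV (\<lambda>x. \<Sum>i\<in>I. F i x)"
    by (rule continuous_on_sum) (rule cum_flow_cont, rule assms)
  show "(\<Sum>i\<in>I. F i x) \<le> (\<Sum>i\<in>I. F i y)" if "x \<le> y" for x y
    by (rule sum_mono, rule cum_flow_mono[OF assms that])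
  show "(\<Sum>i\<in>I. F i x) = 0" if "x \<le> 0" for x
    by (rule sum.neutral) (use cum_flow_zero[OF assms that] in blast)
qed

section \<open>A single fluid queue\<close>

text \<open>The reflection map of the queue: \<open>queue \<theta> = F \<theta> + slack \<nu> F \<theta> - \<nu> * \<theta>\<close>, and the cumulative
  outflow at time \<open>\<theta> + \<tau>\<close> is \<open>\<nu> * \<theta> - slack \<nu> F \<theta>\<close>.\<close>

definition slack :: "real \<Rightarrow> (real \<Rightarrow> real) \<Rightarrow> real \<Rightarrow> real" where
  "slack \<nu> F \<theta> = (SUP \<xi>\<in>{..\<theta>}. \<nu> * \<xi> - F \<xi>)"

definition queue_exit :: "real \<Rightarrow> real \<Rightarrow> (real \<Rightarrow> real) \<Rightarrow> real \<Rightarrow> real" where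
  "queue_exit \<nu> \<tau> F \<theta> = \<tau> + (F \<theta> + slack \<nu> F \<theta>) / \<nu>"

context
  fixes \<nu> \<tau> :: real and F :: "real \<Rightarrow> real"
  assumes nu: "\<nu> > 0" and F: "cum_flow F"
begin

lemma slack_upper:
  assumes "\<xi> \<le> \<theta>" shows "\<nu> * \<xi> - F \<xi> \<le> slack \<nu> F \<theta>"
  unfolding slack_def
proof (rule cSUP_upper)
  show "bdd_above ((\<lambda>\<xi>. \<nu> * \<xi> - F \<xi>) ` {..\<theta>})"
  proof (rule bdd_aboveI2[where M = "\<nu> * \<theta>"])
    fix x assume "x \<in> {..\<theta>}"
    then have "\<nu> * x \<le> \<nu> * \<theta>" using nu by simp
    then show "\<nu> * x - F x \<le> \<nu> * \<theta>" using cum_flow_nonneg[OF F, of x] by linarith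
  qed
qed (use assms in auto)

lemma slack_least:
  assumes "\<And>\<xi>. \<xi> \<le> \<theta> \<Longrightarrow> \<nu> * \<xi> - F \<xi> \<le> B" shows "slack \<nu> F \<theta> \<le> B"
  unfolding slack_def by (rule cSUP_least) (use assms in auto)

lemma slack_mono: "a \<le> b \<Longrightarrow> slack \<nu> F a \<le> slack \<nu> F b"
  by (rule slack_least) (auto intro: slack_upper)

text \<open>A point of \<open>(a, b]\<close> beats \<open>a\<close> by at most
  \<open>\<nu> * (b - a)\<close>, because \<open>F\<close> does not decrease. In terms of the
  outflow \<open>\<nu> * \<theta> - slack \<nu> F \<theta>\<close>, this bound says that it is
  monotone, and \<open>slack_mono\<close> that its rate is at most \<open>\<nu>\<close>.\<close>

lemma slack_lipschitz:
  assumes "a \<le> b" shows "slack \<nu> F b \<le> slack \<nu> F a + \<nu> * (b - a)"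
proof (rule slack_least)
  fix \<xi> assume x: "\<xi> \<le> b"
  show "\<nu> * \<xi> - F \<xi> \<le> slack \<nu> F a + \<nu> * (b - a)"
  proof (cases "\<xi> \<le> a")
    case True
    have "0 \<le> \<nu> * (b - a)" using nu assms by simp
    then show ?thesis using slack_upper[OF True] by linarith
  next
    case False
    have "\<nu> * \<xi> \<le> \<nu> * b" "F a \<le> F \<xi>" using x nu False cum_flow_mono[OF F] by auto
    then show ?thesis using slack_upper[of a a] by (simp add: algebra_simps)
  qed
qed

lemma slack_le: "slack \<nu> F \<theta> \<le> \<nu> * \<theta>"
proof (rule slack_least)
  fix \<xi> assume "\<xi> \<le> \<theta>"
  then have "\<nu> * \<xi> \<le> \<nu> * \<theta>" using nu by auto
  then show "\<nu> * \<xi> - F \<xi> \<le> \<nu> * \<theta>" using cum_flow_nonneg[OF F, of \<xi>] by linarith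
qed

lemma slack_nonpos: "\<theta> \<le> 0 \<Longrightarrow> slack \<nu> F \<theta> = \<nu> * \<theta>"
  using slack_le[of \<theta>] slack_upper[of \<theta> \<theta>] cum_flow_zero[OF F, of \<theta>] by auto

lemma continuous_slack: "continuous_on S (slack \<nu> F)"
proof -
  have "\<nu>-lipschitz_on S (slack \<nu> F)"
  proof (rule lipschitz_onI)
    fix x y show "dist (slack \<nu> F x) (slack \<nu> F y) \<le> \<nu> * dist x y"
    proof (cases "x \<le> y")
      case True
      then show ?thesis using slack_lipschitz[OF True] slack_mono[OF True] by (simp add: dist_real_def)
    next
      case False
      then have "y \<le> x" by simp
      then show ?thesis using slack_lipschitz[of y x] slack_mono[of y x] by (simp add: dist_real_def)
    qed
  qed (use nu in auto)
  then show ?thesis by (rule lipschitz_on_continuous_on)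
qed

lemma slack_attained: "\<exists>\<xi>\<le>\<theta>. slack \<nu> F \<theta> = \<nu> * \<xi> - F \<xi>"
proof -
  \<comment> \<open>Left of 0 the inflow vanishes and \<open>\<nu> * y - F y\<close> is increasing,
    so the supremum is attained on this compact interval.\<close>
  let ?m = "min \<theta> 0"
  have "\<exists>x\<in>{?m..\<theta>}. \<forall>y\<in>{?m..\<theta>}. \<nu> * y - F y \<le> \<nu> * x - F x"
    by (rule continuous_attains_sup) (auto intro!: continuous_intros cum_flow_cont[OF F])
  then obtain x where x: "x \<in> {?m..\<theta>}" "\<And>y. y \<in> {?m..\<theta>} \<Longrightarrow> \<nu> * y - F y \<le> \<nu> * x - F x" by blast
  have "slack \<nu> F \<theta> \<le> \<nu> * x - F x"
  proof (rule slack_least)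
    fix y assume y: "y \<le> \<theta>"
    show "\<nu> * y - F y \<le> \<nu> * x - F x"
    proof (cases "y \<ge> ?m")
      case False
      then have "\<nu> * y - F y \<le> \<nu> * ?m - F ?m"
        using nu cum_flow_zero[OF F, of y] cum_flow_zero[OF F, of ?m] by auto
      also have "\<dots> \<le> \<nu> * x - F x" by (rule x(2)) auto
      finally show ?thesis .
    qed (use x(2) y in auto)
  qed
  then show ?thesis using slack_upper[of x \<theta>] x(1) by (intro exI[of _ x]) auto
qed

text \<open>The difference of the two sides is the growth of \<open>slack\<close>, which is
  nonnegative. Consequently nothing enters while the exit time stands still; the treatment of shares
  and of strict arrival times rests on this.\<close>

lemma queue_exit_diff:
  assumes "a \<le> b" shows "F b - F a \<le> \<nu> * (queue_exit \<nu> \<tau> F b - queue_exit \<nu> \<tau> F a)"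
  using slack_mono[OF assms] nu by (simp add: queue_exit_def field_simps)

lemma queue_exit_mono: "a \<le> b \<Longrightarrow> queue_exit \<nu> \<tau> F a \<le> queue_exit \<nu> \<tau> F b"
  using slack_mono[of a b] cum_flow_mono[OF F, of a b] nu by (simp add: queue_exit_def divide_right_mono)

lemma queue_exit_ge: "\<theta> + \<tau> \<le> queue_exit \<nu> \<tau> F \<theta>"
  using slack_upper[of \<theta> \<theta>] nu by (simp add: queue_exit_def field_simps)

lemma queue_exit_le: "queue_exit \<nu> \<tau> F \<theta> \<le> \<theta> + \<tau> + F \<theta> / \<nu>"
  using slack_le[of \<theta>] nu by (simp add: queue_exit_def field_simps)

lemma continuous_queue_exit: "continuous_on S (queue_exit \<nu> \<tau> F)"
  unfolding queue_exit_def using nu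
  by (intro continuous_intros cum_flow_cont[OF F] continuous_slack) auto

lemma queue_exit_nonpos: "\<theta> \<le> 0 \<Longrightarrow> queue_exit \<nu> \<tau> F \<theta> = \<theta> + \<tau>"
  using nu by (simp add: queue_exit_def slack_nonpos cum_flow_zero[OF F])

lemma queue_exit_surj: "\<exists>\<theta>. queue_exit \<nu> \<tau> F \<theta> = \<xi>"
proof -
  let ?a = "min 0 (\<xi> - \<tau>)" and ?b = "\<xi> - \<tau>"
  have "queue_exit \<nu> \<tau> F ?a \<le> \<xi>" by (subst queue_exit_nonpos) auto
  moreover have "\<xi> \<le> queue_exit \<nu> \<tau> F ?b" using queue_exit_ge[of ?b] by simp
  ultimately show ?thesis
    using IVT'[of "queue_exit \<nu> \<tau> F" ?a \<xi> ?b, OF _ _ _ continuous_queue_exit] by auto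
qed

text \<open>First in, first out: what has left by \<open>\<theta> + \<tau>\<close> is what had
  entered by \<open>a\<close>. After \<open>a\<close>, the quantity
  \<open>\<nu> * \<xi> - F \<xi>\<close> stays below \<open>\<nu> * \<theta> - F a\<close>, which is
  \<open>slack \<nu> F a\<close>, so \<open>slack\<close> does not grow between \<open>a\<close> and
  \<open>\<theta>\<close>.\<close>

lemma slack_at_exit:
  assumes "queue_exit \<nu> \<tau> F a = \<theta> + \<tau>"
  shows "F a = \<nu> * \<theta> - slack \<nu> F \<theta>"
proof -
  have eq: "F a + slack \<nu> F a = \<nu> * \<theta>" using assms nu by (simp add: queue_exit_def field_simps)
  have le: "a \<le> \<theta>" using queue_exit_ge[of a] assms by simp
  have "slack \<nu> F \<theta> \<le> slack \<nu> F a"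
  proof (rule slack_least)
    fix \<xi> assume x: "\<xi> \<le> \<theta>"
    show "\<nu> * \<xi> - F \<xi> \<le> slack \<nu> F a"
    proof (cases "\<xi> \<le> a")
      case False
      have "\<nu> * \<xi> \<le> \<nu> * \<theta>" "F a \<le> F \<xi>" using x nu False cum_flow_mono[OF F] by auto
      then show ?thesis using eq by linarith
    qed (rule slack_upper)
  qed
  then show ?thesis using slack_mono[OF le] eq by simp
qed

end

lemma queue_exit_cong:
  assumes "\<And>x. x \<le> \<theta> \<Longrightarrow> F x = G x" shows "queue_exit \<nu> \<tau> F \<theta> = queue_exit \<nu> \<tau> G \<theta>"
proof -
  have "slack \<nu> F \<theta> = slack \<nu> G \<theta>"
    unfolding slack_def by (rule SUP_cong) (use assms in auto)
  then show ?thesis unfolding queue_exit_def using assms[of \<theta>] by simp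
qed

text \<open>A maximiser for the limit gives the lower bound. For the upper bound \<open>y\<close> is
  replaced by the grid point below it: this costs at most \<open>\<nu> * \<theta> / m\<close>, since
  each \<open>Fn n\<close> is monotone, so convergence at \<open>m + 1\<close> points is
  enough.\<close>

lemma slack_tendsto:
  assumes nu: "\<nu> > 0" and F: "cum_flow F" and Fn: "\<And>n. cum_flow (Fn n)"
    and lim: "\<And>x. (\<lambda>n. Fn n x) \<longlonglongrightarrow> F x"
  shows "(\<lambda>n. slack \<nu> (Fn n) \<theta>) \<longlonglongrightarrow> slack \<nu> F \<theta>"
proof (cases "\<theta> \<le> 0")
  case True
  then show ?thesis by (simp add: slack_nonpos nu F Fn)
next
  case False
  show ?thesis
  proof (rule LIMSEQ_I)
    fix r :: real assume r: "r > 0"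
    obtain x where x: "x \<le> \<theta>" "slack \<nu> F \<theta> = \<nu> * x - F x" using slack_attained[OF nu F] by blast
    obtain m :: nat where m: "m > 0" "\<nu> * \<theta> / m < r / 2"
    proof -
      obtain m :: nat where m: "\<nu> * \<theta> / (r / 2) < m" using reals_Archimedean2 by blast
      have "0 < \<nu> * \<theta> / (r / 2)" using False nu r by auto
      with m have "m > 0" by (auto intro!: gr0I)
      moreover have "\<nu> * \<theta> < r / 2 * m" using m r by (simp add: field_simps)
      ultimately have "m > 0" "\<nu> * \<theta> / m < r / 2" by (auto simp: pos_divide_less_eq)
      then show ?thesis by (rule that)
    qed
    define g where "g = (\<lambda>j::nat. real j * \<theta> / m)"
    have ev1: "\<forall>\<^sub>F n in sequentially. \<bar>Fn n x - F x\<bar> < r / 2"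
      using tendstoD[OF lim[of x], of "r/2"] r by (simp add: dist_real_def)
    have ev2: "\<forall>\<^sub>F n in sequentially. \<forall>j\<in>{..m}. \<bar>Fn n (g j) - F (g j)\<bar> < r / 2"
    proof (intro eventually_ball_finite ballI)
      fix j show "\<forall>\<^sub>F n in sequentially. \<bar>Fn n (g j) - F (g j)\<bar> < r / 2"
        using tendstoD[OF lim[of "g j"], of "r/2"] r by (simp add: dist_real_def)
    qed auto
    have "\<forall>\<^sub>F n in sequentially. norm (slack \<nu> (Fn n) \<theta> - slack \<nu> F \<theta>) < r"
      using ev1 ev2
    proof eventually_elim
      case (elim n)
      have 1: "slack \<nu> F \<theta> < slack \<nu> (Fn n) \<theta> + r / 2"
        using slack_upper[OF nu Fn x(1), of n] x(2) elim(1) by linarith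
      have "slack \<nu> (Fn n) \<theta> \<le> slack \<nu> F \<theta> + r / 2 + \<nu> * \<theta> / m"
      proof (rule slack_least[OF nu Fn])
        fix y assume y: "y \<le> \<theta>"
        show "\<nu> * y - Fn n y \<le> slack \<nu> F \<theta> + r / 2 + \<nu> * \<theta> / m"
        proof (cases "y \<le> 0")
          case True
          have "0 \<le> \<nu> * \<theta> / m" using nu False by auto
          then show ?thesis
            using slack_upper[OF nu F y] cum_flow_zero[OF Fn True, of n] cum_flow_zero[OF F True] r by linarith
        next
          case y0: False
          define j where "j = nat \<lfloor>y * m / \<theta>\<rfloor>"
          have pos: "0 \<le> y * m / \<theta>" using y0 False by auto
          have jle: "real j \<le> y * m / \<theta>" unfolding j_def using pos by simp
          have jgt: "y * m / \<theta> < real j + 1" unfolding j_def using pos by linarith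
          have "y * m / \<theta> \<le> m" using y False m by (auto simp: field_simps)
          then have jm: "j \<le> m" using jle by linarith
          have gy: "g j \<le> y" using jle False m unfolding g_def by (simp add: field_simps)
          have yg: "y \<le> g j + \<theta> / m" using jgt False m unfolding g_def by (simp add: field_simps)
          have "\<nu> * y \<le> \<nu> * (g j + \<theta> / m)" using yg nu by auto
          then have "\<nu> * y - Fn n y \<le> \<nu> * g j + \<nu> * \<theta> / m - Fn n (g j)"
            using cum_flow_mono[OF Fn gy, of n] by (simp add: algebra_simps)
          also have "\<dots> \<le> \<nu> * g j - F (g j) + r / 2 + \<nu> * \<theta> / m"
          proof -
            have "\<bar>Fn n (g j) - F (g j)\<bar> < r / 2" using elim(2) jm by blast
            then show ?thesis by linarith
          qed
          also have "\<nu> * g j - F (g j) \<le> slack \<nu> F \<theta>"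
            using gy y by (intro slack_upper[OF nu F]) auto
          finally show ?thesis by simp
        qed
      qed
      then show ?case unfolding real_norm_def using 1 m(2) by linarith
    qed
    then show "\<exists>no. \<forall>n\<ge>no. norm (slack \<nu> (Fn n) \<theta> - slack \<nu> F \<theta>) < r"
      by (simp add: eventually_sequentially)
  qed
qed

lemma queue_exit_tendsto:
  assumes "\<nu> > 0" "cum_flow F" "\<And>n. cum_flow (Fn n)" "\<And>x. (\<lambda>n. Fn n x) \<longlonglongrightarrow> F x"
  shows "(\<lambda>n. queue_exit \<nu> \<tau> (Fn n) \<theta>) \<longlonglongrightarrow> queue_exit \<nu> \<tau> F \<theta>"
  unfolding queue_exit_def using slack_tendsto[OF assms, of \<theta>] assms(4)[of \<theta>] assms(1)
  by (intro tendsto_add tendsto_divide tendsto_const) auto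

text \<open>The cumulative outflow of a share \<open>K\<close> of the inflow, for link exit time \<open>T\<close>. The choice of the
  entrance time is irrelevant because \<open>K\<close> is constant wherever \<open>T\<close> is.\<close>

definition through :: "(real \<Rightarrow> real) \<Rightarrow> (real \<Rightarrow> real) \<Rightarrow> real \<Rightarrow> real" where
  "through T K \<xi> = K (SOME \<theta>. T \<theta> = \<xi>)"

lemma through_eq:
  fixes K T :: "real \<Rightarrow> real"
  assumes "\<And>a b. a \<le> b \<Longrightarrow> \<bar>K b - K a\<bar> \<le> \<nu> * (T b - T a)"
  shows "through T K (T \<theta>) = K \<theta>"
proof -
  define x where "x = (SOME x. T x = T \<theta>)"
  have "T x = T \<theta>" unfolding x_def by (rule someI[of "\<lambda>x. T x = T \<theta>", OF refl])
  then have z: "T \<theta> - T x = 0" "T x - T \<theta> = 0" by simp_all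
  have "x \<le> \<theta> \<or> \<theta> \<le> x" by (rule linear)
  then have "K x = K \<theta>"
    using assms[of x \<theta>] assms[of \<theta> x] unfolding z by fastforce
  then show ?thesis unfolding through_def x_def by simp
qed

text \<open>All that a single share of the inflow has to know about the queue: it is constant
  wherever the exit time is, and it leaves at a rate of at most \<open>\<nu>\<close>. A share
  inherits this from the total inflow of the link.\<close>

definition carries :: "real \<Rightarrow> (real \<Rightarrow> real) \<Rightarrow> (real \<Rightarrow> real) \<Rightarrow> bool" where
  "carries \<nu> T K \<longleftrightarrow> (\<forall>a b. a \<le> b \<longrightarrow> K b - K a \<le> \<nu> * (T b - T a))"

lemma through_exit:
  assumes "carries \<nu> T K" "cum_flow K"
  shows "through T K (T \<theta>) = K \<theta>"
proof (rule through_eq[of K \<nu>])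
  fix a b :: real assume "a \<le> b"
  then show "\<bar>K b - K a\<bar> \<le> \<nu> * (T b - T a)"
    using assms(1) cum_flow_mono[OF assms(2), of a b] by (simp add: carries_def)
qed

lemma through_lipschitz:
  assumes K: "carries \<nu> T K" "cum_flow K" and T: "\<And>\<xi>. \<exists>\<theta>. T \<theta> = \<xi>" "mono T" and "x \<le> y"
  shows "through T K x \<le> through T K y" "through T K y \<le> through T K x + \<nu> * (y - x)"
proof -
  obtain a where a: "T a = x" using T(1) by blast
  obtain b where b: "T b = y" using T(1) by blast
  have "through T K x \<le> through T K y \<and> through T K y \<le> through T K x + \<nu> * (y - x)"
  proof (cases "a \<le> b")
    case True
    have "K b - K a \<le> \<nu> * (y - x)" using K(1) True a b by (auto simp: carries_def)
    then show ?thesis using through_exit[OF K, of a] through_exit[OF K, of b] a b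
        cum_flow_mono[OF K(2) True] by simp
  next
    case False
    then have "y \<le> x" using a b monoD[OF T(2), of b a] by simp
    then show ?thesis using \<open>x \<le> y\<close> by simp
  qed
  then show "through T K x \<le> through T K y" "through T K y \<le> through T K x + \<nu> * (y - x)" by auto
qed

lemma through_abs_lipschitz:
  assumes K: "carries \<nu> T K" "cum_flow K" and T: "\<And>\<xi>. \<exists>\<theta>. T \<theta> = \<xi>" "mono T"
  shows "\<bar>through T K x - through T K y\<bar> \<le> \<nu> * \<bar>x - y\<bar>"
proof (cases "x \<le> y")
  case True
  then show ?thesis using through_lipschitz[OF K T True] by simp
next
  case False
  then have "y \<le> x" by simp
  then show ?thesis using through_lipschitz[OF K T \<open>y \<le> x\<close>] by simp
qed

lemma cum_flow_through:
  assumes K: "carries \<nu> T K" "cum_flow K" and T: "\<And>\<xi>. \<exists>\<theta>. T \<theta> = \<xi>" "mono T" "\<And>\<theta>. \<theta> \<le> T \<theta>"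
    and nu: "0 < \<nu>"
  shows "cum_flow (through T K)"
proof (rule cum_flowI)
  have "\<nu>-lipschitz_on UNIV (through T K)"
    using nu through_abs_lipschitz[OF K T(1,2)] by (intro lipschitz_onI) (simp_all add: dist_real_def)
  then show "continuous_on UNIV (through T K)" by (rule lipschitz_on_continuous_on)
  show "through T K x \<le> through T K y" if "x \<le> y" for x y
    using through_lipschitz[OF K T(1,2) that] by simp
  show "through T K x = 0" if "x \<le> 0" for x
  proof -
    obtain a where a: "T a = x" using T(1) by blast
    then have "a \<le> 0" using T(3)[of a] that by simp
    then show ?thesis using through_exit[OF K, of a] a cum_flow_zero[OF K(2)] by simp
  qed
qed

text \<open>Entrance times of \<open>\<xi>\<close> under \<open>Tn n\<close> need not converge, as
  \<open>T\<close> may be flat. Therefore an entrance time \<open>a\<close> for the limit is fixed: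
  \<open>Kn n a\<close> is the outflow at \<open>Tn n a\<close>, which tends to
  \<open>\<xi>\<close>, and all the outflows share the Lipschitz constant
  \<open>\<nu>\<close>.\<close>

lemma through_tendsto:
  assumes K: "carries \<nu> T K" "cum_flow K" and T: "\<And>\<xi>. \<exists>\<theta>. T \<theta> = \<xi>"
    and Kn: "\<And>n. carries \<nu> (Tn n) (Kn n)" "\<And>n. cum_flow (Kn n)"
    and Tn: "\<And>n \<xi>. \<exists>\<theta>. Tn n \<theta> = \<xi>" "\<And>n. mono (Tn n)"
    and limK: "\<And>x. (\<lambda>n. Kn n x) \<longlonglongrightarrow> K x" and limT: "\<And>x. (\<lambda>n. Tn n x) \<longlonglongrightarrow> T x"
  shows "(\<lambda>n. through (Tn n) (Kn n) \<xi>) \<longlonglongrightarrow> through T K \<xi>"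
proof -
  obtain a where a: "T a = \<xi>" using T by blast
  have "(\<lambda>n. through (Tn n) (Kn n) \<xi> - Kn n a) \<longlonglongrightarrow> 0"
  proof (rule Lim_null_comparison)
    show "\<forall>\<^sub>F n in sequentially. norm (through (Tn n) (Kn n) \<xi> - Kn n a) \<le> \<nu> * \<bar>\<xi> - Tn n a\<bar>"
    proof (intro always_eventually allI)
      fix n show "norm (through (Tn n) (Kn n) \<xi> - Kn n a) \<le> \<nu> * \<bar>\<xi> - Tn n a\<bar>"
        using through_abs_lipschitz[OF Kn Tn, of n \<xi> "Tn n a"] through_exit[OF Kn, of n a] by simp
    qed
    have "(\<lambda>n. \<nu> * \<bar>\<xi> - Tn n a\<bar>) \<longlonglongrightarrow> \<nu> * \<bar>\<xi> - T a\<bar>"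
      using limT[of a] by (intro tendsto_mult tendsto_rabs tendsto_diff tendsto_const)
    then show "(\<lambda>n. \<nu> * \<bar>\<xi> - Tn n a\<bar>) \<longlonglongrightarrow> 0" using a by simp
  qed
  from tendsto_add[OF this limK[of a]] show ?thesis
    using through_exit[OF K, of a] a by simp
qed

text \<open>Monotonicity takes the place of uniform convergence: the value at \<open>xn n\<close> is
  squeezed between the values at two fixed points on either side of \<open>x\<close>. This is what
  allows limits in compositions of exit times.\<close>

lemma tendsto_mono_continuous:
  fixes f :: "real \<Rightarrow> real"
  assumes fn: "\<And>n. mono (fn n)" and f: "isCont f x"
    and lim: "\<And>y. (\<lambda>n. fn n y) \<longlonglongrightarrow> f y" and xn: "xn \<longlonglongrightarrow> x"
  shows "(\<lambda>n. fn n (xn n)) \<longlonglongrightarrow> f x"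
proof (rule LIMSEQ_I)
  fix r :: real assume r: "r > 0"
  obtain d where d: "d > 0" "\<And>y. \<bar>y - x\<bar> < d \<Longrightarrow> \<bar>f y - f x\<bar> < r / 2"
    using f[unfolded continuous_at_eps_delta, rule_format, of "r / 2"] r by (auto simp: dist_real_def)
  let ?a = "x - d / 2" and ?b = "x + d / 2"
  have fa: "\<bar>f ?a - f x\<bar> < r / 2" and fb: "\<bar>f ?b - f x\<bar> < r / 2" using d by auto
  have "\<forall>\<^sub>F n in sequentially. \<bar>fn n ?a - f ?a\<bar> < r / 2" "\<forall>\<^sub>F n in sequentially. \<bar>fn n ?b - f ?b\<bar> < r / 2"
    "\<forall>\<^sub>F n in sequentially. \<bar>xn n - x\<bar> < d / 2"
    using tendstoD[OF lim[of ?a], of "r/2"] tendstoD[OF lim[of ?b], of "r/2"] tendstoD[OF xn, of "d/2"] r d(1)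
    by (auto simp: dist_real_def)
  then have "\<forall>\<^sub>F n in sequentially. norm (fn n (xn n) - f x) < r"
  proof eventually_elim
    case (elim n)
    have "?a \<le> xn n" "xn n \<le> ?b" using elim(3) by linarith+
    then have "fn n ?a \<le> fn n (xn n)" "fn n (xn n) \<le> fn n ?b" using fn by (auto simp: mono_def)
    then show ?case unfolding real_norm_def using elim(1,2) fa fb by linarith
  qed
  then show "\<exists>no. \<forall>n\<ge>no. norm (fn n (xn n) - f x) < r" by (simp add: eventually_sequentially)
qed

lemma fold_tendsto:
  fixes T :: "'e \<Rightarrow> real \<Rightarrow> real"
  assumes "\<And>n e. mono (Tn n e)" "\<And>e x. isCont (T e) x"
    and "\<And>e y. (\<lambda>n. Tn n e y) \<longlonglongrightarrow> T e y" and "xn \<longlonglongrightarrow> x"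
  shows "(\<lambda>n. fold (Tn n) P (xn n)) \<longlonglongrightarrow> fold T P x"
  using assms(4)
proof (induction P arbitrary: xn x)
  case (Cons e P)
  have "(\<lambda>n. Tn n e (xn n)) \<longlonglongrightarrow> T e x"
    by (rule tendsto_mono_continuous[OF assms(1-3) Cons.prems])
  from Cons.IH[OF this] show ?case by simp
qed simp

lemma fold_mono:
  fixes T :: "'e \<Rightarrow> real \<Rightarrow> real"
  assumes "\<And>e. e \<in> set P \<Longrightarrow> mono (T e)" "x \<le> y"
  shows "fold T P x \<le> fold T P y"
  using assms
proof (induction P arbitrary: x y)
  case (Cons e P)
  have "T e x \<le> T e y" using Cons.prems by (intro monoD[of "T e"]) auto
  then show ?case using Cons.IH[of "T e x" "T e y"] Cons.prems(1) by simp
qed simp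

lemma fold_ge:
  fixes T :: "'e \<Rightarrow> real \<Rightarrow> real"
  assumes "\<And>e x. e \<in> set P \<Longrightarrow> x \<le> T e x"
  shows "x \<le> fold T P x"
  using assms
proof (induction P arbitrary: x)
  case (Cons e P)
  have "x \<le> T e x" by (rule Cons.prems) simp
  also have "T e x \<le> fold T P (T e x)" by (rule Cons.IH) (rule Cons.prems, simp)
  finally show ?case by simp
qed simp

lemma continuous_fold:
  fixes T :: "'e \<Rightarrow> real \<Rightarrow> real"
  assumes "\<And>e. e \<in> set P \<Longrightarrow> continuous_on UNIV (T e)"
  shows "continuous_on UNIV (fold T P)"
  using assms
proof (induction P)
  case (Cons e P)
  have "continuous_on UNIV (fold T P \<circ> T e)"
    by (rule continuous_on_compose) (use Cons in \<open>auto intro: continuous_on_subset\<close>)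
  then show ?case by (simp add: o_def)
qed (simp add: id_def)

section \<open>Densities of monotone functions\<close>

text \<open>Integrals over compact intervals determine the measure, and finiteness is built in. As
  \<open>ennreal\<close> truncates a negative increment to 0, the rules below ask for monotonicity
  of \<open>F\<close> where increments are added or turned back into reals.\<close>

definition density_of :: "(real \<Rightarrow> real) \<Rightarrow> (real \<Rightarrow> real) \<Rightarrow> bool" where
  "density_of f F \<longleftrightarrow> f \<in> borel_measurable borel \<and> (\<forall>x. 0 \<le> f x) \<and>
     (\<forall>a b. a \<le> b \<longrightarrow> (\<integral>\<^sup>+x. ennreal (f x) * indicator {a..b} x \<partial>lborel) = ennreal (F b - F a))"

lemma density_ofD:
  assumes "density_of f F"
  shows density_of_measurable: "f \<in> borel_measurable borel"
    and density_of_nonneg: "0 \<le> f x"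
    and density_of_Icc: "a \<le> b \<Longrightarrow> emeasure (density lborel (\<lambda>x. ennreal (f x))) {a..b} = ennreal (F b - F a)"
  using assms by (auto simp: density_of_def emeasure_density)

lemma measure_eqI_Icc:
  fixes M N :: "real measure"
  assumes sets: "sets M = sets borel" "sets N = sets borel"
    and eq: "\<And>a b. a \<le> b \<Longrightarrow> emeasure M {a..b} = emeasure N {a..b}"
    and fin: "\<And>a b. emeasure M {a..b} \<noteq> \<infinity>"
  shows "M = N"
proof (rule measure_eqI_generator_eq[where \<Omega> = UNIV and E = "range (\<lambda>(a, b). {a..b::real})"
      and A = "\<lambda>i::nat. {- real i..real i}"])
  show "Int_stable (range (\<lambda>(a, b). {a..b::real}))"
    by (auto simp: Int_stable_def)
  show "sets M = sigma_sets UNIV (range (\<lambda>(a, b). {a..b::real}))"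
    "sets N = sigma_sets UNIV (range (\<lambda>(a, b). {a..b::real}))"
    using sets by (simp_all add: borel_eq_atLeastAtMost)
  show "emeasure M X = emeasure N X" if X: "X \<in> range (\<lambda>(a, b). {a..b::real})" for X
  proof -
    obtain a b where X: "X = {a..b}" using X by auto
    show ?thesis using eq[of a b] unfolding X by (cases "a \<le> b") auto
  qed
  have "x \<in> (\<Union>i::nat. {- real i..real i})" for x
    using real_arch_simple[of "\<bar>x\<bar>"] by (auto simp: abs_le_iff minus_le_iff)
  then show "(\<Union>i::nat. {- real i..real i}) = UNIV" by blast
qed (use fin in auto)

lemma density_of_unique:
  assumes "density_of f F" "density_of g F"
  shows "AE x in lborel. f x = g x"
proof -
  note [measurable] = density_of_measurable[OF assms(1)] density_of_measurable[OF assms(2)]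
  have "density lborel (\<lambda>x. ennreal (f x)) = density lborel (\<lambda>x. ennreal (g x))"
  proof (rule measure_eqI_Icc)
    fix a b :: real
    show "emeasure (density lborel (\<lambda>x. ennreal (f x))) {a..b} \<noteq> \<infinity>"
      using density_of_Icc[OF assms(1), of a b] by (cases "a \<le> b") auto
  qed (simp_all add: density_of_Icc[OF assms(1)] density_of_Icc[OF assms(2)])
  then have "AE x in lborel. ennreal (f x) = ennreal (g x)"
    by (subst (asm) sigma_finite_measure.density_unique_iff[OF sigma_finite_lborel]) auto
  then show ?thesis
    by eventually_elim (simp add: density_of_nonneg[OF assms(1)] density_of_nonneg[OF assms(2)])
qed

lemma density_of_add:
  assumes f: "density_of f F" and g: "density_of g G" and "mono F" "mono G"
  shows "density_of (\<lambda>x. f x + g x) (\<lambda>x. F x + G x)"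
  unfolding density_of_def
proof (intro conjI allI impI)
  note [measurable] = density_of_measurable[OF f] density_of_measurable[OF g]
  show "(\<lambda>x. f x + g x) \<in> borel_measurable borel" by measurable
  fix x show "0 \<le> f x + g x" using density_of_nonneg[OF f, of x] density_of_nonneg[OF g, of x] by simp
  fix a b :: real assume ab: "a \<le> b"
  have "(\<integral>\<^sup>+x. ennreal (f x + g x) * indicator {a..b} x \<partial>lborel) =
      (\<integral>\<^sup>+x. ennreal (f x) * indicator {a..b} x + ennreal (g x) * indicator {a..b} x \<partial>lborel)"
    using density_of_nonneg[OF f] density_of_nonneg[OF g] by (intro nn_integral_cong) (simp add: ennreal_plus distrib_right)
  also have "\<dots> = (\<integral>\<^sup>+x. ennreal (f x) * indicator {a..b} x \<partial>lborel) + (\<integral>\<^sup>+x. ennreal (g x) * indicator {a..b} x \<partial>lborel)"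
    by (rule nn_integral_add) auto
  also have "\<dots> = ennreal (F b - F a) + ennreal (G b - G a)" using f g ab by (simp add: density_of_def)
  also have "\<dots> = ennreal (F b + G b - (F a + G a))"
    using monoD[OF assms(3) ab] monoD[OF assms(4) ab] by (simp add: ennreal_plus[symmetric] algebra_simps del: ennreal_plus)
  finally show "(\<integral>\<^sup>+x. ennreal (f x + g x) * indicator {a..b} x \<partial>lborel) = ennreal (F b + G b - (F a + G a))" .
qed

lemma density_of_0: "density_of (\<lambda>_. 0) (\<lambda>_. 0)"
  by (simp add: density_of_def)

lemma density_of_sum:
  assumes "finite I" "\<And>i. i \<in> I \<Longrightarrow> density_of (f i) (F i)" "\<And>i. i \<in> I \<Longrightarrow> mono (F i)"
  shows "density_of (\<lambda>x. \<Sum>i\<in>I. f i x) (\<lambda>x. \<Sum>i\<in>I. F i x)"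
  using assms
proof (induction I rule: finite_induct)
  case (insert i I)
  have "mono (\<lambda>x. \<Sum>i\<in>I. F i x)"
    using insert.prems(2) by (intro monoI sum_mono) (auto simp: mono_def)
  then show ?case using insert density_of_add[of "f i" "F i" "\<lambda>x. \<Sum>i\<in>I. f i x" "\<lambda>x. \<Sum>i\<in>I. F i x"] by auto
qed (simp add: density_of_0)

lemma density_of_linear: "0 \<le> \<nu> \<Longrightarrow> density_of (\<lambda>_. \<nu>) (\<lambda>x. \<nu> * x)"
  by (auto simp: density_of_def nn_integral_cmult ennreal_mult[symmetric] right_diff_distrib)

lemma density_of_shift:
  assumes f: "density_of f F" shows "density_of (\<lambda>x. f (x + \<tau>)) (\<lambda>x. F (x + \<tau>))"
  unfolding density_of_def
proof (intro conjI allI impI)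
  note [measurable] = density_of_measurable[OF f]
  show "(\<lambda>x. f (x + \<tau>)) \<in> borel_measurable borel" by measurable
  show "0 \<le> f (x + \<tau>)" for x by (rule density_of_nonneg[OF f])
  fix a b :: real assume ab: "a \<le> b"
  have "(\<integral>\<^sup>+x. ennreal (f x) * indicator {a + \<tau>..b + \<tau>} x \<partial>lborel) =
      (\<integral>\<^sup>+x. ennreal (f (x + \<tau>)) * indicator {a + \<tau>..b + \<tau>} (x + \<tau>) \<partial>lborel)"
    by (subst nn_integral_real_affine[where c = 1 and t = \<tau>]) (auto simp: add.commute)
  also have "\<dots> = (\<integral>\<^sup>+x. ennreal (f (x + \<tau>)) * indicator {a..b} x \<partial>lborel)"
    by (intro nn_integral_cong) (simp add: indicator_def)
  finally show "(\<integral>\<^sup>+x. ennreal (f (x + \<tau>)) * indicator {a..b} x \<partial>lborel) = ennreal (F (b + \<tau>) - F (a + \<tau>))"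
    using f ab by (simp add: density_of_def)
qed

lemma density_of_has_integral:
  assumes f: "density_of f F" and "mono F" and ab: "a \<le> b"
  shows "(f has_integral (F b - F a)) {a..b}"
proof -
  note [measurable] = density_of_measurable[OF f]
  have "((\<lambda>x. f x * indicator {a..b} x) has_integral (F b - F a)) UNIV"
  proof (rule nn_integral_has_integral)
    show "(\<integral>\<^sup>+x. ennreal (f x * indicator {a..b} x) \<partial>lborel) = ennreal (F b - F a)"
      using f ab density_of_nonneg[OF f] by (simp add: density_of_def ennreal_mult ennreal_indicator)
  qed (use monoD[OF assms(2) ab] density_of_nonneg[OF f] in auto)
  moreover have "(\<lambda>x. f x * indicator {a..b} x) = (\<lambda>x. if x \<in> {a..b} then f x else 0)" by (auto simp: indicator_def)
  ultimately show ?thesis by (simp only: has_integral_restrict_UNIV)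
qed

lemma density_of_zero:
  assumes f: "density_of f F" and ab: "F a = F b"
  shows "AE x in lborel. x \<in> {a..b} \<longrightarrow> f x = 0"
proof (cases "a \<le> b")
  case True
  note [measurable] = density_of_measurable[OF f]
  have "(\<integral>\<^sup>+x. ennreal (f x) * indicator {a..b} x \<partial>lborel) = 0" using f ab True by (simp add: density_of_def)
  then have "AE x in lborel. ennreal (f x) * indicator {a..b} x = 0"
    by (subst (asm) nn_integral_0_iff_AE) auto
  then show ?thesis
    by eventually_elim (use density_of_nonneg[OF f] in \<open>auto simp: indicator_def ennreal_eq_0_iff antisym\<close>)
qed simp

text \<open>Domination by \<open>U\<close> replaces a proof of absolute continuity: the interval
  measures of \<open>F\<close> and of \<open>U - F\<close> add up to \<open>g\<close> times Lebesgue
  measure, so Lebesgue null sets are null for \<open>F\<close> and Radon-Nikodym applies.\<close>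

lemma density_of_exists:
  assumes F: "mono F" "continuous_on UNIV F" and U: "mono U" "continuous_on UNIV U" "density_of g U"
    and dom: "\<And>a b. a \<le> b \<Longrightarrow> F b - F a \<le> U b - U a"
  shows "\<exists>f. density_of f F"
proof -
  let ?D = "\<lambda>x. U x - F x"
  define N where "N = interval_measure F"
  define D where "D = interval_measure ?D"
  have N: "emeasure N {a..b} = ennreal (F b - F a)" if "a \<le> b" for a b
    unfolding N_def using F that by (intro emeasure_interval_measure_Icc) (auto simp: mono_def)
  have D: "emeasure D {a..b} = ennreal (?D b - ?D a)" if "a \<le> b" for a b
    unfolding D_def
  proof (rule emeasure_interval_measure_Icc[OF that])
    show "?D x \<le> ?D y" if "x \<le> y" for x y using dom[OF that] by simp
  qed (intro continuous_intros F U)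
  have sN: "sets N = sets borel" and sD: "sets D = sets borel" by (simp_all add: N_def D_def)
  \<comment> \<open>The sum of the two interval measures; it is identified with the measure of
    density \<open>g\<close> by comparison on compact intervals.\<close>
  define S where "S = measure_of UNIV (sets borel) (\<lambda>A. emeasure N A + emeasure D A)"
  have S: "emeasure S A = emeasure N A + emeasure D A" if A: "A \<in> sets borel" for A
    unfolding S_def
  proof (rule emeasure_measure_of_sigma)
    show "sigma_algebra UNIV (sets borel :: real set set)"
      using sets.sigma_algebra_axioms[of "borel :: real measure"] by simp
    show "positive (sets borel) (\<lambda>A. emeasure N A + emeasure D A)" by (simp add: positive_def)
    show "countably_additive (sets borel) (\<lambda>A. emeasure N A + emeasure D A)"
    proof (rule countably_additiveI)
      fix A :: "nat \<Rightarrow> real set" assume A: "range A \<subseteq> sets borel" "disjoint_family A"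
      show "(\<Sum>i. emeasure N (A i) + emeasure D (A i)) = emeasure N (\<Union>i. A i) + emeasure D (\<Union>i. A i)"
        using suminf_emeasure[of A N] suminf_emeasure[of A D] A sN sD by (simp add: suminf_add[symmetric])
    qed
  qed (rule A)
  have sS: "sets S = sets borel" unfolding S_def by (simp add: sigma_algebra.sets_measure_of_eq sets.sigma_algebra_axioms)
      (metis sets.sigma_sets_eq space_borel)
  note [measurable] = density_of_measurable[OF U(3)]
  have S_eq: "S = density lborel (\<lambda>x. ennreal (g x))"
  proof (rule measure_eqI_Icc)
    fix a b :: real assume ab: "a \<le> b"
    have "emeasure S {a..b} = ennreal (F b - F a) + ennreal (?D b - ?D a)" using S N D ab by simp
    also have "\<dots> = ennreal (U b - U a)"
      using monoD[OF F(1) ab] dom[OF ab] by (simp add: ennreal_plus[symmetric] del: ennreal_plus)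
    finally show "emeasure S {a..b} = emeasure (density lborel (\<lambda>x. ennreal (g x))) {a..b}"
      using density_of_Icc[OF U(3) ab] by simp
  next
    fix a b :: real show "emeasure S {a..b} \<noteq> \<infinity>" using S N D by (cases "a \<le> b") auto
  qed (use sS in auto)
  have ac: "absolutely_continuous lborel N"
    unfolding absolutely_continuous_def
  proof
    fix A :: "real set" assume A: "A \<in> null_sets lborel"
    then have "A \<in> null_sets (density lborel (\<lambda>x. ennreal (g x)))"
      using absolutely_continuousI_density[of "\<lambda>x. ennreal (g x)" lborel] by (auto simp: absolutely_continuous_def)
    then have "emeasure S A = 0" using S_eq by auto
    then show "A \<in> null_sets N" using S[of A] A sN by (auto simp: null_sets_def)
  qed
  obtain h where h: "h \<in> borel_measurable lborel" "density lborel h = N"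
    using sigma_finite_measure.Radon_Nikodym[OF sigma_finite_lborel ac] sN by auto
  have [measurable]: "h \<in> borel_measurable borel" using h(1) by simp
  have hI: "(\<integral>\<^sup>+x. h x * indicator {a..b} x \<partial>lborel) = ennreal (F b - F a)" if "a \<le> b" for a b
    using N[OF that] unfolding h(2)[symmetric] by (simp add: emeasure_density)
  have "density_of (\<lambda>x. enn2real (h x)) F"
    unfolding density_of_def
  proof (intro conjI allI impI)
    show "(\<lambda>x. enn2real (h x)) \<in> borel_measurable borel" by measurable
    fix a b :: real assume ab: "a \<le> b"
    \<comment> \<open>The Radon-Nikodym density may be infinite at some points; finite increments of
      \<open>F\<close> make them a null set, so \<open>enn2real\<close> does not change the
      integrals.\<close>
    have "AE x in lborel. h x * indicator {a..b} x \<noteq> \<infinity>"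
      by (rule nn_integral_PInf_AE) (use hI[OF ab] in auto)
    then have "AE x in lborel. ennreal (enn2real (h x)) * indicator {a..b} x = h x * indicator {a..b} x"
      by eventually_elim (auto simp: indicator_def less_top)
    then show "(\<integral>\<^sup>+x. ennreal (enn2real (h x)) * indicator {a..b} x \<partial>lborel) = ennreal (F b - F a)"
      using nn_integral_cong_AE hI[OF ab] by metis
  qed simp
  then show ?thesis by blast
qed

text \<open>The difference \<open>G - F\<close> is monotone and dominated by \<open>G\<close>, so it
  has a nonnegative density \<open>h\<close>, and \<open>f + h\<close> is another density of
  \<open>G\<close>.\<close>

lemma density_of_le_AE:
  assumes f: "density_of f F" "mono F" "continuous_on UNIV F" and g: "density_of g G" "mono G" "continuous_on UNIV G"
    and dom: "\<And>a b. a \<le> b \<Longrightarrow> F b - F a \<le> G b - G a"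
  shows "AE x in lborel. f x \<le> g x"
proof -
  have mD: "mono (\<lambda>x. G x - F x)" using dom by (intro monoI) (simp add: algebra_simps)
  have "\<exists>h. density_of h (\<lambda>x. G x - F x)"
    by (rule density_of_exists[OF mD _ g(2,3,1)]) (use f(2) in \<open>auto intro!: continuous_intros f g simp: mono_def\<close>)
  then obtain h where h: "density_of h (\<lambda>x. G x - F x)" by blast
  have "density_of (\<lambda>x. f x + h x) G" using density_of_add[OF f(1) h f(2) mD] by simp
  from density_of_unique[OF this g(1)] show ?thesis
  proof eventually_elim
    case (elim x)
    then show ?case using density_of_nonneg[OF h, of x] by linarith
  qed
qed

section \<open>Densities on the set where two cumulative functions coincide\<close>

lemma bounded_component_interval:
  fixes S :: "real set"
  assumes S: "open S" "S \<subseteq> {a<..<b}" and W: "W \<in> components S"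
  obtains \<alpha> \<beta> where "\<alpha> < \<beta>" "W = {\<alpha><..<\<beta>}" "\<alpha> \<notin> S" "\<beta> \<notin> S" "a \<le> \<alpha>" "\<beta> \<le> b"
proof -
  have oW: "open W" by (rule open_components[OF S(1) W])
  have WS: "W \<subseteq> S" by (rule in_components_subset[OF W])
  have cW: "connected W" by (rule in_components_connected[OF W])
  have ne: "W \<noteq> {}" by (rule in_components_nonempty[OF W])
  have bd: "bdd_below W" "bdd_above W" using WS S(2) by (meson bdd_below_Ioo bdd_below_mono bdd_above_Ioo bdd_above_mono order_trans)+
  define \<alpha> \<beta> where "\<alpha> = Inf W" and "\<beta> = Sup W"
  \<comment> \<open>A limit point of the component inside \<open>S\<close> could be added to it
    without losing connectedness, against maximality. Applied to both endpoints.\<close>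
  have notin: "x \<notin> S" if x: "x \<in> closure W" "x \<notin> W" for x
  proof
    assume "x \<in> S"
    have "connected (insert x W)"
      by (rule connected_intermediate_closure[OF cW]) (use x closure_subset in auto)
    then have "insert x W \<subseteq> W"
      using components_maximal[OF W, of "insert x W"] WS \<open>x \<in> S\<close> ne by auto
    then show False using x(2) by blast
  qed
  have \<alpha>W: "\<alpha> \<notin> W"
  proof
    assume "\<alpha> \<in> W"
    then obtain e where e: "e > 0" "ball \<alpha> e \<subseteq> W" using oW open_contains_ball by blast
    have "\<alpha> - e / 2 \<in> W" using e by (intro subsetD[OF e(2)]) (auto simp: dist_real_def)
    then have "\<alpha> \<le> \<alpha> - e / 2" unfolding \<alpha>_def using bd(1) by (rule cInf_lower)
    then show False using e by simp
  qed
  have \<beta>W: "\<beta> \<notin> W"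
  proof
    assume "\<beta> \<in> W"
    then obtain e where e: "e > 0" "ball \<beta> e \<subseteq> W" using oW open_contains_ball by blast
    have "\<beta> + e / 2 \<in> W" using e by (intro subsetD[OF e(2)]) (auto simp: dist_real_def)
    then have "\<beta> + e / 2 \<le> \<beta>" unfolding \<beta>_def using bd(2) by (rule cSup_upper)
    then show False using e by simp
  qed
  have low: "\<alpha> \<le> w" "w \<le> \<beta>" if "w \<in> W" for w
    unfolding \<alpha>_def \<beta>_def using cInf_lower[OF that bd(1)] cSup_upper[OF that bd(2)] by auto
  have WI: "W = {\<alpha><..<\<beta>}"
  proof
    show "W \<subseteq> {\<alpha><..<\<beta>}" using low \<alpha>W \<beta>W by (metis antisym_conv2 greaterThanLessThan_iff subsetI)
    show "{\<alpha><..<\<beta>} \<subseteq> W"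
    proof
      fix x assume x: "x \<in> {\<alpha><..<\<beta>}"
      obtain w1 where w1: "w1 \<in> W" "w1 < x" using x cInf_lessD[OF ne, of x] by (auto simp: \<alpha>_def)
      obtain w2 where w2: "w2 \<in> W" "x < w2" using x less_cSupD[OF ne, of x] by (auto simp: \<beta>_def)
      show "x \<in> W" using connectedD_interval[OF cW w1(1) w2(1)] w1 w2 by simp
    qed
  qed
  have lt: "\<alpha> < \<beta>" using ne WI by auto
  have "\<alpha> \<in> closure W" "\<beta> \<in> closure W" using lt unfolding WI by simp_all
  then have "\<alpha> \<notin> S" "\<beta> \<notin> S" using notin \<alpha>W \<beta>W by auto
  moreover have "a \<le> \<alpha>" unfolding \<alpha>_def using WS S(2) ne by (intro cInf_greatest) auto
  moreover have "\<beta> \<le> b" unfolding \<beta>_def using WS S(2) ne by (intro cSup_least) auto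
  ultimately show ?thesis using that lt WI by blast
qed

text \<open>On each component of the set where \<open>F\<close> and \<open>G\<close> differ they have the same increment, so \<open>f\<close> and \<open>g\<close>
  have the same integral over that set, hence also over its complement.\<close>

lemma density_of_agree_Icc:
  assumes f: "density_of f F" "mono F" "continuous_on UNIV F" and g: "density_of g G" "mono G" "continuous_on UNIV G"
    and a: "F a = G a" and b: "F b = G b"
  shows "emeasure (density lborel (\<lambda>x. ennreal (f x))) ({a..b} \<inter> {x. F x = G x}) =
    emeasure (density lborel (\<lambda>x. ennreal (g x))) ({a..b} \<inter> {x. F x = G x})"
proof (cases "a \<le> b")
  case ab: True
  define Z where "Z = {x. F x = G x}"
  define S where "S = {a<..<b} - Z"
  have cZ: "closed Z" unfolding Z_def by (rule closed_Collect_eq[OF f(3) g(3)])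
  have oS: "open S" unfolding S_def using cZ by (intro open_Diff) auto
  \<comment> \<open>The endpoints lie in \<open>Z\<close>, so removing them from the interval makes
    \<open>S\<close> open without losing any point where \<open>F\<close> and \<open>G\<close>
    differ.\<close>
  have SI: "S = {a..b} - Z" unfolding S_def using a b by (auto simp: Z_def less_le)
  note [measurable] = density_of_measurable[OF f(1)] density_of_measurable[OF g(1)]
  let ?M = "density lborel (\<lambda>x. ennreal (f x))" and ?N = "density lborel (\<lambda>x. ennreal (g x))"
  have pt: "emeasure (density lborel (\<lambda>x. ennreal (h x))) {\<alpha><..<\<beta>} = emeasure (density lborel (\<lambda>x. ennreal (h x))) {\<alpha>..\<beta>}"
    if [measurable]: "h \<in> borel_measurable borel" for h :: "real \<Rightarrow> real" and \<alpha> \<beta>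
  proof -
    have "AE x in lborel. x \<noteq> \<alpha>" "AE x in lborel. x \<noteq> \<beta>" by (rule AE_lborel_singleton)+
    then have "AE x in lborel. ennreal (h x) * indicator {\<alpha><..<\<beta>} x = ennreal (h x) * indicator {\<alpha>..\<beta>} x"
      by eventually_elim (auto simp: indicator_def)
    then show ?thesis by (simp add: emeasure_density cong: nn_integral_cong_AE)
  qed
  have comp: "emeasure ?M W = emeasure ?N W" if W: "W \<in> components S" for W
  proof -
    obtain \<alpha> \<beta> where W: "\<alpha> < \<beta>" "W = {\<alpha><..<\<beta>}" "\<alpha> \<notin> S" "\<beta> \<notin> S" "a \<le> \<alpha>" "\<beta> \<le> b"
      by (rule bounded_component_interval[OF oS _ W, of a b]) (auto simp: S_def)
    then have "F \<alpha> = G \<alpha>" "F \<beta> = G \<beta>" using SI by (auto simp: Z_def)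
    then show ?thesis
      unfolding W(2) pt[OF density_of_measurable[OF f(1)]] pt[OF density_of_measurable[OF g(1)]]
      using density_of_Icc[OF f(1), of \<alpha> \<beta>] density_of_Icc[OF g(1), of \<alpha> \<beta>] W(1) by simp
  qed
  have cC: "countable (components S)"
    by (rule countable_disjoint_open_subsets)
      (use open_components[OF oS] pairwise_disjoint_components[of S] in
        \<open>simp_all add: pairwise_def disjoint_def disjnt_def\<close>)
  have oW: "open W" if "W \<in> components S" for W by (rule open_components[OF oS that])
  have MS: "emeasure ?M S = emeasure ?N S"
  proof -
    have disj: "disjoint_family_on (\<lambda>W. W) (components S)"
      using pairwise_disjoint_components[of S] by (auto simp: disjoint_family_on_def pairwise_def)
    have "emeasure ?M (\<Union>((\<lambda>W. W) ` components S)) = (\<integral>\<^sup>+W. emeasure ?M W \<partial>count_space (components S))"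
      by (rule emeasure_UN_countable[OF _ cC disj]) (use oW in auto)
    also have "\<dots> = (\<integral>\<^sup>+W. emeasure ?N W \<partial>count_space (components S))"
      by (rule nn_integral_cong) (use comp in auto)
    also have "\<dots> = emeasure ?N (\<Union>((\<lambda>W. W) ` components S))"
      by (rule emeasure_UN_countable[OF _ cC disj, symmetric]) (use oW in auto)
    finally show ?thesis by simp
  qed
  have mS: "S \<in> sets borel" using oS by simp
  have MI: "emeasure ?M {a..b} = emeasure ?N {a..b}"
    using density_of_Icc[OF f(1) ab] density_of_Icc[OF g(1) ab] a b by simp
  have ZS: "{a..b} \<inter> Z = {a..b} - S" "S \<subseteq> {a..b}" using SI by auto
  have fin: "emeasure ?M S \<noteq> \<infinity>" "emeasure ?N S \<noteq> \<infinity>"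
    using emeasure_mono[OF ZS(2), of ?M] density_of_Icc[OF f(1) ab] MS by (auto simp: top_unique)
  show ?thesis
    unfolding Z_def[symmetric] ZS(1)
    using emeasure_Diff[of ?M S "{a..b}"] emeasure_Diff[of ?N S "{a..b}"] fin mS ZS(2) MI MS by simp
qed simp

text \<open>The analogue, without derivatives, of the fact that two absolutely continuous functions
  have the same derivative at almost every point where they coincide. It is needed at the times at
  which the queue is empty.\<close>

lemma density_of_agree:
  assumes f: "density_of f F" "mono F" "continuous_on UNIV F" and g: "density_of g G" "mono G" "continuous_on UNIV G"
  shows "AE x in lborel. F x = G x \<longrightarrow> f x = g x"
proof -
  define Z where "Z = {x. F x = G x}"
  have cZ: "closed Z" unfolding Z_def by (rule closed_Collect_eq[OF f(3) g(3)])
  note [measurable] = density_of_measurable[OF f(1)] density_of_measurable[OF g(1)] borel_closed[OF cZ]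
  let ?M = "density lborel (\<lambda>x. ennreal (f x) * indicator Z x)" and ?N = "density lborel (\<lambda>x. ennreal (g x) * indicator Z x)"
  have M: "emeasure ?M A = emeasure (density lborel (\<lambda>x. ennreal (f x))) (A \<inter> Z)"
    "emeasure ?N A = emeasure (density lborel (\<lambda>x. ennreal (g x))) (A \<inter> Z)" if [measurable]: "A \<in> sets borel" for A
    by (simp_all add: emeasure_density) (auto intro!: nn_integral_cong simp: indicator_def)
  have "?M = ?N"
  proof (rule measure_eqI_Icc)
    fix p q :: real
    show "emeasure ?M {p..q} \<noteq> \<infinity>"
    proof (cases "p \<le> q")
      case True
      have "emeasure ?M {p..q} \<le> emeasure (density lborel (\<lambda>x. ennreal (f x))) {p..q}"
        by (subst M) (auto intro!: emeasure_mono)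
      then show ?thesis using density_of_Icc[OF f(1) True] by (auto simp: top_unique)
    qed simp
    show "emeasure ?M {p..q} = emeasure ?N {p..q}"
    proof (cases "{p..q} \<inter> Z = {}")
      case False
      \<comment> \<open>An arbitrary interval is cut down to the hull of its coincidence points,
        whose ends again are coincidence points.\<close>
      define K where "K = {p..q} \<inter> Z"
      have K: "compact K" "K \<noteq> {}" using False cZ by (auto simp: K_def intro: compact_Int_closed)
      obtain a where a: "a \<in> K" "\<forall>t\<in>K. a \<le> t" using compact_attains_inf[OF K] by blast
      obtain b where b: "b \<in> K" "\<forall>t\<in>K. t \<le> b" using compact_attains_sup[OF K] by blast
      have eq: "{p..q} \<inter> Z = {a..b} \<inter> Z" using a b by (fastforce simp: K_def)
      show ?thesis
        using density_of_agree_Icc[OF f g, of a b] a(1) b(1) by (simp add: M eq) (simp add: K_def Z_def)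
    qed (simp add: M)
  qed auto
  then have "AE x in lborel. ennreal (f x) * indicator Z x = ennreal (g x) * indicator Z x"
    by (subst (asm) sigma_finite_measure.density_unique_iff[OF sigma_finite_lborel]) auto
  then show ?thesis
    by eventually_elim (use density_of_nonneg[OF f(1)] density_of_nonneg[OF g(1)] in \<open>auto simp: Z_def indicator_def\<close>)
qed

lemma AE_on_open:
  fixes S :: "real set"
  assumes "open S" and "\<And>a b. {a..b} \<subseteq> S \<Longrightarrow> AE x in lborel. x \<in> {a..b} \<longrightarrow> P x"
  shows "AE x in lborel. x \<in> S \<longrightarrow> P x"
proof -
  obtain D where D: "countable D" "D \<subseteq> Pow S" "\<And>X. X \<in> D \<Longrightarrow> \<exists>a b. X = cbox a b" "\<Union>D = S"
    using open_countable_Union_open_cbox[OF assms(1)] by blast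
  have "AE x in lborel. \<forall>X\<in>D. x \<in> X \<longrightarrow> P x"
  proof (rule AE_ball_countable'[OF _ D(1)])
    fix X assume X: "X \<in> D"
    then obtain a b where "X = {a..b}" using D(3)[OF X] by auto
    then show "AE x in lborel. x \<in> X \<longrightarrow> P x" using assms(2)[of a b] D(2) X by auto
  qed
  then show ?thesis by eventually_elim (use D(4) in blast)
qed

text \<open>With \<open>m\<close> the density of \<open>slack\<close>, the outflow rate is
  \<open>\<nu> - m\<close>. Where the queue is empty, \<open>F + slack\<close> coincides with
  \<open>\<nu> * \<theta>\<close>, so \<open>f + m = \<nu>\<close> and the outflow equals the
  inflow. Where it is positive, \<open>slack\<close> is locally constant and
  \<open>m = 0\<close>.\<close>

lemma link_capacity:
  assumes nu: "\<nu> > 0" and F: "cum_flow F" and f: "density_of f F" and r: "density_of r (\<lambda>\<theta>. \<nu> * \<theta> - slack \<nu> F \<theta>)"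
  shows "AE \<theta> in lborel. r \<theta> \<le> \<nu> \<and>
    r \<theta> = (if F \<theta> + slack \<nu> F \<theta> - \<nu> * \<theta> > 0 then \<nu> else min (f \<theta>) \<nu>)"
proof -
  let ?S = "slack \<nu> F"
  have lin: "mono (\<lambda>x. \<nu> * x)" "continuous_on UNIV (\<lambda>x. \<nu> * x)" "density_of (\<lambda>_. \<nu>) (\<lambda>x. \<nu> * x)"
    using nu density_of_linear[of \<nu>] by (auto simp: mono_def intro!: continuous_intros)
  have mS: "mono ?S" using slack_mono[OF nu F] by (intro monoI)
  have mF: "mono F" and cF: "continuous_on UNIV F" using F by (auto simp: cum_flow_def)
  have cS: "continuous_on UNIV ?S" by (rule continuous_slack[OF nu F])
  obtain m where m: "density_of m ?S"
  proof -
    have "\<exists>m. density_of m ?S"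
      by (rule density_of_exists[OF mS cS lin]) (use slack_lipschitz[OF nu F] in \<open>force simp: algebra_simps\<close>)
    then show ?thesis using that by blast
  qed
  have mO: "mono (\<lambda>\<theta>. \<nu> * \<theta> - ?S \<theta>)"
    using slack_lipschitz[OF nu F] by (intro monoI) (force simp: algebra_simps)
  have 1: "AE \<theta> in lborel. r \<theta> + m \<theta> = \<nu>"
    by (rule density_of_unique[OF _ lin(3)]) (use density_of_add[OF r m mO mS] in simp)
  have "AE \<theta> in lborel. F \<theta> + ?S \<theta> = \<nu> * \<theta> \<longrightarrow> f \<theta> + m \<theta> = \<nu>"
  proof (rule density_of_agree[OF density_of_add[OF f m mF mS] _ _ lin(3,1,2)])
    show "mono (\<lambda>x. F x + ?S x)" using mF mS by (auto simp: mono_def intro: add_mono)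
    show "continuous_on UNIV (\<lambda>x. F x + ?S x)" by (intro continuous_intros cF cS)
  qed
  moreover have "AE \<theta> in lborel. \<theta> \<in> {\<theta>. \<nu> * \<theta> < F \<theta> + ?S \<theta>} \<longrightarrow> m \<theta> = 0"
  proof (rule AE_on_open)
    show "open {\<theta>. \<nu> * \<theta> < F \<theta> + ?S \<theta>}"
      by (intro open_Collect_less continuous_intros cF cS)
    fix a b assume sub: "{a..b} \<subseteq> {\<theta>. \<nu> * \<theta> < F \<theta> + ?S \<theta>}"
    show "AE \<theta> in lborel. \<theta> \<in> {a..b} \<longrightarrow> m \<theta> = 0"
    proof (cases "a \<le> b")
      case True
      \<comment> \<open>At a maximiser \<open>\<xi>\<close> for \<open>slack\<close> at
        \<open>b\<close> the queue is empty, so \<open>\<xi>\<close> lies left of \<open>a\<close>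
        and already counts for \<open>slack\<close> at \<open>a\<close>.\<close>
      obtain \<xi> where \<xi>: "\<xi> \<le> b" "?S b = \<nu> * \<xi> - F \<xi>" using slack_attained[OF nu F] by blast
      have "\<not> a \<le> \<xi>"
      proof
        assume "a \<le> \<xi>"
        then have "\<nu> * \<xi> < F \<xi> + ?S \<xi>" using sub \<xi> by auto
        then show False using slack_mono[OF nu F \<xi>(1)] \<xi>(2) by simp
      qed
      then have "?S b \<le> ?S a" using slack_upper[OF nu F, of \<xi> a] \<xi>(2) by simp
      then have "?S a = ?S b" using slack_mono[OF nu F True] by simp
      then show ?thesis by (rule density_of_zero[OF m])
    qed simp
  qed
  ultimately show ?thesis using 1
  proof eventually_elim
    case (elim \<theta>)
    have z: "\<nu> * \<theta> \<le> F \<theta> + ?S \<theta>" using slack_upper[OF nu F, of \<theta> \<theta>] by simp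
    have "0 \<le> m \<theta>" by (rule density_of_nonneg[OF m])
    then show ?case using elim z by (auto simp: min_def)
  qed
qed

section \<open>Compactness and fixed points\<close>

lemma bounded_family_subseq:
  fixes X :: "nat \<Rightarrow> 'i \<Rightarrow> real"
  assumes I: "countable I" and X: "\<And>n i. i \<in> I \<Longrightarrow> \<bar>X n i\<bar> \<le> B i"
  obtains \<phi> :: "nat \<Rightarrow> nat" where "strict_mono \<phi>" "\<forall>i\<in>I. convergent (\<lambda>n. X (\<phi> n) i)"
proof (cases "I = {}")
  case True
  then show ?thesis using that[of id] by (auto simp: strict_mono_def)
next
  case False
  define P where "P = (\<lambda>n (s::nat\<Rightarrow>nat). convergent (\<lambda>k. X (s k) (from_nat_into I n)))"
  interpret subseqs P
  proof
    fix n and s :: "nat \<Rightarrow> nat"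
    let ?i = "from_nat_into I n"
    have "\<forall>k. X (s k) ?i \<in> {- B ?i..B ?i}"
      using X[OF from_nat_into[OF False, of n]] by (simp add: abs_le_iff minus_le_iff)
    moreover have "seq_compact {- B ?i..B ?i}" by (rule compact_imp_seq_compact) simp
    ultimately obtain l r where "strict_mono r" "((\<lambda>k. X (s k) ?i) \<circ> r) \<longlonglongrightarrow> l"
      using seq_compactE[of "{- B ?i..B ?i}" "\<lambda>k. X (s k) ?i"] by blast
    then show "\<exists>r'. strict_mono r' \<and> P n (s \<circ> r')"
      unfolding P_def by (intro exI[of _ r]) (auto simp: convergent_def o_def)
  qed
  have "convergent (\<lambda>n. X (diagseq n) i)" if i: "i \<in> I" for i
  proof -
    obtain k where k: "from_nat_into I k = i" using from_nat_into_surj[OF I i] by blast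
    \<comment> \<open>The diagonal sequence is a subsequence of the \<open>k\<close>-th selection
      only from index \<open>Suc k\<close> on.\<close>
    have "P k (diagseq \<circ> ((+) (Suc k)))"
    proof (rule diagseq_holds)
      fix r s :: "nat \<Rightarrow> nat" and n assume "strict_mono r" "P n s"
      then show "P n (s \<circ> r)"
        unfolding P_def using convergent_subseq_convergent[of "\<lambda>k. X (s k) (from_nat_into I n)" r] by (simp add: o_def)
    qed
    then have "convergent (\<lambda>n. X (diagseq (n + Suc k)) i)"
      unfolding P_def k o_def by (simp add: add.commute)
    then show ?thesis using convergent_ignore_initial_segment[of "\<lambda>n. X (diagseq n) i" "Suc k"] by simp
  qed
  then show ?thesis using that subseq_diagseq by blast
qed

lemma dominated_continuous:
  assumes U: "cum_flow U" and H: "\<And>x y. x \<le> y \<Longrightarrow> 0 \<le> H y - H x \<and> H y - H x \<le> U y - U x"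
  shows "continuous_on UNIV H"
proof -
  have *: "\<bar>H y - H x\<bar> \<le> \<bar>U y - U x\<bar>" for x y :: real
    using H[of x y] H[of y x] by (cases "x \<le> y") auto
  have "isCont H x" for x
    unfolding isCont_def
  proof (rule Lim_transform_bound[where g = "\<lambda>y. U y - U x" and f = "\<lambda>y. H y - H x", THEN LIM_zero_cancel])
    show "\<forall>\<^sub>F y in at x. norm (H y - H x) \<le> norm (U y - U x)" using * by simp
    show "((\<lambda>y. U y - U x) \<longlongrightarrow> 0) (at x)"
      using cum_flow_isCont[OF U, of x] by (intro LIM_zero) (simp add: isCont_def)
  qed
  then show ?thesis by (simp add: continuous_at_imp_continuous_on)
qed

text \<open>An Arzela--Ascoli argument: \<open>U\<close> provides the common modulus of continuity.\<close>

lemma dominated_cum_flow_subseq: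
  fixes C :: "'c set" and Hn :: "nat \<Rightarrow> 'c \<Rightarrow> real \<Rightarrow> real"
  assumes C: "finite C" and U: "\<And>c. c \<in> C \<Longrightarrow> cum_flow (U c)"
    and Hn: "\<And>n c. c \<in> C \<Longrightarrow> cum_flow (Hn n c)"
    and dom: "\<And>n c x y. c \<in> C \<Longrightarrow> x \<le> y \<Longrightarrow> Hn n c y - Hn n c x \<le> U c y - U c x"
  obtains \<phi> :: "nat \<Rightarrow> nat" and H where "strict_mono \<phi>" "\<And>c. c \<in> C \<Longrightarrow> cum_flow (H c)"
    "\<And>c x. c \<in> C \<Longrightarrow> (\<lambda>n. Hn (\<phi> n) c x) \<longlonglongrightarrow> H c x"
    "\<And>c x y. c \<in> C \<Longrightarrow> x \<le> y \<Longrightarrow> H c y - H c x \<le> U c y - U c x"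
proof -
  have bd: "\<bar>Hn n c x\<bar> \<le> U c x" if c: "c \<in> C" for n c x
  proof (cases "x \<le> 0")
    case True
    then show ?thesis using cum_flow_zero[OF Hn[OF c]] cum_flow_zero[OF U[OF c]] by simp
  next
    case False
    then show ?thesis using dom[OF c, of 0 x n] cum_flow_nonneg[OF Hn[OF c], of n x]
        cum_flow_zero[OF Hn[OF c], of 0 n] cum_flow_zero[OF U[OF c], of 0] by simp
  qed
  have "countable (C \<times> (\<rat> :: real set))" 
    using C countable_rat by (intro countable_SIGMA) (rule countable_finite)
  moreover have "\<bar>Hn n (fst i) (snd i)\<bar> \<le> U (fst i) (snd i)" if "i \<in> C \<times> \<rat>" for n i
    using bd that by auto
  ultimately obtain \<phi> :: "nat \<Rightarrow> nat" where \<phi>: "strict_mono \<phi>"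
    and cq: "\<forall>i\<in>C \<times> \<rat>. convergent (\<lambda>n. Hn (\<phi> n) (fst i) (snd i))"
    by (rule bounded_family_subseq[of "C \<times> \<rat>" "\<lambda>n i. Hn n (fst i) (snd i)"])
  have conv: "convergent (\<lambda>n. Hn (\<phi> n) c x)" if c: "c \<in> C" for c x
  proof (rule Cauchy_convergent, rule metric_CauchyI)
    fix e :: real assume e: "e > 0"
    obtain d where d: "d > 0" "\<And>y. \<bar>y - x\<bar> < d \<Longrightarrow> \<bar>U c y - U c x\<bar> < e / 3"
      using cum_flow_isCont[OF U[OF c], of x, unfolded continuous_at_eps_delta, rule_format, of "e / 3"] e
      by (auto simp: dist_real_def)
    obtain q where q: "q \<in> \<rat>" "x < q" "q < x + d"
      using Rats_dense_in_real[of x "x + d"] d(1) by auto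
    have close: "\<bar>Hn n c x - Hn n c q\<bar> < e / 3" for n
      using dom[OF c less_imp_le[OF q(2)], of n] cum_flow_mono[OF Hn[OF c] less_imp_le[OF q(2)], of n] d(2)[of q] q
      by auto
    have "Cauchy (\<lambda>n. Hn (\<phi> n) c q)" using bspec[OF cq, of "(c, q)"] c q(1) by (auto intro: convergent_Cauchy)
    then obtain M where M: "\<And>m n. m \<ge> M \<Longrightarrow> n \<ge> M \<Longrightarrow> dist (Hn (\<phi> m) c q) (Hn (\<phi> n) c q) < e / 3"
      using metric_CauchyD[of "\<lambda>n. Hn (\<phi> n) c q" "e / 3"] e by auto
    have "dist (Hn (\<phi> m) c x) (Hn (\<phi> n) c x) < e" if "m \<ge> M" "n \<ge> M" for m n
      using close[of "\<phi> m"] close[of "\<phi> n"] M[OF that] unfolding dist_real_def by linarith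
    then show "\<exists>M. \<forall>m\<ge>M. \<forall>n\<ge>M. dist (Hn (\<phi> m) c x) (Hn (\<phi> n) c x) < e" by blast
  qed
  define H where "H = (\<lambda>c x. lim (\<lambda>n. Hn (\<phi> n) c x))"
  have lim: "(\<lambda>n. Hn (\<phi> n) c x) \<longlonglongrightarrow> H c x" if "c \<in> C" for c x
    using conv[OF that] unfolding H_def by (simp add: convergent_LIMSEQ_iff)
  have diff: "0 \<le> H c y - H c x \<and> H c y - H c x \<le> U c y - U c x" if c: "c \<in> C" and xy: "x \<le> y" for c x y
  proof -
    have l: "(\<lambda>n. Hn (\<phi> n) c y - Hn (\<phi> n) c x) \<longlonglongrightarrow> H c y - H c x"
      by (rule tendsto_diff[OF lim[OF c] lim[OF c]])
    have "0 \<le> H c y - H c x"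
      by (rule LIMSEQ_le_const[OF l]) (use cum_flow_mono[OF Hn[OF c] xy] in auto)
    moreover have "H c y - H c x \<le> U c y - U c x"
      by (rule LIMSEQ_le_const2[OF l]) (use dom[OF c xy] in auto)
    ultimately show ?thesis ..
  qed
  have cf: "cum_flow (H c)" if c: "c \<in> C" for c
  proof (rule cum_flowI)
    show "H c x \<le> H c y" if "x \<le> y" for x y using diff[OF c that] by simp
    show "continuous_on UNIV (H c)" by (rule dominated_continuous[OF U[OF c] diff[OF c]])
    show "H c x = 0" if "x \<le> 0" for x
      using lim[OF c, of x] cum_flow_zero[OF Hn[OF c] that] by (simp add: LIMSEQ_const_iff)
  qed
  show ?thesis using that[OF \<phi> cf lim] diff by blast
qed

text \<open>The library version of Brouwer's theorem fixes the dimension by a type; here the dimension has to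
  grow with the discretization, so the theorem is derived again from Kuhn's combinatorial lemma.\<close>

lemma brouwer_finite_cube:
  fixes I :: "'i set" and f :: "('i \<Rightarrow> real) \<Rightarrow> 'i \<Rightarrow> real"
  assumes I: "finite I"
    and maps: "\<And>x i. (\<And>j. j \<in> I \<Longrightarrow> x j \<in> {0..1}) \<Longrightarrow> i \<in> I \<Longrightarrow> f x i \<in> {0..1}"
    and cont: "\<And>X x i. (\<And>n j. j \<in> I \<Longrightarrow> X n j \<in> {0..1}) \<Longrightarrow> (\<And>j. j \<in> I \<Longrightarrow> (\<lambda>n. X n j) \<longlonglongrightarrow> x j)
      \<Longrightarrow> i \<in> I \<Longrightarrow> (\<lambda>n. f (X n) i) \<longlonglongrightarrow> f x i"
  shows "\<exists>x. \<forall>i\<in>I. x i \<in> {0..1} \<and> f x i = x i"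
proof -
  define n where "n = card I"
  obtain h where h: "bij_betw h I {..<n}"
    using finite_same_card_bij[OF I finite_lessThan[of n]] n_def by auto
  have hI: "h i < n" if "i \<in> I" for i using h that by (auto simp: bij_betw_def)
  define P where "P = (\<lambda>x::'i \<Rightarrow> real. \<forall>j\<in>I. x j \<in> {0..1})"
  \<comment> \<open>The face values are forced by Kuhn's lemma. They agree in meaning with the
    interior ones because \<open>f\<close> maps into the cube: label 0 always gives
    \<open>x i \<le> f x i\<close>, and label 1 the reverse inequality.\<close>
  define label where "label = (\<lambda>x i. if x i = 0 then 0 else if x i = 1 then 1 else if x i \<le> f x i then 0 else (1::nat))"
  have lab_le: "label x i \<le> 1" for x i by (simp add: label_def)
  have lab0: "x i \<le> f x i" if "P x" "i \<in> I" "label x i = 0" for x i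
    using that maps[of x i] by (auto simp: label_def P_def split: if_splits)
  have lab1: "f x i \<le> x i" if "P x" "i \<in> I" "label x i \<noteq> 0" for x i
    using that maps[of x i] by (auto simp: label_def P_def split: if_splits)
  \<comment> \<open>Kuhn's lemma works on integer points with coordinates \<open>0..Suc p\<close>
    numbered by \<open>{..<n}\<close>; \<open>emb\<close> rescales them to the cube and renumbers by
    \<open>I\<close>.\<close>
  define emb where "emb = (\<lambda>(p::nat) q i. real (q (h i)) / real (Suc p))"
  define A where "A = (\<lambda>p (q::nat \<Rightarrow> nat). (\<forall>i<n. q i < Suc p) \<and> (\<forall>i<n. \<exists>r s. (\<forall>j<n. q j \<le> r j \<and> r j \<le> q j + 1) \<and>
          (\<forall>j<n. q j \<le> s j \<and> s j \<le> q j + 1) \<and>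
          label (emb p r) (inv_into I h i) \<noteq> label (emb p s) (inv_into I h i)))"
  have "\<exists>q. A p q" for p
  proof -
    have hinv: "h (inv_into I h i) = i" if "i < n" for i
      using h that by (auto simp: bij_betw_def intro!: f_inv_into_f)
    let ?l = "\<lambda>r i. label (emb p r) (inv_into I h i)"
    have l: "\<forall>x. (\<forall>i<n. x i \<le> Suc p) \<longrightarrow> (\<forall>i<n. ?l x i = 0 \<or> ?l x i = 1)"
      "\<forall>x. (\<forall>i<n. x i \<le> Suc p) \<longrightarrow> (\<forall>i<n. x i = 0 \<longrightarrow> ?l x i = 0)"
      "\<forall>x. (\<forall>i<n. x i \<le> Suc p) \<longrightarrow> (\<forall>i<n. x i = Suc p \<longrightarrow> ?l x i = 1)"
      by (simp_all add: label_def emb_def hinv)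
    show ?thesis unfolding A_def by (rule kuhn_lemma[OF zero_less_Suc l]) blast
  qed
  then have "\<forall>p. \<exists>q. A p q" by blast
  then obtain q where "\<forall>p. A p (q p)" by (rule choice[THEN exE])
  then have q1: "i < n \<Longrightarrow> q p i < Suc p"
    and q2: "i < n \<Longrightarrow> \<exists>r s. (\<forall>j<n. q p j \<le> r j \<and> r j \<le> q p j + 1) \<and>
          (\<forall>j<n. q p j \<le> s j \<and> s j \<le> q p j + 1) \<and>
          label (emb p r) (inv_into I h i) \<noteq> label (emb p s) (inv_into I h i)" for p i
    unfolding A_def by blast+
  \<comment> \<open>The two vertices with different labels are ordered, so that \<open>r\<close>
    carries label 0 and \<open>s\<close> does not.\<close>
  define D where "D = (\<lambda>p i r s. (\<forall>j<n. q p j \<le> r j \<and> r j \<le> q p j + 1) \<and> (\<forall>j<n. q p j \<le> s j \<and> s j \<le> q p j + 1) \<and>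
          label (emb p r) i = 0 \<and> label (emb p s) i \<noteq> 0)"
  have "\<exists>r s. D p i r s" if i: "i \<in> I" for p i
  proof -
    have inv: "inv_into I h (h i) = i" using h i by (auto simp: bij_betw_def)
    obtain r s where "\<forall>j<n. q p j \<le> r j \<and> r j \<le> q p j + 1" "\<forall>j<n. q p j \<le> s j \<and> s j \<le> q p j + 1"
      "label (emb p r) i \<noteq> label (emb p s) i"
      using q2[OF hI[OF i], of p] unfolding inv by blast
    then have "D p i r s \<or> D p i s r" 
      using lab_le[of "emb p r" i] lab_le[of "emb p s" i] unfolding D_def
      by (cases "label (emb p r) i = 0") auto
    then show ?thesis by blast
  qed
  then have "\<forall>p. \<forall>i\<in>I. \<exists>r s. D p i r s" by blast
  then obtain r s where "\<forall>p. \<forall>i\<in>I. D p i (r p i) (s p i)" unfolding bchoice_iff choice_iff by blast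
  then have rs: "\<And>p i j. i \<in> I \<Longrightarrow> j < n \<Longrightarrow> q p j \<le> r p i j \<and> r p i j \<le> q p j + 1"
      "\<And>p i j. i \<in> I \<Longrightarrow> j < n \<Longrightarrow> q p j \<le> s p i j \<and> s p i j \<le> q p j + 1"
      "\<And>p i. i \<in> I \<Longrightarrow> label (emb p (r p i)) i = 0" "\<And>p i. i \<in> I \<Longrightarrow> label (emb p (s p i)) i \<noteq> 0"
    unfolding D_def by blast+
  have bnd: "emb p (q p) j \<in> {0..1}" "q p (h j) \<le> m \<Longrightarrow> m \<le> q p (h j) + 1 \<Longrightarrow> real m / real (Suc p) \<in> {0..1}"
    "q p (h j) \<le> m \<Longrightarrow> m \<le> q p (h j) + 1 \<Longrightarrow> \<bar>real m / real (Suc p) - emb p (q p) j\<bar> \<le> 1 / real (Suc p)"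
    if "j \<in> I" for p j m
  proof -
    have "q p (h j) < Suc p" by (rule q1[OF hI[OF that]])
    then show "emb p (q p) j \<in> {0..1}" "q p (h j) \<le> m \<Longrightarrow> m \<le> q p (h j) + 1 \<Longrightarrow> real m / real (Suc p) \<in> {0..1}"
      by (auto simp: emb_def divide_le_eq_1)
    show "\<bar>real m / real (Suc p) - emb p (q p) j\<bar> \<le> 1 / real (Suc p)"
      if "q p (h j) \<le> m" "m \<le> q p (h j) + 1"
    proof -
      have "real m / real (Suc p) - emb p (q p) j = (real m - real (q p (h j))) / real (Suc p)"
        by (simp add: emb_def diff_divide_distrib)
      also have "\<bar>\<dots>\<bar> = \<bar>real m - real (q p (h j))\<bar> / real (Suc p)" by simp
      also have "\<dots> \<le> 1 / real (Suc p)" by (rule divide_right_mono) (use that in auto)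
      finally show ?thesis .
    qed
  qed
  obtain \<phi> :: "nat \<Rightarrow> nat" where \<phi>: "strict_mono \<phi>"
    and cv: "\<forall>i\<in>I. convergent (\<lambda>p. emb (\<phi> p) (q (\<phi> p)) i)"
  proof (rule bounded_family_subseq[of I "\<lambda>p. emb p (q p)" "\<lambda>_. 1"])
    show "countable I" using I by (rule countable_finite)
    show "\<bar>emb p (q p) i\<bar> \<le> 1" if "i \<in> I" for p i using bnd(1)[OF that, of p] by simp
  qed
  define x where "x = (\<lambda>i. lim (\<lambda>p. emb (\<phi> p) (q (\<phi> p)) i))"
  have x: "(\<lambda>p. emb (\<phi> p) (q (\<phi> p)) i) \<longlonglongrightarrow> x i" if "i \<in> I" for i
    using bspec[OF cv that] unfolding x_def by (simp add: convergent_LIMSEQ_iff)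
  have vanish: "(\<lambda>p. 1 / real (Suc (\<phi> p))) \<longlonglongrightarrow> 0"
    using LIMSEQ_subseq_LIMSEQ[OF LIMSEQ_inverse_real_of_nat \<phi>] by (simp add: o_def inverse_eq_divide)
  \<comment> \<open>The vertices \<open>r p i\<close> and \<open>s p i\<close> depend on the
    coordinate \<open>i\<close>, but all lie in the cell of \<open>q p\<close>, whose side tends to
    0; so they share the limit \<open>x\<close>.\<close>
  have near: "(\<lambda>p. emb (\<phi> p) (t (\<phi> p)) j) \<longlonglongrightarrow> x j" "P (emb p (t p))"
    if t: "\<And>p j. j < n \<Longrightarrow> q p j \<le> t p j \<and> t p j \<le> q p j + 1" and j: "j \<in> I" for t :: "nat \<Rightarrow> nat \<Rightarrow> nat" and p j
  proof -
    have "(\<lambda>p. emb (\<phi> p) (t (\<phi> p)) j - emb (\<phi> p) (q (\<phi> p)) j) \<longlonglongrightarrow> 0"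
    proof (rule Lim_null_comparison[OF _ vanish], intro always_eventually allI)
      fix p
      show "norm (emb (\<phi> p) (t (\<phi> p)) j - emb (\<phi> p) (q (\<phi> p)) j) \<le> 1 / real (Suc (\<phi> p))"
        using bnd(3)[OF j, of "\<phi> p" "t (\<phi> p) (h j)"] t[OF hI[OF j], of "\<phi> p"] by (simp add: emb_def)
    qed
    from tendsto_add[OF this x[OF j]] show "(\<lambda>p. emb (\<phi> p) (t (\<phi> p)) j) \<longlonglongrightarrow> x j" by simp
    show "P (emb p (t p))"
      unfolding P_def
    proof
      fix i assume i: "i \<in> I"
      show "emb p (t p) i \<in> {0..1}"
        using bnd(2)[OF i, of p "t p (h i)"] t[OF hI[OF i], of p] by (simp add: emb_def)
    qed
  qed
  have "x i \<in> {0..1} \<and> f x i = x i" if i: "i \<in> I" for i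
  proof -
    note nr = near[of "\<lambda>p. r p i", OF rs(1)[OF i]] and ns = near[of "\<lambda>p. s p i", OF rs(2)[OF i]]
    have Pr: "P (emb p (r p i))" and Ps: "P (emb p (s p i))" for p
      using nr(2)[OF _ i] ns(2)[OF _ i] by auto
    have cr: "(\<lambda>p. f (emb (\<phi> p) (r (\<phi> p) i)) i) \<longlonglongrightarrow> f x i"
      by (rule cont[OF _ _ i]) (use Pr nr(1) in \<open>auto simp: P_def\<close>)
    have cs: "(\<lambda>p. f (emb (\<phi> p) (s (\<phi> p) i)) i) \<longlonglongrightarrow> f x i"
      by (rule cont[OF _ _ i]) (use Ps ns(1) in \<open>auto simp: P_def\<close>)
    have "x i \<le> f x i"
      by (rule LIMSEQ_le[OF nr(1)[OF _ i] cr]) (use lab0[OF Pr i rs(3)[OF i]] in auto)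
    moreover have "f x i \<le> x i"
      by (rule LIMSEQ_le[OF cs ns(1)[OF _ i]]) (use lab1[OF Ps i rs(4)[OF i]] in auto)
    moreover have "0 \<le> x i"
      by (rule LIMSEQ_le_const[OF x[OF i]]) (use bnd(1)[OF i] in auto)
    moreover have "x i \<le> 1"
      by (rule LIMSEQ_le_const2[OF x[OF i]]) (use bnd(1)[OF i] in auto)
    ultimately show ?thesis by auto
  qed
  then show ?thesis by blast
qed

section \<open>Network loading\<close>

text \<open>\<open>C\<close> indexes the paths, so that the same list of links may occur under
  several indices. Rates and delays are constrained on the whole type; a concrete network is first
  extended by default values outside its arcs.\<close>

locale path_network =
  fixes C :: "'c set" and pt :: "'c \<Rightarrow> 'e list" and \<nu> \<tau> :: "'e \<Rightarrow> real" and \<delta> :: real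
  assumes finite_C: "finite C" and rate_pos: "\<And>e. 0 < \<nu> e"
    and delay_pos: "0 < \<delta>" and delay_le: "\<And>e. \<delta> \<le> \<tau> e"
begin

text \<open>\<open>X c i\<close> is the cumulative inflow of path \<open>c\<close> into its \<open>i\<close>-th link; the index \<open>length (pt c)\<close>
  stands for the arrivals at the destination.\<close>

definition link_inflow :: "('c \<Rightarrow> nat \<Rightarrow> real \<Rightarrow> real) \<Rightarrow> 'e \<Rightarrow> real \<Rightarrow> real" where
  "link_inflow X e \<theta> = (\<Sum>c\<in>C. \<Sum>i | i < length (pt c) \<and> pt c ! i = e. X c i \<theta>)"

definition link_exit :: "('c \<Rightarrow> nat \<Rightarrow> real \<Rightarrow> real) \<Rightarrow> 'e \<Rightarrow> real \<Rightarrow> real" where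
  "link_exit X e = queue_exit (\<nu> e) (\<tau> e) (link_inflow X e)"

definition flows :: "('c \<Rightarrow> nat \<Rightarrow> real \<Rightarrow> real) \<Rightarrow> bool" where
  "flows X \<longleftrightarrow> (\<forall>c\<in>C. \<forall>i. cum_flow (X c i))"

definition inflows :: "('c \<Rightarrow> real \<Rightarrow> real) \<Rightarrow> bool" where
  "inflows H \<longleftrightarrow> (\<forall>c\<in>C. cum_flow (H c))"

lemma flowsD: "flows X \<Longrightarrow> c \<in> C \<Longrightarrow> cum_flow (X c i)"
  by (auto simp: flows_def)

lemma cum_flow_agg:
  assumes "flows X" shows "cum_flow (link_inflow X e)"
  unfolding link_inflow_def by (rule cum_flow_sum, rule cum_flow_sum, rule flowsD[OF assms])

lemma agg_diff_ge:
  assumes X: "flows X" and c: "c \<in> C" "i < length (pt c)" "pt c ! i = e" and ab: "a \<le> b"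
  shows "X c i b - X c i a \<le> link_inflow X e b - link_inflow X e a"
proof -
  have nn: "0 \<le> X c' j b - X c' j a" if "c' \<in> C" for c' j
    using cum_flow_mono[OF flowsD[OF X that] ab] by simp
  have "X c i b - X c i a \<le> (\<Sum>i | i < length (pt c) \<and> pt c ! i = e. X c i b - X c i a)"
    by (rule member_le_sum) (use c nn in auto)
  also have "\<dots> \<le> (\<Sum>c\<in>C. \<Sum>i | i < length (pt c) \<and> pt c ! i = e. X c i b - X c i a)"
    by (rule member_le_sum[of c]) (use c nn finite_C in \<open>auto intro!: sum_nonneg\<close>)
  also have "\<dots> = link_inflow X e b - link_inflow X e a"
    by (simp add: link_inflow_def sum_subtractf)
  finally show ?thesis .
qed

lemma link_exit_props:
  assumes "flows X"
  shows link_exit_mono: "mono (link_exit X e)"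
    and link_exit_cont: "continuous_on S (link_exit X e)"
    and link_exit_isCont: "isCont (link_exit X e) x"
    and link_exit_ge: "\<theta> + \<delta> \<le> link_exit X e \<theta>"
    and link_exit_surj: "\<exists>\<theta>. link_exit X e \<theta> = \<xi>"
proof -
  note F = rate_pos[of e] cum_flow_agg[OF assms, of e]
  show "mono (link_exit X e)" unfolding link_exit_def by (intro monoI queue_exit_mono[OF F])
  show "continuous_on S (link_exit X e)" unfolding link_exit_def by (rule continuous_queue_exit[OF F])
  have "continuous_on UNIV (link_exit X e)" unfolding link_exit_def by (rule continuous_queue_exit[OF F])
  then show "isCont (link_exit X e) x" by (simp add: continuous_on_eq_continuous_at)
  show "\<theta> + \<delta> \<le> link_exit X e \<theta>"
    unfolding link_exit_def using queue_exit_ge[OF F, of \<theta> "\<tau> e"] delay_le[of e] by linarith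
  show "\<exists>\<theta>. link_exit X e \<theta> = \<xi>" unfolding link_exit_def by (rule queue_exit_surj[OF F])
qed

lemma link_exit_gt: "flows X \<Longrightarrow> \<theta> < link_exit X e \<theta>"
  using link_exit_ge[of X \<theta> e] delay_pos by linarith

lemma carries_link_exit:
  assumes "flows X" "c \<in> C" "i < length (pt c)" "pt c ! i = e"
  shows "carries (\<nu> e) (link_exit X e) (X c i)"
  unfolding carries_def
proof (intro allI impI)
  fix a b :: real assume ab: "a \<le> b"
  show "X c i b - X c i a \<le> \<nu> e * (link_exit X e b - link_exit X e a)"
    unfolding link_exit_def
    using agg_diff_ge[OF assms ab] queue_exit_diff[OF rate_pos cum_flow_agg[OF assms(1)] ab, of e e "\<tau> e"]
    by linarith
qed

lemma link_exit_cong: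
  assumes "\<And>c i x. c \<in> C \<Longrightarrow> x \<le> \<theta> \<Longrightarrow> X c i x = Y c i x"
  shows "link_exit X e \<theta> = link_exit Y e \<theta>"
  unfolding link_exit_def by (rule queue_exit_cong) (simp add: link_inflow_def assms cong: sum.cong)

lemma link_exit_tendsto:
  assumes "flows X" "\<And>n. flows (Xn n)"
    and "\<And>c i \<xi>. c \<in> C \<Longrightarrow> (\<lambda>n. Xn n c i \<xi>) \<longlonglongrightarrow> X c i \<xi>"
  shows "(\<lambda>n. link_exit (Xn n) e \<theta>) \<longlonglongrightarrow> link_exit X e \<theta>"
  unfolding link_exit_def
proof (rule queue_exit_tendsto[OF rate_pos cum_flow_agg[OF assms(1)] cum_flow_agg[OF assms(2)]])
  fix x show "(\<lambda>n. link_inflow (Xn n) e x) \<longlonglongrightarrow> link_inflow X e x"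
    unfolding link_inflow_def by (rule tendsto_sum, rule tendsto_sum, rule assms(3))
qed

text \<open>One round of the loading iteration: the exit times are computed from the flows of the
  previous round. The value 0 beyond the destination makes \<open>flows\<close> hold at every
  index.\<close>

definition step :: "('c \<Rightarrow> real \<Rightarrow> real) \<Rightarrow> ('c \<Rightarrow> nat \<Rightarrow> real \<Rightarrow> real) \<Rightarrow> 'c \<Rightarrow> nat \<Rightarrow> real \<Rightarrow> real" where
  "step H X c i = (case i of 0 \<Rightarrow> H c
     | Suc j \<Rightarrow> if j < length (pt c) then through (link_exit X (pt c ! j)) (X c j) else (\<lambda>_. 0))"

fun iter :: "('c \<Rightarrow> real \<Rightarrow> real) \<Rightarrow> nat \<Rightarrow> 'c \<Rightarrow> nat \<Rightarrow> real \<Rightarrow> real" where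
  "iter H 0 = (\<lambda>_ _ _. 0)"
| "iter H (Suc k) = step H (iter H k)"

text \<open>The number of rounds depends on the time: at \<open>\<xi>\<close> just enough are run
  for the iteration to have become stationary on \<open>{..\<xi>}\<close>. For
  \<open>\<xi> \<le> 0\<close> this is no round at all.\<close>

definition load :: "('c \<Rightarrow> real \<Rightarrow> real) \<Rightarrow> 'c \<Rightarrow> nat \<Rightarrow> real \<Rightarrow> real" where
  "load H c i \<xi> = iter H (nat \<lceil>\<xi> / \<delta>\<rceil>) c i \<xi>"

lemma flows_step:
  assumes H: "inflows H" and X: "flows X"
  shows "flows (step H X)"
  unfolding flows_def
proof (intro ballI allI)
  fix c i assume c: "c \<in> C"
  show "cum_flow (step H X c i)"
  proof (cases i)
    case (Suc j)
    have "cum_flow (through (link_exit X (pt c ! j)) (X c j))" if "j < length (pt c)"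
      by (rule cum_flow_through[OF carries_link_exit[OF X c that refl] flowsD[OF X c]
            link_exit_surj[OF X] link_exit_mono[OF X] less_imp_le[OF link_exit_gt[OF X]] rate_pos])
    then show ?thesis by (simp add: step_def Suc)
  qed (use H c in \<open>simp add: step_def inflows_def\<close>)
qed

lemma flows_iter: "inflows H \<Longrightarrow> flows (iter H k)"
  by (induction k) (auto intro: flows_step simp: flows_def[of "\<lambda>_ _ _. 0"])

text \<open>Because of this gain of \<open>\<delta>\<close>, the iteration of \<open>step\<close> is stationary on each \<open>{..k * \<delta>}\<close> after \<open>k\<close>
  rounds.\<close>

lemma step_causal:
  assumes H: "inflows H" and X: "flows X" and Y: "flows Y"
    and eq: "\<And>c i x. c \<in> C \<Longrightarrow> x \<le> a \<Longrightarrow> X c i x = Y c i x" and c: "c \<in> C" and \<xi>: "\<xi> \<le> a + \<delta>"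
  shows "step H X c i \<xi> = step H Y c i \<xi>"
proof (cases i)
  case (Suc j)
  show ?thesis
  proof (cases "j < length (pt c)")
    case True
    let ?T = "link_exit X (pt c ! j)" and ?S = "link_exit Y (pt c ! j)"
    obtain \<theta> where \<theta>: "?T \<theta> = \<xi>" using link_exit_surj[OF X] by blast
    then have le: "\<theta> \<le> a" using link_exit_ge[OF X, of \<theta> "pt c ! j"] \<xi> by simp
    have "?S \<theta> = \<xi>"
      unfolding \<theta>[symmetric] by (rule link_exit_cong) (use eq le in auto)
    then have "through ?S (Y c j) \<xi> = Y c j \<theta>"
      using through_exit[OF carries_link_exit[OF Y c True refl] flowsD[OF Y c], of \<theta>] by simp
    moreover have "through ?T (X c j) \<xi> = X c j \<theta>"
      using through_exit[OF carries_link_exit[OF X c True refl] flowsD[OF X c], of \<theta>] \<theta> by simp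
    ultimately show ?thesis using eq[OF c le] True by (simp add: step_def Suc)
  qed (simp add: step_def Suc)
qed (simp add: step_def)

lemma iter_stable:
  assumes H: "inflows H" and c: "c \<in> C" and "\<xi> \<le> real k * \<delta>" "k \<le> l"
  shows "iter H l c i \<xi> = iter H k c i \<xi>"
proof -
  have *: "iter H (Suc k) c i \<xi> = iter H k c i \<xi>" if "c \<in> C" "\<xi> \<le> real k * \<delta>" for k c i \<xi>
    using that
  proof (induction k arbitrary: c i \<xi>)
    case 0
    then show ?case
      using cum_flow_zero[OF flowsD[OF flows_iter[OF H, of "Suc 0"] 0(1)], of \<xi> i] by simp
  next
    case (Suc k)
    have "step H (iter H (Suc k)) c i \<xi> = step H (iter H k) c i \<xi>"
      by (rule step_causal[OF H, where a = "real k * \<delta>"])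
        (use Suc flows_iter[OF H] in \<open>auto simp: algebra_simps simp del: iter.simps\<close>)
    then show ?case by simp
  qed
  show ?thesis using assms(4,3)
  proof (induction l rule: dec_induct)
    case (step m)
    have "real k * \<delta> \<le> real m * \<delta>" using step delay_pos by simp
    then show ?case using *[OF c, of \<xi> m i] step by simp
  qed simp
qed

lemma load_eq_iter:
  assumes H: "inflows H" and c: "c \<in> C" and \<xi>: "\<xi> \<le> real k * \<delta>"
  shows "load H c i \<xi> = iter H k c i \<xi>"
proof -
  let ?l = "nat \<lceil>\<xi> / \<delta>\<rceil>"
  have "\<xi> / \<delta> \<le> real ?l" by linarith
  then have "\<xi> \<le> real ?l * \<delta>" using delay_pos by (simp add: field_simps)
  moreover have "?l \<le> k" using \<xi> delay_pos by (simp add: field_simps ceiling_le_iff)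
  ultimately show ?thesis unfolding load_def using iter_stable[OF H c] by metis
qed

lemma ex_steps: "\<exists>k. x \<le> real k * \<delta>"
  using reals_Archimedean2[of "x / \<delta>"] delay_pos by (auto simp: field_simps intro: less_imp_le)

lemma flows_load:
  assumes H: "inflows H" shows "flows (load H)"
  unfolding flows_def
proof (intro ballI allI)
  fix c i assume c: "c \<in> C"
  note it = flowsD[OF flows_iter[OF H] c]
  show "cum_flow (load H c i)"
  proof (rule cum_flowI)
    fix x y :: real assume xy: "x \<le> y"
    obtain k where "y \<le> real k * \<delta>" using ex_steps by blast
    then show "load H c i x \<le> load H c i y"
      using load_eq_iter[OF H c, of x k i] load_eq_iter[OF H c, of y k i] cum_flow_mono[OF it xy, of k i] xy
      by auto
  next
    fix x :: real assume "x \<le> 0"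
    then show "load H c i x = 0"
      using load_eq_iter[OF H c, of x 0 i] by simp
  next
    have "isCont (load H c i) x" for x
    proof -
      \<comment> \<open>The margin 1 lets one fixed iterate represent \<open>load\<close> on a whole
        neighbourhood of \<open>x\<close>.\<close>
      obtain k where k: "x + 1 \<le> real k * \<delta>" using ex_steps by blast
      have "\<forall>\<^sub>F y in nhds x. y \<in> {..<x + 1}" by (rule eventually_nhds_in_open) auto
      then have "\<forall>\<^sub>F y in nhds x. load H c i y = iter H k c i y"
        by eventually_elim (use load_eq_iter[OF H c] k in auto)
      then have "isCont (load H c i) x = isCont (iter H k c i) x" by (rule isCont_cong)
      then show ?thesis using cum_flow_isCont[OF it] by simp
    qed
    then show "continuous_on UNIV (load H c i)" by (simp add: continuous_at_imp_continuous_on)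
  qed
qed

lemma load_0:
  assumes H: "inflows H" and c: "c \<in> C"
  shows "load H c 0 = H c"
proof
  fix \<xi>
  obtain k where "\<xi> \<le> real k * \<delta>" using ex_steps by blast
  then have "\<xi> \<le> real (Suc k) * \<delta>" using delay_pos by (simp add: algebra_simps)
  then show "load H c 0 \<xi> = H c \<xi>"
    using load_eq_iter[OF H c, of \<xi> "Suc k" 0] by (simp add: step_def)
qed

lemma load_Suc:
  assumes H: "inflows H" and c: "c \<in> C" and i: "i < length (pt c)"
  shows "load H c (Suc i) (link_exit (load H) (pt c ! i) \<theta>) = load H c i \<theta>"
proof -
  let ?e = "pt c ! i"
  obtain k where k: "link_exit (load H) ?e \<theta> \<le> real k * \<delta>" using ex_steps by blast
  have k': "link_exit (load H) ?e \<theta> \<le> real (Suc k) * \<delta>" using k delay_pos by (simp add: algebra_simps)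
  have le: "\<theta> \<le> real k * \<delta>" using link_exit_gt[OF flows_load[OF H], of \<theta> ?e] k by linarith
  have T: "link_exit (load H) ?e \<theta> = link_exit (iter H k) ?e \<theta>"
    by (rule link_exit_cong, rule load_eq_iter[OF H]) (use le in auto)
  \<comment> \<open>After \<open>k\<close> rounds both the inflow and the exit time at
    \<open>\<theta>\<close> are final; the additional round unfolds \<open>step\<close> once, so
    that \<open>through_exit\<close> applies.\<close>
  have "load H c (Suc i) (link_exit (load H) ?e \<theta>) = iter H (Suc k) c (Suc i) (link_exit (iter H k) ?e \<theta>)"
    using load_eq_iter[OF H c k', of "Suc i"] T by metis
  also have "\<dots> = iter H k c i \<theta>"
    using through_exit[OF carries_link_exit[OF flows_iter[OF H] c i refl] flowsD[OF flows_iter[OF H] c], of k \<theta>] i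
    by (simp add: step_def)
  also have "\<dots> = load H c i \<theta>" using load_eq_iter[OF H c le, of i] by simp
  finally show ?thesis .
qed

lemma iter_tendsto:
  assumes H: "inflows H" and Hn: "\<And>n. inflows (Hn n)"
    and lim: "\<And>c \<xi>. c \<in> C \<Longrightarrow> (\<lambda>n. Hn n c \<xi>) \<longlonglongrightarrow> H c \<xi>" and c: "c \<in> C"
  shows "(\<lambda>n. iter (Hn n) k c i \<xi>) \<longlonglongrightarrow> iter H k c i \<xi>"
  using c
proof (induction k arbitrary: c i \<xi>)
  case (Suc k)
  show ?case
  proof (cases i)
    case 0
    then show ?thesis using lim[OF Suc.prems] by (simp add: step_def)
  next
    case (Suc j)
    note X = flows_iter[OF H, of k]
    have Xn: "\<And>n. flows (iter (Hn n) k)" by (rule flows_iter[OF Hn])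
    show ?thesis
    proof (cases "j < length (pt c)")
      case True
      have "(\<lambda>n. through (link_exit (iter (Hn n) k) (pt c ! j)) (iter (Hn n) k c j) \<xi>)
          \<longlonglongrightarrow> through (link_exit (iter H k) (pt c ! j)) (iter H k c j) \<xi>"
        by (rule through_tendsto[OF carries_link_exit[OF X Suc.prems True refl] flowsD[OF X Suc.prems]
              link_exit_surj[OF X] carries_link_exit[OF Xn Suc.prems True refl] flowsD[OF Xn Suc.prems]
              link_exit_surj[OF Xn] link_exit_mono[OF Xn] Suc.IH[OF Suc.prems]
              link_exit_tendsto[OF X Xn Suc.IH]])
      then show ?thesis by (simp add: step_def Suc True)
    qed (simp add: step_def Suc)
  qed
qed simp

lemma load_tendsto:
  assumes "inflows H" "\<And>n. inflows (Hn n)"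
    and "\<And>c \<xi>. c \<in> C \<Longrightarrow> (\<lambda>n. Hn n c \<xi>) \<longlonglongrightarrow> H c \<xi>" and "c \<in> C"
  shows "(\<lambda>n. load (Hn n) c i \<xi>) \<longlonglongrightarrow> load H c i \<xi>"
  unfolding load_def by (rule iter_tendsto[OF assms])

section \<open>Arrival times along the paths and bounds for them\<close>

definition arrival :: "('c \<Rightarrow> real \<Rightarrow> real) \<Rightarrow> 'c \<Rightarrow> real \<Rightarrow> real" where
  "arrival H c = fold (link_exit (load H)) (pt c)"

lemma arrival_tendsto:
  assumes "inflows H" "\<And>n. inflows (Hn n)"
    and "\<And>c \<xi>. c \<in> C \<Longrightarrow> (\<lambda>n. Hn n c \<xi>) \<longlonglongrightarrow> H c \<xi>"
  shows "(\<lambda>n. arrival (Hn n) c \<theta>) \<longlonglongrightarrow> arrival H c \<theta>"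
  unfolding arrival_def
  by (rule fold_tendsto[OF link_exit_mono[OF flows_load[OF assms(2)]] link_exit_isCont[OF flows_load[OF assms(1)]]
     link_exit_tendsto[OF flows_load[OF assms(1)] flows_load[OF assms(2)] load_tendsto[OF assms]] tendsto_const])

lemma arrival_props:
  assumes H: "inflows H"
  shows arrival_mono: "x \<le> y \<Longrightarrow> arrival H c x \<le> arrival H c y"
    and arrival_cont: "continuous_on UNIV (arrival H c)"
    and arrival_ge: "x \<le> arrival H c x"
proof -
  note X = flows_load[OF H]
  show "x \<le> y \<Longrightarrow> arrival H c x \<le> arrival H c y"
    unfolding arrival_def by (rule fold_mono[OF link_exit_mono[OF X]])
  show "continuous_on UNIV (arrival H c)"
    unfolding arrival_def by (rule continuous_fold[OF link_exit_cont[OF X]])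
  show "x \<le> arrival H c x"
    unfolding arrival_def by (rule fold_ge[OF less_imp_le[OF link_exit_gt[OF X]]])
qed

text \<open>Transport along the path: what has departed by \<open>\<theta>\<close> is what has
  reached the \<open>i\<close>-th link by the corresponding arrival time. This translates between
  departure times and link times.\<close>

lemma load_prefix:
  assumes H: "inflows H" and c: "c \<in> C" and i: "i \<le> length (pt c)"
  shows "load H c i (fold (link_exit (load H)) (take i (pt c)) \<theta>) = H c \<theta>"
  using i
proof (induction i)
  case (Suc i)
  then show ?case using load_Suc[OF H c, of i] by (simp add: take_Suc_conv_app_nth)
qed (simp add: load_0[OF H c])

lemma load_le:
  assumes H: "inflows H" and c: "c \<in> C" and B: "\<And>\<theta>. H c \<theta> \<le> B"
    and i: "i \<le> length (pt c)"
  shows "load H c i \<xi> \<le> B"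
proof -
  have "load H c i \<xi> \<le> load H c i (fold (link_exit (load H)) (take i (pt c)) \<xi>)"
    by (rule cum_flow_mono[OF flowsD[OF flows_load[OF H] c]],
        rule fold_ge, rule less_imp_le[OF link_exit_gt[OF flows_load[OF H]]])
  then show ?thesis using load_prefix[OF H c i] B by (metis order_trans)
qed

lemma agg_load_le:
  assumes H: "inflows H" and B: "\<And>c \<theta>. c \<in> C \<Longrightarrow> H c \<theta> \<le> B" "0 \<le> B"
  shows "link_inflow (load H) e \<theta> \<le> (\<Sum>c\<in>C. real (length (pt c)) * B)"
  unfolding link_inflow_def
proof (rule sum_mono)
  fix c assume c: "c \<in> C"
  let ?I = "{i. i < length (pt c) \<and> pt c ! i = e}"
  have "(\<Sum>i\<in>?I. load H c i \<theta>) \<le> of_nat (card ?I) * B"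
    by (rule sum_bounded_above) (use load_le[OF H c B(1)[OF c]] in auto)
  also have "card ?I \<le> length (pt c)" using card_mono[of "{..<length (pt c)}" ?I] by auto
  then have "of_nat (card ?I) * B \<le> real (length (pt c)) * B" using B(2) by (intro mult_right_mono) auto
  finally show "(\<Sum>i\<in>?I. load H c i \<theta>) \<le> real (length (pt c)) * B" .
qed

text \<open>The point is that \<open>D\<close> does not depend on \<open>H\<close>. A path's
  cumulative inflow never exceeds \<open>B\<close>, so a link receives at most \<open>M\<close> in
  total, and its waiting time is at most \<open>M / \<nu> e\<close>. \<open>D1\<close> bounds the
  time spent on any link in use, and \<open>L\<close> the number of links on any path.\<close>

lemma arrival_bound:
  assumes "0 \<le> B"
  shows "\<exists>D. \<forall>H. (\<forall>c\<in>C. cum_flow (H c) \<and> (\<forall>\<theta>. H c \<theta> \<le> B)) \<longrightarrow> (\<forall>c\<in>C. \<forall>\<theta>. arrival H c \<theta> \<le> \<theta> + D)"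
proof -
  define M where "M = (\<Sum>c\<in>C. real (length (pt c)) * B)"
  define E where "E = (\<Union>c\<in>C. set (pt c))"
  have fE: "finite E" unfolding E_def using finite_C by auto
  define D1 where "D1 = (\<Sum>e\<in>E. \<tau> e + M / \<nu> e)"
  have M0: "0 \<le> M" unfolding M_def using assms by (intro sum_nonneg) auto
  have nn: "0 \<le> \<tau> e + M / \<nu> e" for e using delay_le[of e] delay_pos rate_pos[of e] M0 by auto
  then have D10: "0 \<le> D1" unfolding D1_def by (intro sum_nonneg) auto
  define L where "L = (\<Sum>c\<in>C. length (pt c))"
  have "arrival H c \<theta> \<le> \<theta> + real L * D1"
    if H: "\<forall>c\<in>C. cum_flow (H c) \<and> (\<forall>\<theta>. H c \<theta> \<le> B)" and c: "c \<in> C" for H c \<theta>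
  proof -
    have Hc: "inflows H" using H by (auto simp: inflows_def)
    have le: "link_exit (load H) e \<theta> \<le> \<theta> + D1" if e: "e \<in> E" for e \<theta>
    proof -
      have "link_exit (load H) e \<theta> \<le> \<theta> + \<tau> e + link_inflow (load H) e \<theta> / \<nu> e"
        unfolding link_exit_def by (rule queue_exit_le[OF rate_pos cum_flow_agg[OF flows_load[OF Hc]]])
      moreover have "link_inflow (load H) e \<theta> / \<nu> e \<le> M / \<nu> e"
        unfolding M_def using H assms Hc less_imp_le[OF rate_pos] by (intro divide_right_mono agg_load_le) auto
      moreover have "\<tau> e + M / \<nu> e \<le> D1"
        unfolding D1_def by (rule member_le_sum[of e E "\<lambda>e. \<tau> e + M / \<nu> e"]) (use e fE nn in auto)
      ultimately show ?thesis by linarith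
    qed
    have "set P \<subseteq> E \<Longrightarrow> fold (link_exit (load H)) P \<theta> \<le> \<theta> + real (length P) * D1" for P \<theta>
    proof (induction P arbitrary: \<theta>)
      case (Cons e P)
      have "fold (link_exit (load H)) P (link_exit (load H) e \<theta>) \<le> link_exit (load H) e \<theta> + real (length P) * D1"
        using Cons by auto
      also have "link_exit (load H) e \<theta> \<le> \<theta> + D1" using le Cons.prems by auto
      finally show ?case by (simp add: algebra_simps)
    qed simp
    from this[of "pt c" \<theta>] have "arrival H c \<theta> \<le> \<theta> + real (length (pt c)) * D1"
      using c by (auto simp: arrival_def E_def)
    also have "real (length (pt c)) * D1 \<le> real L * D1"
      unfolding L_def using finite_C c D10 by (intro mult_right_mono) (auto intro: member_le_sum)
    finally show ?thesis by simp
  qed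
  then show ?thesis by blast
qed

section \<open>Link outflows and densities of the loaded flow\<close>

definition link_outflow :: "('c \<Rightarrow> nat \<Rightarrow> real \<Rightarrow> real) \<Rightarrow> 'e \<Rightarrow> real \<Rightarrow> real" where
  "link_outflow X e \<theta> = (\<Sum>c\<in>C. \<Sum>i | i < length (pt c) \<and> pt c ! i = e. X c (Suc i) \<theta>)"

lemma cum_flow_out: "flows X \<Longrightarrow> cum_flow (link_outflow X e)"
  unfolding link_outflow_def by (rule cum_flow_sum, rule cum_flow_sum, rule flowsD)

lemma out_load:
  assumes H: "inflows H"
  shows "link_outflow (load H) e (\<theta> + \<tau> e) = \<nu> e * \<theta> - slack (\<nu> e) (link_inflow (load H) e) \<theta>"
proof -
  obtain a where a: "link_exit (load H) e a = \<theta> + \<tau> e" using link_exit_surj[OF flows_load[OF H]] by blast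
  have "link_outflow (load H) e (\<theta> + \<tau> e) = link_inflow (load H) e a"
    unfolding link_outflow_def link_inflow_def a[symmetric]
    by (intro sum.cong refl) (use load_Suc[OF H] in blast)
  also have "\<dots> = \<nu> e * \<theta> - slack (\<nu> e) (link_inflow (load H) e) \<theta>"
    by (rule slack_at_exit[OF rate_pos cum_flow_agg[OF flows_load[OF H]]])
      (use a in \<open>simp add: link_exit_def\<close>)
  finally show ?thesis .
qed

lemma load_lipschitz:
  assumes H: "inflows H" and c: "c \<in> C" and i: "i < length (pt c)" and xy: "x \<le> y"
  shows "load H c (Suc i) y - load H c (Suc i) x \<le> \<nu> (pt c ! i) * (y - x)"
proof -
  let ?T = "link_exit (load H) (pt c ! i)"
  note X = flows_load[OF H]
  obtain a where a: "?T a = x" using link_exit_surj[OF X] by blast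
  obtain b where b: "?T b = y" using link_exit_surj[OF X] by blast
  have "a \<le> b \<or> x = y" using monoD[OF link_exit_mono[OF X, of "pt c ! i"], of b a] a b xy by linarith
  moreover have "load H c i b - load H c i a \<le> \<nu> (pt c ! i) * (?T b - ?T a)" if "a \<le> b"
    using carries_link_exit[OF X c i refl] that by (simp add: carries_def)
  ultimately show ?thesis using load_Suc[OF H c i, of a] load_Suc[OF H c i, of b] a b by auto
qed

text \<open>There are two sources of domination: the first index is controlled by the network inflow
  \<open>V\<close>, every later one by the rate of the link just left.\<close>

lemma load_density:
  assumes H: "inflows H" and c: "c \<in> C" and i: "i \<le> length (pt c)"
    and V: "density_of g V" "cum_flow V" and dom: "\<And>x y. x \<le> y \<Longrightarrow> H c y - H c x \<le> V y - V x"
  shows "\<exists>f. density_of f (load H c i)"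
proof -
  have cf: "cum_flow (load H c i)" by (rule flowsD[OF flows_load[OF H] c])
  then have mc: "mono (load H c i)" "continuous_on UNIV (load H c i)" by (simp_all add: cum_flow_def)
  show ?thesis
  proof (cases i)
    case 0
    show ?thesis
      by (rule density_of_exists[OF mc _ _ V(1)]) (use V(2) dom in \<open>auto simp: cum_flow_def 0 load_0[OF H c]\<close>)
  next
    case (Suc j)
    let ?\<nu> = "\<nu> (pt c ! j)"
    show ?thesis
    proof (rule density_of_exists[OF mc])
      show "mono (\<lambda>x. ?\<nu> * x)" using rate_pos[of "pt c ! j"] by (auto simp: mono_def)
      show "continuous_on UNIV (\<lambda>x. ?\<nu> * x)" by (intro continuous_intros)
      show "density_of (\<lambda>_. ?\<nu>) (\<lambda>x. ?\<nu> * x)" using rate_pos[of "pt c ! j"] by (intro density_of_linear) simp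
      show "load H c i b - load H c i a \<le> ?\<nu> * b - ?\<nu> * a" if "a \<le> b" for a b
        using load_lipschitz[OF H c _ that, of j] i Suc by (simp add: algebra_simps)
    qed
  qed
qed

end

section \<open>Equilibrium path inflows\<close>

text \<open>\<open>grp\<close> stands for the origin-destination pair of a path, and
  \<open>U\<close> for the cumulative network inflow of a pair. Constancy after \<open>T\<close>
  leaves only finitely many grid cells to be decided.\<close>

locale path_choice = path_network C pt \<nu> \<tau> \<delta>
  for C :: "'c set" and pt :: "'c \<Rightarrow> 'e list" and \<nu> \<tau> :: "'e \<Rightarrow> real" and \<delta> :: real +
  fixes grp :: "'c \<Rightarrow> 's" and U :: "'s \<Rightarrow> real \<Rightarrow> real" and T :: real
  assumes U: "\<And>c. c \<in> C \<Longrightarrow> cum_flow (U (grp c))"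
    and U_const: "\<And>c \<theta>. c \<in> C \<Longrightarrow> T \<le> \<theta> \<Longrightarrow> U (grp c) \<theta> = U (grp c) T"
begin

definition peers :: "'c \<Rightarrow> 'c set" where
  "peers c = {c' \<in> C. grp c' = grp c}"

lemma peers_simps: "finite (peers c)" "c \<in> C \<Longrightarrow> c \<in> peers c" "c' \<in> peers c \<Longrightarrow> c' \<in> C"
    "c' \<in> peers c \<Longrightarrow> grp c' = grp c" "c' \<in> peers c \<Longrightarrow> peers c' = peers c"
  using finite_C by (auto simp: peers_def)

text \<open>Only paths that are best up to \<open>\<epsilon>\<close> get a positive weight, and the weights depend continuously on
  the path costs \<open>y\<close>.\<close>

definition raw_weight :: "real \<Rightarrow> ('c \<Rightarrow> real) \<Rightarrow> 'c \<Rightarrow> real" where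
  "raw_weight \<epsilon> y c = (\<Prod>c'\<in>peers c. max 0 (\<epsilon> + y c' - y c))"

definition weight :: "real \<Rightarrow> ('c \<Rightarrow> real) \<Rightarrow> 'c \<Rightarrow> real" where
  "weight \<epsilon> y c = raw_weight \<epsilon> y c / (\<Sum>c'\<in>peers c. raw_weight \<epsilon> y c')"

lemma raw_weight_nonneg: "0 \<le> raw_weight \<epsilon> y c"
  unfolding raw_weight_def by (intro prod_nonneg) auto

text \<open>For a cheapest peer every factor is at least \<open>\<epsilon>\<close>, so the
  normalisation in \<open>weight\<close> is legitimate.\<close>

lemma raw_weight_sum_pos:
  assumes e: "\<epsilon> > 0" and c: "c \<in> C" shows "0 < (\<Sum>c'\<in>peers c. raw_weight \<epsilon> y c')"
proof -
  have ne: "peers c \<noteq> {}" using peers_simps(2)[OF c] by auto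
  define c0 where "c0 = arg_min_on y (peers c)"
  have c0: "c0 \<in> peers c" "\<And>c'. c' \<in> peers c \<Longrightarrow> y c0 \<le> y c'"
    using arg_min_if_finite[OF peers_simps(1) ne, of y] unfolding c0_def by (auto simp: not_less)
  have "0 < raw_weight \<epsilon> y c0"
    unfolding raw_weight_def peers_simps(5)[OF c0(1)]
  proof (rule prod_pos)
    fix c' assume "c' \<in> peers c"
    then have "y c0 \<le> y c'" by (rule c0(2))
    then show "0 < max 0 (\<epsilon> + y c' - y c0)" using e by simp
  qed
  then show ?thesis
    using sum_pos2[OF peers_simps(1) c0(1)] raw_weight_nonneg by blast
qed

lemma weight_nonneg: "0 \<le> weight \<epsilon> y c"
  unfolding weight_def by (intro divide_nonneg_nonneg raw_weight_nonneg sum_nonneg)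

lemma weight_sum:
  assumes "\<epsilon> > 0" "c \<in> C" shows "(\<Sum>c'\<in>peers c. weight \<epsilon> y c') = 1"
proof -
  have "(\<Sum>c'\<in>peers c. weight \<epsilon> y c') = (\<Sum>c'\<in>peers c. raw_weight \<epsilon> y c' / (\<Sum>c'\<in>peers c. raw_weight \<epsilon> y c'))"
    by (rule sum.cong) (simp_all add: weight_def peers_simps(5))
  also have "\<dots> = 1" using raw_weight_sum_pos[OF assms, of y] by (simp add: sum_divide_distrib[symmetric])
  finally show ?thesis .
qed

lemma weight_zero:
  assumes "c' \<in> peers c" "y c' + \<epsilon> \<le> y c" shows "weight \<epsilon> y c = 0"
proof -
  have "raw_weight \<epsilon> y c = 0"
    unfolding raw_weight_def by (rule prod_zero[OF peers_simps(1)]) (use assms in \<open>auto intro!: bexI[of _ c']\<close>)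
  then show ?thesis by (simp add: weight_def)
qed

lemma weight_tendsto:
  assumes e: "\<epsilon> > 0" and c: "c \<in> C" and lim: "\<And>c. c \<in> C \<Longrightarrow> (\<lambda>n. Y n c) \<longlonglongrightarrow> y c"
  shows "(\<lambda>n. weight \<epsilon> (Y n) c) \<longlonglongrightarrow> weight \<epsilon> y c"
proof -
  have r: "(\<lambda>n. raw_weight \<epsilon> (Y n) c') \<longlonglongrightarrow> raw_weight \<epsilon> y c'" if "c' \<in> C" for c'
    unfolding raw_weight_def
  proof (rule tendsto_prod)
    fix d assume "d \<in> peers c'"
    then have "d \<in> C" by (rule peers_simps(3))
    then show "(\<lambda>n. max 0 (\<epsilon> + Y n d - Y n c')) \<longlonglongrightarrow> max 0 (\<epsilon> + y d - y c')"
      using lim[of d] lim[OF that] by (intro tendsto_max tendsto_diff tendsto_add tendsto_const)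
  qed
  have "(\<lambda>n. \<Sum>c'\<in>peers c. raw_weight \<epsilon> (Y n) c') \<longlonglongrightarrow> (\<Sum>c'\<in>peers c. raw_weight \<epsilon> y c')"
    by (rule tendsto_sum) (rule r, rule peers_simps(3))
  then show ?thesis
    unfolding weight_def using r[OF c] raw_weight_sum_pos[OF e c, of y] by (intro tendsto_divide) auto
qed

text \<open>The difference of the two \<open>U\<close> terms is the inflow of the group that falls
  into the cell from \<open>k / N\<close> to \<open>(k + 1) / N\<close> and has departed by
  \<open>\<theta>\<close>. Within a cell it is split in constant proportions, determined by the
  costs \<open>y (c, k)\<close> attached to the left end of the cell.\<close>

definition shares :: "nat \<Rightarrow> nat \<Rightarrow> ('c \<times> nat \<Rightarrow> real) \<Rightarrow> 'c \<Rightarrow> real \<Rightarrow> real" where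
  "shares N K y c \<theta> = (\<Sum>k<K. weight (1 / N) (\<lambda>c. y (c, k)) c *
     (U (grp c) (min \<theta> (real (Suc k) / N)) - U (grp c) (min \<theta> (real k / N))))"

lemma dU_mono:
  assumes c: "c \<in> C" and xy: "x \<le> y" and pq: "p \<le> q"
  shows "U (grp c) (min x q) - U (grp c) (min x p) \<le> U (grp c) (min y q) - U (grp c) (min y p)"
proof -
  note m = cum_flow_mono[OF U[OF c]]
  consider "y \<le> p" | "x \<le> p" "p < y" | "p < x" "x \<le> q" | "q < x" by linarith
  then show ?thesis
  proof cases
    case 2
    then show ?thesis using m[of p "min y q"] pq by (simp add: min_def split: if_splits)
  next
    case 3
    then show ?thesis using m[of x "min y q"] pq xy by (simp add: min_def)
  qed (use xy pq in \<open>simp_all add: min_def\<close>)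
qed

lemma inflows_shares: "inflows (shares N K y)"
  unfolding inflows_def
proof (intro ballI cum_flowI)
  fix c assume c: "c \<in> C"
  show "shares N K y c x \<le> shares N K y c z" if "x \<le> z" for x z
    unfolding shares_def
    by (rule sum_mono, rule mult_left_mono[OF dU_mono[OF c that] weight_nonneg]) (simp add: divide_right_mono)
  have cU: "continuous_on UNIV (\<lambda>\<theta>. U (grp c) (min \<theta> z))" for z
    by (rule continuous_on_compose2[OF cum_flow_cont[OF U[OF c], of UNIV]])
      (auto intro!: continuous_intros)
  show "continuous_on UNIV (shares N K y c)"
    unfolding shares_def by (intro continuous_on_sum continuous_on_mult continuous_on_diff continuous_on_const cU)
  show "shares N K y c x = 0" if "x \<le> 0" for x
  proof -
    have "min x (real k / N) \<le> 0" for k using that by auto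
    then have "U (grp c) (min x (real k / N)) = 0" for k by (rule cum_flow_zero[OF U[OF c]])
    then show ?thesis unfolding shares_def by (simp del: of_nat_Suc)
  qed
qed

lemma shares_sum:
  assumes N: "N > 0" and K: "T \<le> real K / N" and c: "c \<in> C"
  shows "(\<Sum>c'\<in>peers c. shares N K y c' \<theta>) = U (grp c) \<theta>"
proof -
  let ?d = "\<lambda>k. U (grp c) (min \<theta> (real (Suc k) / N)) - U (grp c) (min \<theta> (real k / N))"
  have "(\<Sum>c'\<in>peers c. shares N K y c' \<theta>) = (\<Sum>c'\<in>peers c. \<Sum>k<K. weight (1 / N) (\<lambda>c. y (c, k)) c' * ?d k)"
    by (rule sum.cong) (auto simp: shares_def peers_simps(4))
  also have "\<dots> = (\<Sum>k<K. \<Sum>c'\<in>peers c. weight (1 / N) (\<lambda>c. y (c, k)) c' * ?d k)"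
    by (rule sum.swap)
  also have "\<dots> = (\<Sum>k<K. ?d k)"
    using weight_sum[of "1 / N" c] c N by (simp add: sum_distrib_right[symmetric])
  also have "\<dots> = U (grp c) (min \<theta> (real K / N)) - U (grp c) (min \<theta> (real 0 / N))"
    by (rule sum_lessThan_telescope)
  also have "U (grp c) (min \<theta> (real 0 / N)) = 0" by (rule cum_flow_zero[OF U[OF c]]) simp
  also have "U (grp c) (min \<theta> (real K / N)) = U (grp c) \<theta>"
    using U_const[OF c K] U_const[OF c, of \<theta>] K by (auto simp: min_def)
  finally show ?thesis by simp
qed

lemma shares_dominated:
  assumes H: "inflows H" and sum: "\<And>\<theta>. (\<Sum>c'\<in>peers c. H c' \<theta>) = U (grp c) \<theta>" and c: "c \<in> C" and xy: "x \<le> y"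
  shows "H c y - H c x \<le> U (grp c) y - U (grp c) x"
proof -
  have "H c y - H c x \<le> (\<Sum>c'\<in>peers c. H c' y - H c' x)"
  proof (rule member_le_sum[OF peers_simps(2)[OF c] _ peers_simps(1)])
    fix d assume "d \<in> peers c - {c}"
    then have "cum_flow (H d)" using H by (auto simp: inflows_def peers_def)
    then show "0 \<le> H d y - H d x" using cum_flow_mono[OF _ xy] by fastforce
  qed
  also have "\<dots> = U (grp c) y - U (grp c) x" by (simp add: sum_subtractf sum)
  finally show ?thesis .
qed

text \<open>At the fixed point, \<open>y (c, k)\<close> is the arrival time of \<open>c\<close> for
  departure at \<open>k / N\<close>, divided by \<open>B\<close>. A tolerance of
  \<open>1 / N\<close> in these units is a delay of \<open>B / N\<close>. The window starts at
  \<open>a - 1 / N\<close> because a cell meeting the interval may begin up to one cell width before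
  it.\<close>

lemma quasi_equilibrium:
  obtains B where "\<And>N. N > 0 \<Longrightarrow> \<exists>H. inflows H \<and> (\<forall>c\<in>C. \<forall>\<theta>. (\<Sum>c'\<in>peers c. H c' \<theta>) = U (grp c) \<theta>) \<and>
     (\<forall>c\<in>C. \<forall>c'\<in>peers c. \<forall>a b. a \<le> b \<longrightarrow>
        (\<forall>\<theta>\<in>{a - 1 / real N..b}. arrival H c' \<theta> + B / real N \<le> arrival H c \<theta>) \<longrightarrow> H c a = H c b)"
proof -
  define M where "M = (\<Sum>c\<in>C. U (grp c) T)"
  have UM: "U (grp c) \<theta> \<le> M" if c: "c \<in> C" for c \<theta>
  proof -
    have "U (grp c) \<theta> \<le> U (grp c) T"
      using cum_flow_mono[OF U[OF c], of \<theta> T] U_const[OF c, of \<theta>] by (cases "\<theta> \<le> T") auto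
    also have "\<dots> \<le> M" unfolding M_def
      by (rule member_le_sum[OF c _ finite_C]) (rule cum_flow_nonneg[OF U], blast)
    finally show ?thesis .
  qed
  have "0 \<le> M" unfolding M_def by (rule sum_nonneg) (rule cum_flow_nonneg[OF U])
  from arrival_bound[OF this] obtain D where
    D: "\<forall>H. (\<forall>c\<in>C. cum_flow (H c) \<and> (\<forall>\<theta>. H c \<theta> \<le> M)) \<longrightarrow> (\<forall>c\<in>C. \<forall>\<theta>. arrival H c \<theta> \<le> \<theta> + D)" by blast
  define L where "L = nat \<lceil>T\<rceil>"
  have TL: "T \<le> real L" unfolding L_def by linarith
  \<comment> \<open>Grid times are at most \<open>L\<close>, so \<open>L + D\<close> bounds all
    arrival times that occur, for every \<open>N\<close>; division by \<open>B\<close> brings them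
    into the unit interval. The maximum with 1 makes \<open>B\<close> positive.\<close>
  define B where "B = max 1 (real L + D)"
  have B: "B > 0" "real L + D \<le> B" unfolding B_def by auto
  have "\<exists>H. inflows H \<and> (\<forall>c\<in>C. \<forall>\<theta>. (\<Sum>c'\<in>peers c. H c' \<theta>) = U (grp c) \<theta>) \<and>
     (\<forall>c\<in>C. \<forall>c'\<in>peers c. \<forall>a b. a \<le> b \<longrightarrow>
        (\<forall>\<theta>\<in>{a - 1 / real N..b}. arrival H c' \<theta> + B / real N \<le> arrival H c \<theta>) \<longrightarrow> H c a = H c b)"
    if N: "N > 0" for N
  proof -
    \<comment> \<open>The cells of width \<open>1 / N\<close> then fill the interval from 0 to
      \<open>L\<close>, which reaches beyond \<open>T\<close>.\<close>
    define K where "K = L * N"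
    have KN: "real K / N = L" using N by (simp add: K_def)
    have e: "1 / real N > 0" using N by simp
    define S where "S = shares N K"
    have inf: "inflows (S y)" for y unfolding S_def by (rule inflows_shares)
    have sum: "(\<Sum>c'\<in>peers c. S y c' \<theta>) = U (grp c) \<theta>" if "c \<in> C" for c y \<theta>
      unfolding S_def by (rule shares_sum[OF N _ that]) (use KN TL in simp)
    have SM: "S y c \<theta> \<le> M" if c: "c \<in> C" for y c \<theta>
    proof -
      have "S y c \<theta> \<le> (\<Sum>c'\<in>peers c. S y c' \<theta>)"
        by (rule member_le_sum[OF peers_simps(2)[OF c] _ peers_simps(1)])
          (use inf[of y] in \<open>auto simp: inflows_def peers_def intro: cum_flow_nonneg\<close>)
      then show ?thesis using sum[OF c] UM[OF c, of \<theta>] by simp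
    qed
    define f where "f = (\<lambda>y i. arrival (S y) (fst i) (real (snd i) / N) / B)"
    have "\<exists>y. \<forall>i\<in>C \<times> {..<K}. y i \<in> {0..1} \<and> f y i = y i"
    proof (rule brouwer_finite_cube)
      show "finite (C \<times> {..<K})" using finite_C by simp
    next
      fix y i assume i: "i \<in> C \<times> {..<K}"
      have "real (snd i) / N \<le> real K / N" using i N by (intro divide_right_mono) auto
      then have "arrival (S y) (fst i) (real (snd i) / N) \<le> B"
        using D[rule_format, of "S y" "fst i" "real (snd i) / N"] SM inf[of y] i B(2) KN
        by (auto simp: inflows_def)
      moreover have "0 \<le> arrival (S y) (fst i) (real (snd i) / N)"
        by (rule order_trans[OF _ arrival_ge[OF inf]]) simp
      ultimately show "f y i \<in> {0..1}" using B(1) by (simp add: f_def)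
    next
      fix Y :: "nat \<Rightarrow> 'c \<times> nat \<Rightarrow> real" and y i
      assume lim: "\<And>j. j \<in> C \<times> {..<K} \<Longrightarrow> (\<lambda>n. Y n j) \<longlonglongrightarrow> y j"
      have "(\<lambda>n. S (Y n) c \<xi>) \<longlonglongrightarrow> S y c \<xi>" if c: "c \<in> C" for c \<xi>
        unfolding S_def shares_def
        by (rule tendsto_sum, rule tendsto_mult[OF weight_tendsto[OF e c] tendsto_const], rule lim) auto
      then have "(\<lambda>n. arrival (S (Y n)) c \<theta>) \<longlonglongrightarrow> arrival (S y) c \<theta>" for c \<theta>
        by (rule arrival_tendsto[OF inf inf])
      then show "(\<lambda>n. f (Y n) i) \<longlonglongrightarrow> f y i"
        unfolding f_def using B(1) by (intro tendsto_divide tendsto_const) auto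
    qed
    then obtain y where fx: "\<forall>i\<in>C \<times> {..<K}. y i \<in> {0..1} \<and> f y i = y i" by blast
    have y: "y (c, k) = arrival (S y) c (real k / N) / B" if "c \<in> C" "k < K" for c k
    proof -
      have "f y (c, k) = y (c, k)" using fx that by blast
      then show ?thesis unfolding f_def by simp
    qed
    have "S y c a = S y c b"
      if c: "c \<in> C" and c': "c' \<in> peers c" and ab: "a \<le> b"
        and gap: "\<And>\<theta>. \<theta> \<in> {a - 1 / real N..b} \<Longrightarrow> arrival (S y) c' \<theta> + B / real N \<le> arrival (S y) c \<theta>"
      for c c' a b
      unfolding S_def shares_def
    proof (rule sum.cong[OF refl])
      fix k assume "k \<in> {..<K}"
      then have k: "k < K" by simp
      let ?p = "real k / N" and ?q = "real (Suc k) / N"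
      have pq: "?q = ?p + 1 / N" by (simp add: add_divide_distrib)
      \<comment> \<open>A cell after \<open>b\<close> has contributed nothing at either time, and a
        cell before \<open>a\<close> has contributed fully at both. Any other cell has its left end
        in the window, and there \<open>c\<close> has weight 0.\<close>
      consider "b \<le> ?p" | "?q \<le> a" | "?p \<in> {a - 1 / real N..b}" using pq by force
      then show "weight (1 / N) (\<lambda>c. y (c, k)) c * (U (grp c) (min a ?q) - U (grp c) (min a ?p)) =
        weight (1 / N) (\<lambda>c. y (c, k)) c * (U (grp c) (min b ?q) - U (grp c) (min b ?p))"
      proof cases
        case 1
        then have "b \<le> ?q" "a \<le> ?p" "a \<le> ?q" using ab pq e by linarith+
        then have "min a ?q = a" "min a ?p = a" "min b ?q = b" "min b ?p = b"
          using 1 by (simp_all only: min_absorb1)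
        then show ?thesis by simp
      next
        case 2
        then have "?p \<le> a" "?p \<le> b" "?q \<le> b" using ab pq e by linarith+
        then have "min a ?q = ?q" "min a ?p = ?p" "min b ?q = ?q" "min b ?p = ?p"
          using 2 by (simp_all only: min_absorb2)
        then show ?thesis by simp
      next
        case 3
        have c'C: "c' \<in> C" using c' by (rule peers_simps(3))
        have "arrival (S y) c' ?p / B + 1 / real N \<le> arrival (S y) c ?p / B"
        proof -
          have "(arrival (S y) c' ?p + B / real N) / B \<le> arrival (S y) c ?p / B"
            using gap[OF 3] B(1) by (intro divide_right_mono) auto
          then show ?thesis using B(1) by (simp add: add_divide_distrib)
        qed
        then have "y (c', k) + 1 / N \<le> y (c, k)" using y[OF c k] y[OF c'C k] by simp
        then have "weight (1 / N) (\<lambda>c. y (c, k)) c = 0" by (rule weight_zero[OF c'])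
        then show ?thesis by simp
      qed
    qed
    then show ?thesis using inf[of y] sum by (intro exI[of _ "S y"]) blast
  qed
  then show ?thesis using that by blast
qed

theorem equilibrium_exists:
  "\<exists>H. inflows H \<and> (\<forall>c\<in>C. \<forall>\<theta>. (\<Sum>c'\<in>peers c. H c' \<theta>) = U (grp c) \<theta>) \<and>
     (\<forall>c\<in>C. \<forall>c'\<in>peers c. \<forall>\<theta>. (\<forall>\<theta>'<\<theta>. H c \<theta>' < H c \<theta>) \<longrightarrow> arrival H c \<theta> \<le> arrival H c' \<theta>)"
proof -
  obtain B where B: "\<And>N. N > 0 \<Longrightarrow> \<exists>H. inflows H \<and> (\<forall>c\<in>C. \<forall>\<theta>. (\<Sum>c'\<in>peers c. H c' \<theta>) = U (grp c) \<theta>) \<and>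
     (\<forall>c\<in>C. \<forall>c'\<in>peers c. \<forall>a b. a \<le> b \<longrightarrow>
        (\<forall>\<theta>\<in>{a - 1 / real N..b}. arrival H c' \<theta> + B / real N \<le> arrival H c \<theta>) \<longrightarrow> H c a = H c b)"
    using quasi_equilibrium by blast
  have "\<forall>n. \<exists>H. inflows H \<and> (\<forall>c\<in>C. \<forall>\<theta>. (\<Sum>c'\<in>peers c. H c' \<theta>) = U (grp c) \<theta>) \<and>
     (\<forall>c\<in>C. \<forall>c'\<in>peers c. \<forall>a b. a \<le> b \<longrightarrow>
        (\<forall>\<theta>\<in>{a - 1 / real (Suc n)..b}. arrival H c' \<theta> + B / real (Suc n) \<le> arrival H c \<theta>) \<longrightarrow> H c a = H c b)"
    using B by blast
  from choice[OF this] obtain Hn where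
    inf: "\<And>n. inflows (Hn n)" and sum: "\<And>n c \<theta>. c \<in> C \<Longrightarrow> (\<Sum>c'\<in>peers c. Hn n c' \<theta>) = U (grp c) \<theta>"
    and quasi: "\<And>n c c' a b. c \<in> C \<Longrightarrow> c' \<in> peers c \<Longrightarrow> a \<le> b \<Longrightarrow>
        (\<forall>\<theta>\<in>{a - 1 / real (Suc n)..b}. arrival (Hn n) c' \<theta> + B / real (Suc n) \<le> arrival (Hn n) c \<theta>) \<Longrightarrow>
        Hn n c a = Hn n c b"
    by blast
  obtain \<phi> :: "nat \<Rightarrow> nat" and H where \<phi>: "strict_mono \<phi>" and H: "\<forall>c\<in>C. cum_flow (H c)"
    and lim: "\<forall>c\<in>C. \<forall>x. (\<lambda>n. Hn (\<phi> n) c x) \<longlonglongrightarrow> H c x"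
  proof (rule dominated_cum_flow_subseq[of C "\<lambda>c. U (grp c)" Hn])
    show "finite C" by (rule finite_C)
    show "cum_flow (U (grp c))" if "c \<in> C" for c by (rule U[OF that])
    show "cum_flow (Hn n c)" if "c \<in> C" for n c using inf that by (auto simp: inflows_def)
    show "Hn n c y - Hn n c x \<le> U (grp c) y - U (grp c) x" if "c \<in> C" "x \<le> y" for n c x y
      by (rule shares_dominated[OF inf sum[OF that(1)] that])
  qed blast
  have infH: "inflows H" using H by (simp add: inflows_def)
  have lim: "c \<in> C \<Longrightarrow> (\<lambda>n. Hn (\<phi> n) c x) \<longlonglongrightarrow> H c x" for c x using lim by blast
  have alim: "(\<lambda>n. arrival (Hn (\<phi> n)) c \<theta>) \<longlonglongrightarrow> arrival H c \<theta>" for c \<theta>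
    by (rule arrival_tendsto[OF infH inf lim])
  have sumH: "(\<Sum>c'\<in>peers c. H c' \<theta>) = U (grp c) \<theta>" if c: "c \<in> C" for c \<theta>
  proof (rule LIMSEQ_unique)
    show "(\<lambda>n. \<Sum>c'\<in>peers c. Hn (\<phi> n) c' \<theta>) \<longlonglongrightarrow> (\<Sum>c'\<in>peers c. H c' \<theta>)"
      by (rule tendsto_sum) (rule lim, rule peers_simps(3))
    show "(\<lambda>n. \<Sum>c'\<in>peers c. Hn (\<phi> n) c' \<theta>) \<longlonglongrightarrow> U (grp c) \<theta>"
      by (simp add: sum[OF c])
  qed
  have opt: "arrival H c \<theta> \<le> arrival H c' \<theta>"
    if c: "c \<in> C" and c': "c' \<in> peers c" and incr: "\<forall>\<theta>'<\<theta>. H c \<theta>' < H c \<theta>" for c c' \<theta>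
  proof (rule ccontr)
    assume less: "\<not> arrival H c \<theta> \<le> arrival H c' \<theta>"
    \<comment> \<open>The gap is spent in four parts: the change of the arrival time of
      \<open>c\<close> between \<open>\<theta> - 2 * r\<close> and \<open>\<theta>\<close>, the two
      approximation errors, and the tolerance.\<close>
    define g where "g = (arrival H c \<theta> - arrival H c' \<theta>) / 4"
    have g: "g > 0" and geq: "arrival H c \<theta> = arrival H c' \<theta> + 4 * g"
      using less unfolding g_def by (simp, simp add: field_simps)
    have "isCont (arrival H c) \<theta>"
      using arrival_cont[OF infH, of c] by (simp add: continuous_on_eq_continuous_at)
    then obtain d where d: "d > 0" "\<And>x. \<bar>x - \<theta>\<bar> < d \<Longrightarrow> \<bar>arrival H c x - arrival H c \<theta>\<bar> < g"
      using g unfolding continuous_at_eps_delta by (auto simp: dist_real_def)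
    \<comment> \<open>One \<open>r\<close> is the length of the interval on which the approximations
      will be constant; the other absorbs the cell width. Both together stay within
      \<open>d\<close>.\<close>
    define r where "r = d / 4"
    have r: "r > 0" "\<bar>\<theta> - 2 * r - \<theta>\<bar> < d" using d(1) by (auto simp: r_def)
    have near: "\<bar>arrival H c (\<theta> - 2 * r) - arrival H c \<theta>\<bar> < g" by (rule d(2)[OF r(2)])
    have vanish: "(\<lambda>n. 1 / real (Suc (\<phi> n))) \<longlonglongrightarrow> 0"
      using LIMSEQ_subseq_LIMSEQ[OF LIMSEQ_inverse_real_of_nat \<phi>] by (simp add: o_def inverse_eq_divide)
    have vanishB: "(\<lambda>n. B / real (Suc (\<phi> n))) \<longlonglongrightarrow> 0"
      using tendsto_mult_left[OF vanish, of B] by simp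
    have "\<forall>\<^sub>F n in sequentially. \<bar>arrival (Hn (\<phi> n)) c (\<theta> - 2 * r) - arrival H c (\<theta> - 2 * r)\<bar> < g"
      "\<forall>\<^sub>F n in sequentially. \<bar>arrival (Hn (\<phi> n)) c' \<theta> - arrival H c' \<theta>\<bar> < g"
      "\<forall>\<^sub>F n in sequentially. 1 / real (Suc (\<phi> n)) < r"
      "\<forall>\<^sub>F n in sequentially. B / real (Suc (\<phi> n)) < g"
      using tendstoD[OF alim[of c "\<theta> - 2 * r"] g] tendstoD[OF alim[of c' \<theta>] g]
        order_tendstoD(2)[OF vanish r(1)] order_tendstoD(2)[OF vanishB g]
      by (simp_all add: dist_real_def)
    then have ev: "\<forall>\<^sub>F n in sequentially. Hn (\<phi> n) c (\<theta> - r) = Hn (\<phi> n) c \<theta>"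
    proof eventually_elim
      case (elim n)
      show ?case
      proof (rule quasi[OF c c'])
        show "\<theta> - r \<le> \<theta>" using r by simp
        show "\<forall>x\<in>{\<theta> - r - 1 / real (Suc (\<phi> n))..\<theta>}.
          arrival (Hn (\<phi> n)) c' x + B / real (Suc (\<phi> n)) \<le> arrival (Hn (\<phi> n)) c x"
        \<comment> \<open>By monotonicity, the gap on the whole window follows from two points only:
          \<open>c'\<close> at its right end and \<open>c\<close> at
          \<open>\<theta> - 2 * r\<close>, left of the window.\<close>
        proof
          fix x assume x: "x \<in> {\<theta> - r - 1 / real (Suc (\<phi> n))..\<theta>}"
          have "arrival (Hn (\<phi> n)) c' x \<le> arrival (Hn (\<phi> n)) c' \<theta>"
            using x by (intro arrival_mono[OF inf]) auto
          moreover have "arrival (Hn (\<phi> n)) c (\<theta> - 2 * r) \<le> arrival (Hn (\<phi> n)) c x"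
            using x elim(3) by (intro arrival_mono[OF inf]) auto
          ultimately show "arrival (Hn (\<phi> n)) c' x + B / real (Suc (\<phi> n)) \<le> arrival (Hn (\<phi> n)) c x"
            using elim near geq by linarith
        qed
      qed
    qed
    have "H c (\<theta> - r) = H c \<theta>"
      by (rule LIMSEQ_unique[OF _ lim[OF c]])
        (rule Lim_transform_eventually[OF lim[OF c] ev])
    then show False using incr[rule_format, of "\<theta> - r"] r by simp
  qed
  show ?thesis using infH sumH opt by blast
qed

end

section \<open>Earliest arrival times\<close>

text \<open>The witness is the first time in \<open>{a..b}\<close> at which \<open>H\<close> has
  reached the value \<open>H b\<close>.\<close>

lemma left_increase_point:
  fixes H :: "real \<Rightarrow> real"
  assumes H: "mono H" "continuous_on UNIV H" and lt: "H a < H b"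
  obtains \<theta> where "a < \<theta>" "\<theta> \<le> b" "\<forall>x<\<theta>. H x < H \<theta>"
proof -
  have ab: "a < b" using lt monoD[OF H(1), of b a] by (cases "a < b") auto
  define S where "S = {a..b} \<inter> {x. H x = H b}"
  have "closed {x. H x = H b}" by (rule closed_Collect_eq[OF H(2) continuous_on_const])
  then have "compact S"
    unfolding S_def by (intro compact_Int_closed) auto
  moreover have "b \<in> S" using ab by (simp add: S_def)
  then have "S \<noteq> {}" by blast
  ultimately obtain \<theta> where \<theta>: "\<theta> \<in> S" "\<forall>x\<in>S. \<theta> \<le> x" using compact_attains_inf by blast
  have "H \<theta> = H b" "a \<le> \<theta>" "\<theta> \<le> b" using \<theta>(1) by (auto simp: S_def)
  show ?thesis
  proof (rule that)
    show "a < \<theta>" using \<open>H \<theta> = H b\<close> \<open>a \<le> \<theta>\<close> lt by (cases "a = \<theta>") auto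
    show "\<theta> \<le> b" by fact
    have "H x < H \<theta>" if x: "x < \<theta>" for x
    proof (cases "a \<le> x")
      case True
      have "H x \<noteq> H b"
      proof
        assume "H x = H b"
        then have "x \<in> S" using True x \<open>\<theta> \<le> b\<close> by (simp add: S_def)
        then show False using \<theta>(2) x by auto
      qed
      then show ?thesis using monoD[OF H(1), of x \<theta>] x \<open>H \<theta> = H b\<close> by simp
    next
      case False
      then have "H x \<le> H a" using H(1) by (auto simp: mono_def)
      then show ?thesis using lt \<open>H \<theta> = H b\<close> by simp
    qed
    then show "\<forall>x<\<theta>. H x < H \<theta>" by blast
  qed
qed

lemma continuous_Min:
  fixes f :: "'i \<Rightarrow> real \<Rightarrow> real"
  assumes "finite I" "I \<noteq> {}" "\<And>i. i \<in> I \<Longrightarrow> continuous_on S (f i)"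
  shows "continuous_on S (\<lambda>x. Min ((\<lambda>i. f i x) ` I))"
  using assms
proof (induction I rule: finite_ne_induct)
  case (insert i I)
  have "continuous_on S (\<lambda>x. min (f i x) (Min ((\<lambda>i. f i x) ` I)))"
    by (rule continuous_on_min) (use insert in auto)
  then show ?case using insert.hyps by simp
qed simp

locale timed_digraph = fin_digraph G for G :: "('v, 'e) pre_digraph" +
  fixes T :: "'e \<Rightarrow> real \<Rightarrow> real"
  assumes T_mono: "\<And>e. e \<in> arcs G \<Longrightarrow> mono (T e)"
    and T_cont: "\<And>e. e \<in> arcs G \<Longrightarrow> continuous_on UNIV (T e)"
    and T_ge: "\<And>e x. e \<in> arcs G \<Longrightarrow> x \<le> T e x"
    and T_surj: "\<And>e y. e \<in> arcs G \<Longrightarrow> \<exists>x. T e x = y"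
begin

lemma walk_arcs: "awalk u p v \<Longrightarrow> set p \<subseteq> arcs G"
  by (simp add: awalk_def)

lemma walk_time_mono: "set p \<subseteq> arcs G \<Longrightarrow> x \<le> y \<Longrightarrow> fold T p x \<le> fold T p y"
  by (rule fold_mono) (use T_mono in auto)

lemma walk_time_ge: "set p \<subseteq> arcs G \<Longrightarrow> x \<le> fold T p x"
  by (rule fold_ge) (use T_ge in auto)

lemma walk_time_cont: "set p \<subseteq> arcs G \<Longrightarrow> continuous_on UNIV (fold T p)"
  by (rule continuous_fold) (use T_cont in auto)

lemma walk_time_surj: "set p \<subseteq> arcs G \<Longrightarrow> \<exists>x. fold T p x = y"
proof (induction p arbitrary: y)
  case (Cons e p)
  then obtain z where "fold T p z = y" by auto
  moreover obtain x where "T e x = z" using T_surj[of e z] Cons.prems by auto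
  ultimately show ?case by auto
qed simp

text \<open>Going round a cycle only loses time, since \<open>x \<le> T e x\<close>, and by
  monotonicity the loss is never turned into a gain on the rest of the walk.\<close>

lemma shorten_walk:
  assumes "awalk u p v"
  shows "\<exists>P. apath u P v \<and> (\<forall>\<theta>. fold T P \<theta> \<le> fold T p \<theta>)"
  using assms
proof (induction rule: awalk_to_apath_induct)
  case (path p)
  then show ?case by (auto simp: apath_def)
next
  case (decomp p q r s)
  have p: "p = q @ r @ s" by (rule awalk_cyc_decompE[OF decomp(2,1,3)])
  have sub: "set q \<subseteq> arcs G" "set r \<subseteq> arcs G" "set s \<subseteq> arcs G" using walk_arcs[OF decomp(1)] p by auto
  have "fold T (q @ s) \<theta> \<le> fold T p \<theta>" for \<theta>
    unfolding p using walk_time_mono[OF sub(3) walk_time_ge[OF sub(2), of "fold T q \<theta>"]] by simp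
  then show ?case using decomp(4) by (meson order_trans)
qed

text \<open>The real-valued counterpart of \<open>earliest_arrival\<close>. It is meaningful only if
  \<open>v\<close> can be reached from \<open>s\<close>; for this reason a path is supplied as a
  hypothesis in what follows.\<close>

definition earliest :: "'v \<Rightarrow> 'v \<Rightarrow> real \<Rightarrow> real" where
  "earliest s v \<theta> = Min ((\<lambda>P. fold T P \<theta>) ` {P. apath s P v})"

lemma earliest_le:
  assumes "awalk s p v" shows "earliest s v \<theta> \<le> fold T p \<theta>"
proof -
  obtain P where P: "apath s P v" "fold T P \<theta> \<le> fold T p \<theta>" using shorten_walk[OF assms] by blast
  have "earliest s v \<theta> \<le> fold T P \<theta>" unfolding earliest_def using apaths_finite P(1) by (intro Min_le) auto
  then show ?thesis using P(2) by simp
qed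

lemma earliest_attained:
  assumes "apath s p v" obtains P where "apath s P v" "earliest s v \<theta> = fold T P \<theta>"
proof -
  have "earliest s v \<theta> \<in> (\<lambda>P. fold T P \<theta>) ` {P. apath s P v}"
    unfolding earliest_def using apaths_finite assms by (intro Min_in) auto
  then show ?thesis using that by auto
qed

lemma earliest_mono:
  assumes p: "apath s p v" and "x \<le> y" shows "earliest s v x \<le> earliest s v y"
proof -
  obtain P where P: "apath s P v" "earliest s v y = fold T P y" by (rule earliest_attained[OF p])
  then have w: "awalk s P v" by (simp add: apath_def)
  show ?thesis using earliest_le[OF w, of x] walk_time_mono[OF walk_arcs[OF w] assms(2)] P(2) by simp
qed

lemma earliest_cont:
  assumes "apath s p v" shows "continuous_on UNIV (earliest s v)"
proof -
  have "continuous_on UNIV (\<lambda>\<theta>. Min ((\<lambda>P. fold T P \<theta>) ` {P. apath s P v}))"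
  proof (rule continuous_Min)
    show "continuous_on UNIV (fold T P)" if "P \<in> {P. apath s P v}" for P
      using that by (intro walk_time_cont walk_arcs) (auto simp: apath_def)
  qed (use apaths_finite assms in auto)
  then show ?thesis by (simp add: earliest_def[abs_def])
qed

lemma earliest_arc_le:
  assumes e: "e \<in> arcs G" and p: "apath s p (tail G e)"
  shows "earliest s (head G e) \<theta> \<le> T e (earliest s (tail G e) \<theta>)"
proof -
  obtain P where P: "apath s P (tail G e)" "earliest s (tail G e) \<theta> = fold T P \<theta>" by (rule earliest_attained[OF p])
  then have "awalk s (P @ [e]) (head G e)"
    using e by (intro awalk_appendI[OF _ arc_implies_awalk]) (auto simp: apath_def arc_def)
  from earliest_le[OF this, of \<theta>] show ?thesis using P(2) by simp
qed

lemma earliest_arrival_eq: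
  assumes "apath s p v" shows "earliest_arrival G T s v \<theta> = ereal (earliest s v \<theta>)"
  using assms by (auto simp: earliest_arrival_def earliest_def path_arrival_def)

lemma not_active_iff:
  assumes e: "e \<in> arcs G" and p: "apath s p (tail G e)"
  shows "\<theta> \<notin> active_times G T s e \<longleftrightarrow> earliest s (head G e) \<theta> < T e (earliest s (tail G e) \<theta>)"
proof -
  have "awalk s (p @ [e]) (head G e)"
    using e p by (intro awalk_appendI[OF _ arc_implies_awalk]) (auto simp: apath_def arc_def)
  then obtain q where q: "apath s q (head G e)" using shorten_walk by blast
  show ?thesis
    using earliest_arc_le[OF e p, of \<theta>]
    by (auto simp: active_times_def extend_infty_def earliest_arrival_eq[OF p] earliest_arrival_eq[OF q])
qed

lemma path_split:
  assumes P: "awalk s P t" and i: "i < length P"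
  shows "awalk s (take i P) (tail G (P ! i))" "awalk (tail G (P ! i)) (drop i P) t"
    "awalk s (take (Suc i) P) (head G (P ! i))" "awalk (head G (P ! i)) (drop (Suc i) P) t"
    "P ! i \<in> arcs G"
proof -
  have "awalk s (take i P @ drop i P) t" using P by simp
  then have 1: "awalk s (take i P) (awlast s (take i P))" "awalk (awlast s (take i P)) (drop i P) t"
    unfolding awalk_append_iff by auto
  have d: "drop i P = P ! i # drop (Suc i) P" using i by (rule Cons_nth_drop_Suc[symmetric])
  have 2: "awlast s (take i P) = tail G (P ! i)" "awalk (head G (P ! i)) (drop (Suc i) P) t" "P ! i \<in> arcs G"
    using 1(2) unfolding d by (auto simp: awalk_Cons_iff)
  show "awalk s (take i P) (tail G (P ! i))" "awalk (tail G (P ! i)) (drop i P) t"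
    using 1 2(1) by auto
  then have "awalk s (take i P @ [P ! i]) (head G (P ! i))"
    using 2(3) by (intro awalk_appendI[OF _ arc_implies_awalk]) (auto simp: arc_def)
  then show "awalk s (take (Suc i) P) (head G (P ! i))" using i by (simp add: take_Suc_conv_app_nth)
  show "awalk (head G (P ! i)) (drop (Suc i) P) t" "P ! i \<in> arcs G" using 2 by auto
qed

text \<open>A single path: \<open>H\<close> counts its departures and \<open>X i\<close> its inflow
  into the \<open>i\<close>-th link. Optimality is assumed at points of left increase only, as this
  is what the limit of the approximations provides.\<close>

context
  fixes s t :: 'v and P :: "'e list" and X :: "nat \<Rightarrow> real \<Rightarrow> real" and H :: "real \<Rightarrow> real"
  assumes P: "apath s P t"
    and H: "mono H" "continuous_on UNIV H" and X: "\<And>i. mono (X i)"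
    and transport: "\<And>i \<theta>. i \<le> length P \<Longrightarrow> X i (fold T (take i P) \<theta>) = H \<theta>"
    and optimal: "\<And>Q \<theta>. apath s Q t \<Longrightarrow> (\<forall>x<\<theta>. H x < H \<theta>) \<Longrightarrow> fold T P \<theta> \<le> fold T Q \<theta>"
begin

text \<open>Flow does not enter during an interval on which the exit time is constant, so along a used path
  later departures arrive strictly later.\<close>

lemma prefix_strict:
  assumes incr: "\<forall>x<\<theta>. H x < H \<theta>" and i: "i \<le> length P" and x: "x < \<theta>"
  shows "fold T (take i P) x < fold T (take i P) \<theta>"
proof (rule ccontr)
  have PP: "set (take i P) \<subseteq> arcs G" using walk_arcs[of s P t] P set_take_subset by (force simp: apath_def)
  assume "\<not> ?thesis"
  then have "fold T (take i P) x = fold T (take i P) \<theta>" using walk_time_mono[OF PP, of x \<theta>] x by simp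
  then have "H x = H \<theta>" using transport[OF i, of x] transport[OF i, of \<theta>] by simp
  then show False using incr x by auto
qed

text \<open>Optimality of the whole path alone does not suffice: time gained on the way to
  \<open>v\<close> could be lost in a later queue. Strict increase of the arrival times along the
  used path excludes this.\<close>

lemma prefix_shortest:
  assumes incr: "\<forall>x<\<theta>. H x < H \<theta>" and i: "i \<le> length P"
    and w: "awalk s (take i P) v" "awalk v (drop i P) t"
  shows "earliest s v \<theta> = fold T (take i P) \<theta>"
proof (rule antisym[OF earliest_le[OF w(1)]], rule ccontr)
  assume less: "\<not> fold T (take i P) \<theta> \<le> earliest s v \<theta>"
  obtain Q0 where "apath s Q0 v" using shorten_walk[OF w(1)] by blast
  then obtain Q where Q: "apath s Q v" "earliest s v \<theta> = fold T Q \<theta>" by (rule earliest_attained)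
  have "awalk s (Q @ drop i P) t" using Q(1) w(2) by (intro awalk_appendI) (auto simp: apath_def)
  then obtain R where R: "apath s R t" "\<forall>\<theta>. fold T R \<theta> \<le> fold T (Q @ drop i P) \<theta>" using shorten_walk by blast
  \<comment> \<open>If \<open>Q\<close> reached \<open>v\<close> earlier, the same arrival at
    \<open>v\<close> would be possible along the prefix with departure at some
    \<open>x < \<theta>\<close>. Following the rest of \<open>P\<close> from there is no better than
    \<open>P\<close> from \<open>\<theta>\<close>, against strictness.\<close>
  obtain x where x: "fold T (take i P) x = fold T Q \<theta>" using walk_time_surj[OF walk_arcs[OF w(1)]] by blast
  have "x < \<theta>"
    using walk_time_mono[OF walk_arcs[OF w(1)], of \<theta> x] less x Q(2) by (cases "x < \<theta>") auto
  have "fold T P x = fold T (take i P @ drop i P) x" by simp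
  also have "\<dots> = fold T (drop i P) (fold T (take i P) x)" unfolding fold_append by simp
  also have "\<dots> = fold T (Q @ drop i P) \<theta>" unfolding x by simp
  finally have "fold T P \<theta> \<le> fold T P x" using optimal[OF R(1) incr] R(2) by (metis order_trans)
  then show False using prefix_strict[OF incr order_refl \<open>x < \<theta>\<close>] by simp
qed

text \<open>Otherwise some departure \<open>\<theta>\<close> of left increase reaches the tail at a
  time that is also the earliest arrival for some \<open>\<theta>'\<close> in \<open>{a..b}\<close>,
  possibly different from \<open>\<theta>\<close>. Inactivity at \<open>\<theta>'\<close>, compared
  at the head, gives \<open>\<theta>' < \<theta>\<close>; then strictness along the prefix gives an
  earlier arrival at the tail for \<open>\<theta>'\<close>, a contradiction.\<close>

lemma no_inflow_inactive:
  assumes i: "i < length P" and ab: "a \<le> b"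
    and inactive: "\<And>\<theta>. \<theta> \<in> {a..b} \<Longrightarrow> earliest s (head G (P ! i)) \<theta> < T (P ! i) (earliest s (tail G (P ! i)) \<theta>)"
  shows "X i (earliest s (tail G (P ! i)) a) = X i (earliest s (tail G (P ! i)) b)"
proof (rule ccontr)
  assume neq: "\<not> ?thesis"
  let ?e = "P ! i"
  define v w where "v = tail G ?e" and "w = head G ?e"
  let ?L = "fold T (take i P)"
  have aP: "awalk s P t" using P by (simp add: apath_def)
  note sp = path_split[OF aP i, folded v_def w_def]
  obtain q where q: "apath s q v" using shorten_walk[OF sp(1)] by blast
  obtain q' where q': "apath s q' w" using shorten_walk[OF sp(3)] by blast
  note L_mono = walk_time_mono[OF walk_arcs[OF sp(1)]]
  obtain x where x: "?L x = earliest s v a" using walk_time_surj[OF walk_arcs[OF sp(1)]] by blast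
  obtain y where y: "?L y = earliest s v b" using walk_time_surj[OF walk_arcs[OF sp(1)]] by blast
  have "X i (earliest s v a) \<le> X i (earliest s v b)" using X[of i] earliest_mono[OF q ab] by (auto simp: mono_def)
  then have "H x < H y"
    using neq transport[of i x] transport[of i y] i x y by (simp add: v_def)
  then obtain \<theta> where \<theta>: "x < \<theta>" "\<theta> \<le> y" and incr: "\<forall>z<\<theta>. H z < H \<theta>"
    by (rule left_increase_point[OF H])
  have "earliest s v a \<le> ?L \<theta>" "?L \<theta> \<le> earliest s v b"
    using L_mono[of x \<theta>] L_mono[of \<theta> y] \<theta> x y by auto
  then obtain \<theta>' where \<theta>': "\<theta>' \<in> {a..b}" "earliest s v \<theta>' = ?L \<theta>"
    using IVT'[of "earliest s v" a "?L \<theta>" b, OF _ _ ab] continuous_on_subset[OF earliest_cont[OF q]] by auto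
  have opt_v: "earliest s v \<theta> = ?L \<theta>" by (rule prefix_shortest[OF incr _ sp(1,2)]) (use i in simp)
  have "earliest s w \<theta> = fold T (take (Suc i) P) \<theta>" by (rule prefix_shortest[OF incr _ sp(3,4)]) (use i in simp)
  also have "\<dots> = T ?e (?L \<theta>)" using i by (simp add: take_Suc_conv_app_nth)
  finally have "earliest s w \<theta>' < earliest s w \<theta>" using inactive[OF \<theta>'(1)] \<theta>'(2) by (simp add: v_def w_def)
  then have lt: "\<theta>' < \<theta>" using earliest_mono[OF q', of \<theta> \<theta>'] by (cases "\<theta>' < \<theta>") auto
  have "earliest s v \<theta>' \<le> ?L \<theta>'" by (rule earliest_le[OF sp(1)])
  also have "\<dots> < ?L \<theta>" by (rule prefix_strict[OF incr _ lt]) (use i in simp)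
  finally show False using \<theta>'(2) by simp
qed

end

end

text \<open>Every arrival at \<open>v\<close> by the \<open>i\<close>-th link is matched by the
  departure with index \<open>Suc i\<close>; as \<open>v\<close> is not the final node, only the
  initial departure can remain. The argument covers walks with repeated nodes.\<close>

lemma path_balance:
  fixes f :: "nat \<Rightarrow> real"
  assumes "pre_digraph.cas G s P t" "v \<noteq> t"
  shows "(\<Sum>i | i < length P \<and> tail G (P ! i) = v. f i) - (\<Sum>i | i < length P \<and> head G (P ! i) = v. f (Suc i))
    = (if v = s then f 0 else 0)"
proof -
  have "(\<Sum>i<length P. if tail G (P ! i) = v then f i else 0) - (\<Sum>i<length P. if head G (P ! i) = v then f (Suc i) else 0)
    = (if v = s then f 0 else 0)"
    using assms
  proof (induction P arbitrary: s f)
    case Nil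
    then show ?case by (simp add: pre_digraph.cas.simps)
  next
    case (Cons e P)
    from Cons.prems have "tail G e = s" "pre_digraph.cas G (head G e) P t" by (auto simp: pre_digraph.cas.simps)
    then show ?case using Cons.IH[of "head G e" "\<lambda>i. f (Suc i)"] Cons.prems(2)
      by (simp add: sum.lessThan_Suc_shift del: sum.lessThan_Suc) (auto split: if_splits)
  qed
  moreover have "(\<Sum>i | i < length P \<and> Q i. h i) = (\<Sum>i<length P. if Q i then h i else 0)" for Q and h :: "nat \<Rightarrow> real"
    by (rule sum.mono_neutral_cong_left) auto
  ultimately show ?thesis by simp
qed

section \<open>Flows with given path inflows\<close>

lemma density_of_absolutely_integrable:
  assumes "density_of f F" "mono F"
  shows "f absolutely_integrable_on {a..b}"
proof (cases "a \<le> b")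
  case True
  have "f integrable_on {a..b}" using density_of_has_integral[OF assms True] by blast
  then show ?thesis using density_of_nonneg[OF assms(1)] by (intro nonnegative_absolutely_integrable_1)
next
  case False
  then have "{a..b} = {}" by simp
  then show ?thesis by (simp add: set_integrable_def)
qed

lemma density_of_F0_space:
  assumes f: "density_of f F" and F: "cum_flow F"
  shows "f \<in> F0_space"
proof -
  have mF: "mono F" using F by (simp add: cum_flow_def)
  have "f absolutely_integrable_on K" if K: "compact K" for K
  proof -
    obtain a b where ab: "K \<subseteq> cbox a b" using bounded_subset_cbox_symmetric[OF compact_imp_bounded[OF K]] by metis
    then have "K \<subseteq> {a..b}" by simp
    moreover have "K \<in> sets lebesgue" using K by (simp add: borel_compact)
    ultimately show ?thesis using set_integrable_subset[OF density_of_absolutely_integrable[OF f mF]] by blast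
  qed
  moreover have "AE x in lborel. \<forall>n::nat. x \<in> {- real n..0} \<longrightarrow> f x = 0"
    unfolding AE_all_countable
    by (intro allI density_of_zero[OF f]) (simp add: cum_flow_zero[OF F])
  then have "AE x in lborel. x < 0 \<longrightarrow> f x = 0"
  proof eventually_elim
    case (elim x)
    obtain n :: nat where "- x \<le> real n" using real_arch_simple by blast
    then have "x < 0 \<Longrightarrow> x \<in> {- real n..0}" by auto
    then show ?case using elim by blast
  qed
  then have "AE x in lebesgue. x < 0 \<longrightarrow> f x = 0" by (rule AE_completion)
  ultimately show ?thesis using density_of_nonneg[OF f] by (simp add: F0_space_def locally_integrable_def)
qed

lemma density_of_set_integral:
  assumes f: "density_of f F" "mono F" and ab: "a \<le> b"
  shows "(LINT x:{a<..<b}|lebesgue. f x) = F b - F a"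
proof -
  have ai: "f absolutely_integrable_on {a<..<b}"
    by (rule set_integrable_subset[OF density_of_absolutely_integrable[OF f, of a b]]) auto
  have "(LINT x:{a<..<b}|lebesgue. f x) = integral {a<..<b} f"
    by (rule set_lebesgue_integral_eq_integral(2)[OF ai])
  also have "\<dots> = integral {a..b} f" by (simp add: integral_open_interval_real)
  also have "\<dots> = F b - F a" by (rule integral_unique[OF density_of_has_integral[OF f ab]])
  finally show ?thesis .
qed

lemma cumulative_density_of:
  assumes f: "density_of f F" "mono F" shows "cumulative f \<theta> = F \<theta> - F 0"
proof (cases "0 \<le> \<theta>")
  case True
  then have "einterval 0 (ereal \<theta>) = {0<..<\<theta>}" by (auto simp: einterval_def)
  then show ?thesis
    using True density_of_set_integral[OF f True] by (simp add: cumulative_def interval_lebesgue_integral_def)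
next
  case False
  then have "einterval (ereal \<theta>) 0 = {\<theta><..<0}" by (auto simp: einterval_def)
  then show ?thesis
    using False density_of_set_integral[OF f, of \<theta> 0] by (simp add: cumulative_def interval_lebesgue_integral_def)
qed

lemma inflow_density:
  assumes T: "0 < T" and p: "1 < p" and u: "u \<in> Lp_space (lebesgue_on {0<..<T}) p"
    and nn: "AE \<theta> in lebesgue_on {0<..<T}. 0 \<le> u \<theta>"
  shows "\<exists>g U. density_of g U \<and> cum_flow U \<and> (\<forall>\<theta>\<ge>T. U \<theta> = U T) \<and>
    (AE \<theta> in lebesgue. g \<theta> = (if \<theta> \<in> {0..T} then u \<theta> else 0))"
proof -
  define S where "S = {0<..<T}"
  let ?M = "lebesgue_on S"
  have Sm: "S \<in> sets lebesgue" "S \<in> lmeasurable" by (simp_all add: S_def)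
  interpret finite_measure ?M by (rule finite_measure_lebesgue_on[OF Sm(2)])
  have "integrable ?M u"
  proof (rule Bochner_Integration.integrable_bound)
    show "integrable ?M (\<lambda>x. 1 + \<bar>u x\<bar> powr p)" using u
      by (intro Bochner_Integration.integrable_add integrable_const) (simp add: Lp_space_def S_def)
    show "u \<in> borel_measurable ?M" using u by (simp add: Lp_space_def S_def)
    \<comment> \<open>The inclusion of \<open>L^p\<close> in \<open>L^1\<close> on a set of finite
      measure.\<close>
    have "\<bar>u x\<bar> \<le> 1 + \<bar>u x\<bar> powr p" for x
    proof (cases "\<bar>u x\<bar> \<le> 1")
      case False
      then have "\<bar>u x\<bar> powr 1 \<le> \<bar>u x\<bar> powr p" using p by (intro powr_mono) auto
      then show ?thesis using False by simp
    qed (simp add: add_increasing2)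
    then show "AE x in ?M. norm (u x) \<le> norm (1 + \<bar>u x\<bar> powr p)" by (auto intro!: AE_I2 order_trans[OF _ abs_ge_self])
  qed
  then have vi: "integrable lebesgue (\<lambda>x. indicator S x *\<^sub>R u x)"
    using Sm(1) by (subst (asm) integrable_restrict_space) auto
  then have "(\<lambda>x. indicator S x *\<^sub>R u x) \<in> borel_measurable lebesgue" by simp
  then obtain g0 where g0[measurable]: "g0 \<in> borel_measurable lborel"
    and g0_eq: "AE x in lborel. indicator S x *\<^sub>R u x = g0 x"
    using completion_ex_borel_measurable_real by blast
  have nn': "AE x in lborel. x \<in> S \<longrightarrow> 0 \<le> u x"
    using nn Sm(1) unfolding S_def[symmetric] by (subst (asm) AE_restrict_space_iff) (auto simp: AE_completion_iff)
  \<comment> \<open>A Borel representative that is nonnegative everywhere, as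
    \<open>density_of\<close> demands; it differs from \<open>u\<close> on a null set of
    \<open>S\<close> only.\<close>
  define g where "g = (\<lambda>x. if x \<in> S then max 0 (g0 x) else 0)"
  have [measurable]: "S \<in> sets borel" by (simp add: S_def)
  have gm[measurable]: "g \<in> borel_measurable borel" using g0 unfolding g_def by measurable
  have g_nn: "0 \<le> g x" for x by (simp add: g_def)
  have g_eq: "AE x in lborel. g x = indicator S x *\<^sub>R u x"
    using g0_eq nn' by eventually_elim (auto simp: g_def indicator_def)
  have "integrable lebesgue g"
  proof (rule integrable_cong_AE_imp[OF vi])
    show "g \<in> borel_measurable lebesgue" using gm by (simp add: measurable_completion)
    show "AE x in lebesgue. indicator S x *\<^sub>R u x = g x"
      using AE_completion[OF g_eq] by eventually_elim simp
  qed
  then have gi: "integrable lborel g" by (simp add: integrable_completion)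
  have gI: "g integrable_on {a..b}" for a b :: real
    using integrable_on_subcbox[OF integrable_on_lborel[OF gi], of a b] by simp
  define V where "V = (\<lambda>x. integral {0..x} g)"
  \<comment> \<open>Clamping the time to \<open>{0..T}\<close> makes \<open>U\<close> vanish before
    0 and stay constant after \<open>T\<close>.\<close>
  define cl where "cl = (\<lambda>x::real. max 0 (min x T))"
  define U where "U = (\<lambda>x. V (cl x))"
  have cl: "cl x \<in> {0..T}" "x \<le> y \<Longrightarrow> cl x \<le> cl y" for x y using T by (auto simp: cl_def)
  have Vdiff: "(g has_integral (V y - V x)) {x..y}" if "0 \<le> x" "x \<le> y" for x y
  proof -
    have "integral {0..x} g + integral {x..y} g = integral {0..y} g"
      using that by (intro Henstock_Kurzweil_Integration.integral_combine gI)
    then show ?thesis using gI[of x y] by (simp add: V_def has_integral_iff algebra_simps)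
  qed
  have Umono: "U x \<le> U y" if "x \<le> y" for x y
    using has_integral_nonneg[OF Vdiff[of "cl x" "cl y"]] cl that g_nn by (auto simp: U_def)
  have cont: "continuous_on UNIV U"
  proof -
    have "continuous_on {0..T} V" unfolding V_def by (rule indefinite_integral_continuous_1[OF gI])
    moreover have "continuous_on UNIV cl" unfolding cl_def by (intro continuous_intros)
    ultimately show ?thesis unfolding U_def by (rule continuous_on_compose2) (use cl in blast)
  qed
  have "cum_flow U"
    by (rule cum_flowI[OF Umono cont]) (use T in \<open>auto simp: U_def V_def cl_def\<close>)
  moreover have "\<forall>\<theta>\<ge>T. U \<theta> = U T" by (auto simp: U_def cl_def)
  moreover have "density_of g U"
    unfolding density_of_def
  proof (intro conjI allI impI gm g_nn)
    fix a b :: real assume ab: "a \<le> b"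
    have "(\<integral>\<^sup>+x. ennreal (g x) * indicator {a..b} x \<partial>lborel) =
        (\<integral>\<^sup>+x. ennreal (indicator {cl a..cl b} x * g x) \<partial>lborel)"
    proof (rule nn_integral_cong)
      fix x
      have "x \<in> {a..b} \<longleftrightarrow> x \<in> {cl a..cl b}" if "x \<in> S" using that by (auto simp: S_def cl_def)
      then show "ennreal (g x) * indicator {a..b} x = ennreal (indicator {cl a..cl b} x * g x)"
        by (cases "x \<in> S") (auto simp: g_def indicator_def)
    qed
    also have "\<dots> = ennreal (U b - U a)"
      unfolding U_def using cl[of a] cl(2)[OF ab] g_nn by (intro nn_integral_has_integral_lebesgue Vdiff) auto
    finally show "(\<integral>\<^sup>+x. ennreal (g x) * indicator {a..b} x \<partial>lborel) = ennreal (U b - U a)" .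
  qed
  moreover have "AE \<theta> in lborel. g \<theta> = (if \<theta> \<in> {0..T} then u \<theta> else 0)"
    using g_eq AE_lborel_singleton[of 0] AE_lborel_singleton[of T]
    by eventually_elim (auto simp: S_def indicator_def)
  then have "AE \<theta> in lebesgue. g \<theta> = (if \<theta> \<in> {0..T} then u \<theta> else 0)" by (rule AE_completion)
  ultimately show ?thesis by blast
qed

theorem theorem21:
  fixes G :: "('v, 'e) pre_digraph"
    and \<nu> \<tau> :: "'e \<Rightarrow> real"
    and T p :: real
    and u :: "'v \<times> 'v \<Rightarrow> real \<Rightarrow> real"
  assumes "digraph G"
    and "\<And>e. e \<in> arcs G \<Longrightarrow> \<nu> e > 0"
    and "\<And>e. e \<in> arcs G \<Longrightarrow> \<tau> e > 0"
    and "0 < T" and "1 < p"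
    and "\<And>st. st \<in> od_pairs G \<Longrightarrow> u st \<in> Lp_space (lebesgue_on {0<..<T}) p"
    and "\<And>st. st \<in> od_pairs G \<Longrightarrow> AE \<theta> in lebesgue_on {0<..<T}. 0 \<le> u st \<theta>"
    and "\<And>s t. \<lbrakk>(s, t) \<in> od_pairs G; \<not> (AE \<theta> in lebesgue_on {0<..<T}. u (s, t) \<theta> = 0)\<rbrakk>
           \<Longrightarrow> \<exists>P. pre_digraph.apath G s P t"
  shows "\<exists>fp fm. dynamic_equilibrium G \<nu> \<tau>
           (\<lambda>st \<theta>. if \<theta> \<in> {0..T} then u st \<theta> else 0) fp fm"
proof -
  interpret digraph G by (rule assms(1))
  define v where "v = (\<lambda>st \<theta>. if \<theta> \<in> {0..T} then u st \<theta> else 0)"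
  have fin_od: "finite (od_pairs G)"
    by (rule finite_subset[of _ "verts G \<times> verts G"]) (auto simp: od_pairs_def)
  have "\<forall>st\<in>od_pairs G. \<exists>g U. density_of g U \<and> cum_flow U \<and> (\<forall>\<theta>\<ge>T. U \<theta> = U T) \<and> (AE \<theta> in lebesgue. g \<theta> = v st \<theta>)"
    unfolding v_def by (intro ballI inflow_density[OF assms(4,5)] assms(6,7))
  then obtain g U where gU: "\<forall>st\<in>od_pairs G. density_of (g st) (U st) \<and> cum_flow (U st) \<and>
      (\<forall>\<theta>\<ge>T. U st \<theta> = U st T) \<and> (AE \<theta> in lebesgue. g st \<theta> = v st \<theta>)"
    unfolding bchoice_iff by blast
  define C where "C = {(st, P). st \<in> od_pairs G \<and> apath (fst st) P (snd st)}"
  \<comment> \<open>The loading locale asks for positive rates and delays at every element of the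
    type, hence the value 1 outside the arcs.\<close>
  define \<nu>' where "\<nu>' = (\<lambda>e. if e \<in> arcs G then \<nu> e else 1)"
  define \<tau>' where "\<tau>' = (\<lambda>e. if e \<in> arcs G then \<tau> e else 1)"
  \<comment> \<open>The inserted 1 covers the default delays and keeps the minimum defined when
    there are no arcs.\<close>
  define \<delta> where "\<delta> = Min (insert 1 (\<tau> ` arcs G))"
  have \<delta>: "0 < \<delta>" "\<delta> \<le> \<tau>' e" for e
    using assms(3) by (auto simp: \<delta>_def \<tau>'_def intro!: Min_le)
  have fin_C: "finite C"
  proof -
    have "C = Sigma (od_pairs G) (\<lambda>st. {P. apath (fst st) P (snd st)})" by (auto simp: C_def)
    then show ?thesis using fin_od apaths_finite by (simp add: finite_SigmaI)
  qed
  interpret pc: path_choice C snd \<nu>' \<tau>' \<delta> fst U T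
  proof
    show "0 < \<nu>' e" for e using assms(2) by (simp add: \<nu>'_def)
    show "cum_flow (U (fst c))" if "c \<in> C" for c 
    proof -
      have "fst c \<in> od_pairs G" using that by (auto simp: C_def)
      then show ?thesis using gU by blast
    qed
    show "U (fst c) \<theta> = U (fst c) T" if "c \<in> C" "T \<le> \<theta>" for c \<theta>
    proof -
      have "fst c \<in> od_pairs G" using that by (auto simp: C_def)
      then show ?thesis using gU that(2) by blast
    qed
  qed (rule fin_C, rule \<delta>, rule \<delta>)
  obtain H where H: "pc.inflows H" and H_sum: "\<forall>c\<in>C. \<forall>\<theta>. (\<Sum>c'\<in>pc.peers c. H c' \<theta>) = U (fst c) \<theta>"
    and H_opt: "\<forall>c\<in>C. \<forall>c'\<in>pc.peers c. \<forall>\<theta>. (\<forall>\<theta>'<\<theta>. H c \<theta>' < H c \<theta>) \<longrightarrow> pc.arrival H c \<theta> \<le> pc.arrival H c' \<theta>"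
    using pc.equilibrium_exists by blast
  define X where "X = pc.load H"
  have X: "pc.flows X" unfolding X_def by (rule pc.flows_load[OF H])
  have cfX: "cum_flow (X c i)" if "c \<in> C" for c i by (rule pc.flowsD[OF X that])
  have mX: "mono (X c i)" if "c \<in> C" for c i using cfX[OF that] by (simp add: cum_flow_def)
  have "\<exists>f. density_of f (X c i)" if c: "c \<in> C" and i: "i \<le> length (snd c)" for c i
    unfolding X_def
  proof (rule pc.load_density[OF H c i])
    have st: "fst c \<in> od_pairs G" using c by (auto simp: C_def)
    show "density_of (g (fst c)) (U (fst c))" "cum_flow (U (fst c))" using gU st by blast+
    show "H c y - H c x \<le> U (fst c) y - U (fst c) x" if "x \<le> y" for x y
      by (rule pc.shares_dominated[OF H _ c that]) (use H_sum c in blast)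
  qed
  then have "\<forall>c i. \<exists>f. c \<in> C \<longrightarrow> i \<le> length (snd c) \<longrightarrow> density_of f (X c i)" by blast
  then obtain f where f: "c \<in> C \<Longrightarrow> i \<le> length (snd c) \<Longrightarrow> density_of (f c i) (X c i)" for c i
    unfolding choice_iff by blast
  define I where "I = (\<lambda>(c :: ('v \<times> 'v) \<times> 'e list) e. {i. i < length (snd c) \<and> snd c ! i = e})"
  have fin_I: "finite (I c e)" for c e unfolding I_def by simp
  define Cof where "Cof = (\<lambda>st. {c \<in> C. fst c = st})"
  have fin_Cof: "finite (Cof st)" for st using fin_C by (simp add: Cof_def)
  define fp where "fp = (\<lambda>e st \<theta>. \<Sum>c\<in>Cof st. \<Sum>i\<in>I c e. f c i \<theta>)"
  define fm where "fm = (\<lambda>e st \<theta>. \<Sum>c\<in>Cof st. \<Sum>i\<in>I c e. f c (Suc i) \<theta>)"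
  have regroup: "(\<Sum>st\<in>od_pairs G. \<Sum>c\<in>Cof st. h c) = (\<Sum>c\<in>C. h c)" for h :: "_ \<Rightarrow> real"
    unfolding Cof_def by (rule sum.group[OF fin_C fin_od]) (auto simp: C_def)
  have agg_fp: "aggregate G fp e = (\<lambda>\<theta>. \<Sum>c\<in>C. \<Sum>i\<in>I c e. f c i \<theta>)" for e
    by (simp add: aggregate_def fp_def regroup fun_eq_iff)
  have agg_fm: "aggregate G fm e = (\<lambda>\<theta>. \<Sum>c\<in>C. \<Sum>i\<in>I c e. f c (Suc i) \<theta>)" for e
    by (simp add: aggregate_def fm_def regroup fun_eq_iff)
  have cfI: "cum_flow (\<lambda>\<theta>. \<Sum>i\<in>J. X c (r i) \<theta>)" if "c \<in> C" for c and J :: "nat set" and r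
    by (rule cum_flow_sum) (rule cfX[OF that])
  \<comment> \<open>The index map \<open>r\<close> is the identity for inflows and
    \<open>Suc\<close> for outflows, so both cases are treated at once.\<close>
  have densI: "density_of (\<lambda>\<theta>. \<Sum>i\<in>I c e. f c (r i) \<theta>) (\<lambda>\<theta>. \<Sum>i\<in>I c e. X c (r i) \<theta>)"
    if "c \<in> C" "\<And>i. i < length (snd c) \<Longrightarrow> r i \<le> length (snd c)" for c e r
    by (rule density_of_sum[OF fin_I]) (use that f mX in \<open>auto simp: I_def\<close>)
  have densC: "density_of (\<lambda>\<theta>. \<Sum>c\<in>D. \<Sum>i\<in>I c e. f c (r i) \<theta>) (\<lambda>\<theta>. \<Sum>c\<in>D. \<Sum>i\<in>I c e. X c (r i) \<theta>)"
    if D: "D \<subseteq> C" and r: "\<And>n i. i < n \<Longrightarrow> r i \<le> n" for D e r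
  proof (rule density_of_sum)
    show "finite D" using D fin_C by (rule finite_subset)
    show "density_of (\<lambda>\<theta>. \<Sum>i\<in>I c e. f c (r i) \<theta>) (\<lambda>\<theta>. \<Sum>i\<in>I c e. X c (r i) \<theta>)" if "c \<in> D" for c
      by (rule densI) (use D r that in auto)
    show "mono (\<lambda>\<theta>. \<Sum>i\<in>I c e. X c (r i) \<theta>)" if "c \<in> D" for c
      using cfI[where c = c and J = "I c e" and r = r] D that by (auto simp: cum_flow_def)
  qed
  have cfC: "cum_flow (\<lambda>\<theta>. \<Sum>c\<in>D. \<Sum>i\<in>I c e. X c (r i) \<theta>)" if "D \<subseteq> C" for D e r
    by (rule cum_flow_sum) (rule cfI, use that in blast)
  have density_of_fp: "density_of (aggregate G fp e) (pc.link_inflow X e)" for e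
    using densC[OF order_refl, where r = "\<lambda>i. i" and e = e] by (simp add: agg_fp pc.link_inflow_def[abs_def] I_def)
  have density_of_fm: "density_of (aggregate G fm e) (pc.link_outflow X e)" for e
    using densC[OF order_refl, where r = Suc and e = e] by (simp add: agg_fm pc.link_outflow_def[abs_def] I_def)
  have cf_agg: "cum_flow (pc.link_inflow X e)" "cum_flow (pc.link_outflow X e)" for e
    by (rule pc.cum_flow_agg[OF X]) (rule pc.cum_flow_out[OF X])
  have out: "pc.link_outflow X e (\<theta> + \<tau> e) = \<nu> e * \<theta> - slack (\<nu> e) (pc.link_inflow X e) \<theta>" if "e \<in> arcs G" for e \<theta>
    using pc.out_load[OF H, of e \<theta>] that by (simp add: X_def \<nu>'_def \<tau>'_def)
  have queue: "queue G \<tau> fp fm e \<theta> = pc.link_inflow X e \<theta> + slack (\<nu> e) (pc.link_inflow X e) \<theta> - \<nu> e * \<theta>"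
    if e: "e \<in> arcs G" for e \<theta>
  proof -
    have "cumulative (aggregate G fp e) \<theta> = pc.link_inflow X e \<theta>"
      using cumulative_density_of[OF density_of_fp, of e \<theta>] cf_agg(1)[of e] cum_flow_zero[OF cf_agg(1)[of e], of 0]
      by (simp add: cum_flow_def)
    moreover have "cumulative (aggregate G fm e) (\<theta> + \<tau> e) = pc.link_outflow X e (\<theta> + \<tau> e)"
      using cumulative_density_of[OF density_of_fm, of e] cf_agg(2)[of e] cum_flow_zero[OF cf_agg(2)[of e], of 0]
      by (simp add: cum_flow_def)
    ultimately show ?thesis using out[OF e] by (simp add: queue_def)
  qed
  define L where "L = exit_time G \<nu> \<tau> fp fm"
  have L: "L e = pc.link_exit X e" if e: "e \<in> arcs G" for e
  proof
    fix \<theta>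
    have par: "\<nu>' e = \<nu> e" "\<tau>' e = \<tau> e" using e by (simp_all add: \<nu>'_def \<tau>'_def)
    show "L e \<theta> = pc.link_exit X e \<theta>"
      using assms(2)[OF e]
      by (simp add: L_def exit_time_def queue[OF e] pc.link_exit_def queue_exit_def par field_simps)
  qed
  interpret td: timed_digraph G L
  proof
    fix e assume e: "e \<in> arcs G"
    show "mono (L e)" "continuous_on UNIV (L e)" unfolding L[OF e]
      by (rule pc.link_exit_mono[OF X], rule pc.link_exit_cont[OF X])
    show "x \<le> L e x" for x unfolding L[OF e] using pc.link_exit_gt[OF X, of x e] by simp
    show "\<exists>x. L e x = y" for y unfolding L[OF e] by (rule pc.link_exit_surj[OF X])
  qed

  \<comment> \<open>Capacity, rates and function spaces\<close>
  have capacity: "AE \<theta> in lborel. aggregate G fm e (\<theta> + \<tau> e) \<le> \<nu> e \<and> aggregate G fm e (\<theta> + \<tau> e) =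
      (if queue G \<tau> fp fm e \<theta> > 0 then \<nu> e else min (aggregate G fp e \<theta>) (\<nu> e))" if e: "e \<in> arcs G" for e
  proof -
    have "density_of (\<lambda>\<theta>. aggregate G fm e (\<theta> + \<tau> e)) (\<lambda>\<theta>. \<nu> e * \<theta> - slack (\<nu> e) (pc.link_inflow X e) \<theta>)"
      using density_of_shift[OF density_of_fm, of e "\<tau> e"] by (simp add: out[OF e])
    from link_capacity[OF assms(2)[OF e] cf_agg(1) density_of_fp this] show ?thesis
      by (simp add: queue[OF e])
  qed

  have oper: "operates_at_capacity G \<nu> \<tau> fp fm"
    unfolding operates_at_capacity_def
  proof
    fix e assume "e \<in> arcs G"
    from AE_completion[OF capacity[OF this]]
    show "AE \<theta> in lebesgue. aggregate G fm e (\<theta> + \<tau> e) =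
      (if queue G \<tau> fp fm e \<theta> > 0 then \<nu> e else min (aggregate G fp e \<theta>) (\<nu> e))"
      by eventually_elim simp
  qed

  have rate: "AE \<theta> in lebesgue. aggregate G fm e \<theta> \<le> \<nu> e \<and> 0 \<le> queue G \<tau> fp fm e \<theta>" if e: "e \<in> arcs G" for e
  proof -
    have "AE \<theta> in lborel. aggregate G fm e \<theta> \<le> \<nu> e"
    proof (rule density_of_le_AE[OF density_of_fm _ _ density_of_linear])
      show "mono (pc.link_outflow X e)" "continuous_on UNIV (pc.link_outflow X e)" using cf_agg(2) by (simp_all add: cum_flow_def)
      show "0 \<le> \<nu> e" "mono (\<lambda>x. \<nu> e * x)" "continuous_on UNIV (\<lambda>x. \<nu> e * x)"
        using assms(2)[OF e] by (auto simp: mono_def intro!: continuous_intros)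
      show "pc.link_outflow X e b - pc.link_outflow X e a \<le> \<nu> e * b - \<nu> e * a" if "a \<le> b" for a b
        using out[OF e, of "a - \<tau> e"] out[OF e, of "b - \<tau> e"]
          slack_mono[OF assms(2)[OF e] cf_agg(1), of "a - \<tau> e" "b - \<tau> e" e] that by (simp add: algebra_simps)
    qed
    moreover have "0 \<le> queue G \<tau> fp fm e \<theta>" for \<theta>
      using slack_upper[OF assms(2)[OF e] cf_agg(1), of \<theta> \<theta> e] by (simp add: queue[OF e])
    ultimately show ?thesis by (intro AE_completion) simp
  qed

  have F0: "fp e st \<in> F0_space" "fm e st \<in> F0_space" for e st
  proof -
    have D: "Cof st \<subseteq> C" by (auto simp: Cof_def)
    have "density_of (fp e st) (\<lambda>\<theta>. \<Sum>c\<in>Cof st. \<Sum>i\<in>I c e. X c i \<theta>)"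
      using densC[OF D, where r = "\<lambda>i. i" and e = e] by (simp add: fp_def)
    then show "fp e st \<in> F0_space" by (rule density_of_F0_space) (rule cfC[OF D])
    have "density_of (fm e st) (\<lambda>\<theta>. \<Sum>c\<in>Cof st. \<Sum>i\<in>I c e. X c (Suc i) \<theta>)"
      using densC[OF D, where r = Suc and e = e] by (simp add: fm_def)
    then show "fm e st \<in> F0_space" by (rule density_of_F0_space) (rule cfC[OF D])
  qed

  \<comment> \<open>Flow conservation at the nodes\<close>
  have conserve: "AE \<theta> in lebesgue. (\<Sum>e\<in>out_arcs G x. fp e (s, t) \<theta>) - (\<Sum>e\<in>in_arcs G x. fm e (s, t) \<theta>)
      = (if x = s then v (s, t) \<theta> else 0)"
    if st: "(s, t) \<in> od_pairs G" and x: "x \<in> verts G - {t}" for s t x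
  proof -
    have arcsC: "set (snd c) \<subseteq> arcs G" "cas s (snd c) t" if "c \<in> Cof (s, t)" for c
      using that by (auto simp: Cof_def C_def apath_def awalk_def)
    have out_sum: "(\<Sum>e\<in>out_arcs G x. \<Sum>i\<in>I c e. h i) = (\<Sum>i | i < length (snd c) \<and> tail G (snd c ! i) = x. h i)"
      and in_sum: "(\<Sum>e\<in>in_arcs G x. \<Sum>i\<in>I c e. h i) = (\<Sum>i | i < length (snd c) \<and> head G (snd c ! i) = x. h i)"
      if "c \<in> Cof (s, t)" for c and h :: "nat \<Rightarrow> real"
    proof -
      have arc: "snd c ! i \<in> arcs G" if "i < length (snd c)" for i using arcsC(1)[OF \<open>c \<in> _\<close>] that by auto
      have *: "(\<Sum>e\<in>A. \<Sum>i\<in>I c e. h i) = (\<Sum>i | i < length (snd c) \<and> snd c ! i \<in> A. h i)" if "finite A" for A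
      proof -
        have "(\<Sum>e\<in>A. \<Sum>i\<in>I c e. h i) = (\<Sum>e\<in>A. \<Sum>i | i \<in> {i. i < length (snd c) \<and> snd c ! i \<in> A} \<and> snd c ! i = e. h i)"
          by (intro sum.cong refl) (auto simp: I_def)
        also have "\<dots> = (\<Sum>i | i < length (snd c) \<and> snd c ! i \<in> A. h i)"
          by (rule sum.group) (use that in auto)
        finally show ?thesis .
      qed
      show "(\<Sum>e\<in>out_arcs G x. \<Sum>i\<in>I c e. h i) = (\<Sum>i | i < length (snd c) \<and> tail G (snd c ! i) = x. h i)"
        by (subst *) (use arc in \<open>auto simp: out_arcs_def intro!: sum.cong\<close>)
      show "(\<Sum>e\<in>in_arcs G x. \<Sum>i\<in>I c e. h i) = (\<Sum>i | i < length (snd c) \<and> head G (snd c ! i) = x. h i)"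
        by (subst *) (use arc in \<open>auto simp: in_arcs_def intro!: sum.cong\<close>)
    qed
    have bal: "(\<Sum>e\<in>out_arcs G x. fp e (s, t) \<theta>) - (\<Sum>e\<in>in_arcs G x. fm e (s, t) \<theta>)
      = (\<Sum>c\<in>Cof (s, t). if x = s then f c 0 \<theta> else 0)" for \<theta>
    proof -
      have "(\<Sum>e\<in>out_arcs G x. fp e (s, t) \<theta>) - (\<Sum>e\<in>in_arcs G x. fm e (s, t) \<theta>) =
        (\<Sum>c\<in>Cof (s, t). (\<Sum>e\<in>out_arcs G x. \<Sum>i\<in>I c e. f c i \<theta>) - (\<Sum>e\<in>in_arcs G x. \<Sum>i\<in>I c e. f c (Suc i) \<theta>))"
        unfolding fp_def fm_def sum_subtractf by (simp only: sum.swap[of _ "Cof (s, t)"])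
      also have "\<dots> = (\<Sum>c\<in>Cof (s, t). if x = s then f c 0 \<theta> else 0)"
      proof (rule sum.cong[OF refl])
        fix c assume c: "c \<in> Cof (s, t)"
        show "(\<Sum>e\<in>out_arcs G x. \<Sum>i\<in>I c e. f c i \<theta>) - (\<Sum>e\<in>in_arcs G x. \<Sum>i\<in>I c e. f c (Suc i) \<theta>)
          = (if x = s then f c 0 \<theta> else 0)"
          unfolding out_sum[OF c] in_sum[OF c] using path_balance[OF arcsC(2)[OF c], of x "\<lambda>i. f c i \<theta>"] x by auto
      qed
      finally show ?thesis .
    qed
    have "AE \<theta> in lebesgue. (\<Sum>c\<in>Cof (s, t). f c 0 \<theta>) = v (s, t) \<theta>"
    \<comment> \<open>A pair without any path receives no flow; here the reachability hypothesis of
      the theorem forces its network inflow to vanish almost everywhere.\<close>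
    proof (cases "Cof (s, t) = {}")
      case True
      then have "\<not> (\<exists>P. apath s P t)" using st by (auto simp: Cof_def C_def)
      then have "AE \<theta> in lebesgue_on {0<..<T}. u (s, t) \<theta> = 0" using assms(8)[OF st] by blast
      then have "AE \<theta> in lborel. \<theta> \<in> {0<..<T} \<longrightarrow> u (s, t) \<theta> = 0"
        by (subst (asm) AE_restrict_space_iff) (auto simp: AE_completion_iff)
      then have "AE \<theta> in lborel. v (s, t) \<theta> = 0"
        using AE_lborel_singleton[of 0] AE_lborel_singleton[of T]
        by eventually_elim (auto simp: v_def)
      from AE_completion[OF this] show ?thesis using True by simp
    next
      case False
      then obtain c where c: "c \<in> C" "fst c = (s, t)" by (auto simp: Cof_def)
      have peers: "pc.peers c = Cof (s, t)" using c by (auto simp: pc.peers_def Cof_def)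
      have CofC: "Cof (s, t) \<subseteq> C" by (auto simp: Cof_def)
      have "density_of (\<lambda>\<theta>. \<Sum>c\<in>Cof (s, t). f c 0 \<theta>) (\<lambda>\<theta>. \<Sum>c\<in>Cof (s, t). X c 0 \<theta>)"
        by (rule density_of_sum[OF fin_Cof]) (use f mX CofC in auto)
      also have "(\<lambda>\<theta>. \<Sum>c\<in>Cof (s, t). X c 0 \<theta>) = U (s, t)"
      proof
        fix \<theta>
        have "(\<Sum>c\<in>Cof (s, t). X c 0 \<theta>) = (\<Sum>c\<in>Cof (s, t). H c \<theta>)"
          by (intro sum.cong refl) (use CofC pc.load_0[OF H] in \<open>auto simp: X_def\<close>)
        then show "(\<Sum>c\<in>Cof (s, t). X c 0 \<theta>) = U (s, t) \<theta>" using bspec[OF H_sum c(1)] c(2) peers by simp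
      qed
      finally have "AE \<theta> in lborel. (\<Sum>c\<in>Cof (s, t). f c 0 \<theta>) = g (s, t) \<theta>"
        by (rule density_of_unique) (use gU st in blast)
      then have "AE \<theta> in lebesgue. (\<Sum>c\<in>Cof (s, t). f c 0 \<theta>) = g (s, t) \<theta>" by (rule AE_completion)
      moreover have "AE \<theta> in lebesgue. g (s, t) \<theta> = v (s, t) \<theta>" using gU st by blast
      ultimately show ?thesis by eventually_elim simp
    qed
    then show ?thesis by eventually_elim (simp add: bal)
  qed

  \<comment> \<open>The equilibrium condition on the links\<close>
  have equi: "AE \<xi> in lebesgue.
      ereal \<xi> \<in> earliest_arrival G L s (tail G e) ` (UNIV - active_times G L s e) \<longrightarrow> fp e (s, t) \<xi> = 0"
    if st: "(s, t) \<in> od_pairs G" and e: "e \<in> arcs G" and q: "apath s q (tail G e)" for s t e q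
  proof -
    define N where "N = {\<theta>. td.earliest s (head G e) \<theta> < L e (td.earliest s (tail G e) \<theta>)}"
    obtain q' where q': "apath s q' (head G e)"
    proof -
      have "awalk s (q @ [e]) (head G e)"
        using e q by (intro awalk_appendI[OF _ arc_implies_awalk]) (auto simp: apath_def arc_def)
      then show ?thesis using td.shorten_walk that by blast
    qed
    have oN: "open N"
      unfolding N_def
      by (intro open_Collect_less td.earliest_cont[OF q'] continuous_on_compose2[OF td.T_cont[OF e] td.earliest_cont[OF q]]) auto
    \<comment> \<open>The cumulative inflow is the same at the earliest arrivals for
      \<open>a\<close> and \<open>b\<close>, so its density vanishes almost everywhere between them,
      and monotonicity puts the image of \<open>{a..b}\<close> there.\<close>
    have used: "AE \<xi> in lborel. \<xi> \<in> td.earliest s (tail G e) ` {a..b} \<longrightarrow> f c i \<xi> = 0"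
      if ab: "{a..b} \<subseteq> N" and c: "c \<in> Cof (s, t)" and i: "i \<in> I c e" for a b c i
    proof (cases "a \<le> b")
      case True
      have cC: "c \<in> C" "fst c = (s, t)" using c by (auto simp: Cof_def)
      then have P: "apath s (snd c) t" by (auto simp: C_def)
      have ie: "i < length (snd c)" "snd c ! i = e" using i by (auto simp: I_def)
      have fold_L: "fold L P = fold (pc.link_exit X) P" if "set P \<subseteq> arcs G" for P
        by (rule ext, rule List.fold_cong) (use that L in auto)
      have arcs_P: "set P \<subseteq> arcs G" if "apath s P t" for P
        using that by (auto simp: apath_def awalk_def)
      have "X c i (td.earliest s (tail G e) a) = X c i (td.earliest s (tail G e) b)"
      proof (rule td.no_inflow_inactive[OF P _ _ mX[OF cC(1)] _ _ ie(1) True, unfolded ie(2)])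
        show "mono (H c)" "continuous_on UNIV (H c)" using H cC(1) by (auto simp: pc.inflows_def cum_flow_def)
        show "X c i (fold L (take i (snd c)) \<theta>) = H c \<theta>" if "i \<le> length (snd c)" for i \<theta>
          using pc.load_prefix[OF H cC(1) that, of \<theta>] fold_L[of "take i (snd c)"] arcs_P[OF P] set_take_subset[of i "snd c"]
          by (simp add: X_def subset_trans)
        show "fold L (snd c) \<theta> \<le> fold L Q \<theta>" if Q: "apath s Q t" and incr: "\<forall>x<\<theta>. H c x < H c \<theta>" for Q \<theta>
        proof -
          have "((s, t), Q) \<in> C" using Q st by (simp add: C_def)
          then have "((s, t), Q) \<in> pc.peers c" using cC by (simp add: pc.peers_def)
          then have "pc.arrival H c \<theta> \<le> pc.arrival H ((s, t), Q) \<theta>" using H_opt cC(1) incr by blast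
          then show ?thesis
            using fold_L[OF arcs_P[OF P]] fold_L[OF arcs_P[OF Q]] by (simp add: pc.arrival_def X_def)
        qed
        show "td.earliest s (head G e) \<theta> < L e (td.earliest s (tail G e) \<theta>)" if "\<theta> \<in> {a..b}" for \<theta>
          using ab that by (auto simp: N_def)
      qed
      moreover have "density_of (f c i) (X c i)" using f[OF cC(1), of i] ie by simp
      ultimately have "AE \<xi> in lborel. \<xi> \<in> {td.earliest s (tail G e) a..td.earliest s (tail G e) b} \<longrightarrow> f c i \<xi> = 0"
        by (intro density_of_zero)
      then show ?thesis
      proof eventually_elim
        case (elim \<xi>)
        have "td.earliest s (tail G e) ` {a..b} \<subseteq> {td.earliest s (tail G e) a..td.earliest s (tail G e) b}"
          using td.earliest_mono[OF q] by auto
        then show ?case using elim by blast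
      qed
    qed simp
    \<comment> \<open>The open set of inactive departure times is a countable union of compact
      intervals, so the exceptional null sets of the intervals, paths and positions form one null
      set.\<close>
    obtain D where D: "countable D" "D \<subseteq> Pow N" "\<And>Y. Y \<in> D \<Longrightarrow> \<exists>a b. Y = cbox a b" "\<Union>D = N"
      using open_countable_Union_open_cbox[OF oN] by blast
    have "AE \<xi> in lborel. \<forall>Y\<in>D. \<forall>c\<in>Cof (s, t). \<forall>i\<in>I c e. \<xi> \<in> td.earliest s (tail G e) ` Y \<longrightarrow> f c i \<xi> = 0"
    proof (intro AE_ball_countable'[OF _ D(1)] AE_ball_countable'[OF _ countable_finite[OF fin_Cof]]
        AE_ball_countable'[OF _ countable_finite[OF fin_I]])
      fix Y c i assume Y: "Y \<in> D" and ci: "c \<in> Cof (s, t)" "i \<in> I c e"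
      obtain a b where "Y = {a..b}" using D(3)[OF Y] by auto
      then show "AE \<xi> in lborel. \<xi> \<in> td.earliest s (tail G e) ` Y \<longrightarrow> f c i \<xi> = 0"
        using used[OF _ ci, of a b] D(2) Y by auto
    qed
    then have "AE \<xi> in lborel. \<xi> \<in> td.earliest s (tail G e) ` N \<longrightarrow> fp e (s, t) \<xi> = 0"
    proof eventually_elim
      case (elim \<xi>)
      show ?case
      proof
        assume "\<xi> \<in> td.earliest s (tail G e) ` N"
        then obtain Y where "Y \<in> D" "\<xi> \<in> td.earliest s (tail G e) ` Y" using D(4) by blast
        then show "fp e (s, t) \<xi> = 0" using elim by (auto simp: fp_def intro!: sum.neutral)
      qed
    qed
    from AE_completion[OF this] show ?thesis
    proof eventually_elim
      case (elim \<xi>)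
      show ?case
      proof
        assume "ereal \<xi> \<in> earliest_arrival G L s (tail G e) ` (UNIV - active_times G L s e)"
        then obtain \<theta> where "\<theta> \<notin> active_times G L s e" "ereal \<xi> = earliest_arrival G L s (tail G e) \<theta>" by auto
        then have "\<theta> \<in> N" "\<xi> = td.earliest s (tail G e) \<theta>"
          using td.not_active_iff[OF e q] td.earliest_arrival_eq[OF q] by (auto simp: N_def)
        then show "fp e (s, t) \<xi> = 0" using elim by blast
      qed
    qed
  qed

  have "dynamic_equilibrium G \<nu> \<tau> v fp fm"
    unfolding dynamic_equilibrium_def feasible_flow_def Let_def L_def[symmetric]
    using F0 rate conserve oper equi by blast
  then show ?thesis unfolding v_def by blast
qed

end
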